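(* Suppose that $g$ satisfies the two following assumptions: (A1) for some real $\nu>0$ there are constants $C_g\ge C_g'>0$ with $C_g'|\ell|^{-\nu}\le|\gamma_\ell|\le C_g|\ell|^{-\nu}$ for all $\ell\in\mathbb{Z}\setminus\{0\}$; (A2) there are a constant $C>0$ and a real $\alpha>1$ with $g(x)\le\frac{C}{1+|x|^\alpha}$ for all $x\in\mathbb{R}$. Let $\Lambda_0=\{\lambda\in L^2([0,1]):\ \lambda(t)\ge0\text{ for all }t\in[0,1]\}$. Let $1\le p\le\infty$, $1\le q\le\infty$, $A>0$ and assume that $s>2\nu+1$. Then there exists a constant $C_0>0$ (independent of $n$) such that for all sufficiently large $n$ $$\inf_{\hat\lambda_n}\ \sup_{\lambda\in B^s_{p,q}(A)\cap\Lambda_0}\mathbb{E}\|\hat\lambda_n-\lambda\|_2^2\ \ge\ C_0\,n^{-\frac{2s}{2s+2\nu+1}},$$ where the infimum is taken over all estimators $\hat\lambda_n\in L^2([0,1])$, i.e. all measurable mappings of the processes $N^1,\dots,N^n$ with values in $L^2([0,1])$.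
   Context: **Model.** $g$ is a known probability density on $\mathbb{R}$ and $\tau_1,\dots,\tau_n$ are i.i.d. random variables with density $g$ (unobserved). $\lambda:[0,1]\to\mathbb{R}_+$ is in $L^2([0,1])$ and is extended to $\mathbb{R}$ as a 1-periodic function. Conditionally on $\tau_1,\dots,\tau_n$, the observed processes $N^1,\dots,N^n$ are independent Poisson point processes on $[0,1]$ with intensities $t\mapsto\lambda(t-\tau_i)$ with respect to Lebesgue measure. $\mathbb{E}$ is the expectation under this model with intensity $\lambda$, and $\|\cdot\|_2$ is the norm of $L^2([0,1])$. For $\ell\in\mathbb{Z}$, $\gamma_\ell=\int_{\mathbb{R}}g(t)e^{2i\pi\ell t}\,dt$. **Meyer wavelets.** Let $\beta:\mathbb{R}\to[0,1]$ be a $C^\infty$ function with $\beta(x)=0$ for $x\le0$, $\beta(x)=1$ for $x\ge1$, $\beta(x)+\beta(1-x)=1$. The Meyer scaling function $\phi^*$ and wavelet $\psi^*$ on $\mathbb{R}$ have Fourier transforms ($\hat f(\omega)=\int f(x)e^{-i\omega x}dx$): $\hat\phi^*(\omega)=1$ for $|\omega|\le\frac{2\pi}3$, $\cos\left[\frac\pi2\beta\left(\frac{3|\omega|}{2\pi}-1\right)\right]$ for $\frac{2\pi}3\le|\omega|\le\frac{4\pi}3$, $0$ otherwise; $\hat\psi^*(\omega)=e^{-i\omega/2}\sin\left[\frac\pi2\beta\left(\frac{3|\omega|}{2\pi}-1\right)\right]$ for $\frac{2\pi}3\le|\omega|\le\frac{4\pi}3$, $e^{-i\omega/2}\cos\left[\frac\pi2\beta\left(\frac{3|\omega|}{4\pi}-1\right)\right]$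 for $\frac{4\pi}3\le|\omega|\le\frac{8\pi}3$, $0$ otherwise. The periodic Meyer functions on $[0,1]$ are $\phi_{j,k}(t)=2^{j/2}\sum_{m\in\mathbb{Z}}\phi^*(2^j(t+m)-k)$ and $\psi_{j,k}(t)=2^{j/2}\sum_{m\in\mathbb{Z}}\psi^*(2^j(t+m)-k)$, $j\ge0$, $0\le k\le2^j-1$. For any $j_0\ge0$, $\{\phi_{j_0,k}\}_k\cup\{\psi_{j,k}\}_{j\ge j_0,k}$ is an orthonormal basis of $L^2([0,1])$. **Besov ball.** For a fixed coarse level $j_0\ge0$ (not depending on $n$), $B^s_{p,q}(A)$ is the set of $f\in L^2([0,1])$ whose coefficients $c_{j_0,k}=\int_0^1f\phi_{j_0,k}$, $\beta_{j,k}=\int_0^1f\psi_{j,k}$ satisfy $$\Big(\sum_{k=0}^{2^{j_0}-1}|c_{j_0,k}|^p\Big)^{1/p}+\Big(\sum_{j\ge j_0}2^{j(s+1/2-1/p)q}\Big(\sum_{k=0}^{2^j-1}|\beta_{j,k}|^p\Big)^{q/p}\Big)^{1/q}\le A,$$ with sums replaced by suprema if $p=\infty$ or $q=\infty$. *)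

theory Defs
  imports "HOL-Probability.Probability"
begin

subsection \<open>The space $L^2([0,1])$\<close>

text \<open>
  Elements are represented by real functions of which only the restriction to \<open>[0,1]\<close> matters.
  No quotient by almost-everywhere equality is taken; the sets in \<open>L2_open\<close> below are
  automatically saturated for that equivalence, so \<open>L2_borel\<close> is the pull-back of the Borel
  sigma-algebra of the Hilbert space.
\<close>

definition L2_01 :: "(real \<Rightarrow> real) set" where
  "L2_01 = {f. set_borel_measurable lborel {0..1} f \<and>
               set_integrable lborel {0..1} (\<lambda>t. (f t)\<^sup>2)}"

definition L2_norm_01 :: "(real \<Rightarrow> real) \<Rightarrow> real" where
  "L2_norm_01 f = sqrt (LBINT t:{0..1}. (f t)\<^sup>2)"

definition L2_open :: "(real \<Rightarrow> real) set \<Rightarrow> bool" where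
  "L2_open U \<longleftrightarrow> U \<subseteq> L2_01 \<and>
     (\<forall>f\<in>U. \<exists>e>0. \<forall>h\<in>L2_01. L2_norm_01 (\<lambda>t. h t - f t) < e \<longrightarrow> h \<in> U)"

definition L2_borel :: "(real \<Rightarrow> real) measure" where
  "L2_borel = sigma L2_01 {U. L2_open U}"

definition Lambda0 :: "(real \<Rightarrow> real) set" where
  "Lambda0 = {lam \<in> L2_01. \<forall>t\<in>{0..1}. 0 \<le> lam t}"

subsection \<open>Poisson processes on $[0,1]$ and the observation model\<close>

text \<open>
  A realisation of a point process on \<open>[0,1]\<close> is a finite multiset of points of \<open>[0,1]\<close>
  (the intensities considered are integrable). The sigma-algebra is generated by the counts of
  points in Borel sets.
\<close>

definition npoints :: "real set \<Rightarrow> real multiset \<Rightarrow> nat" where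
  "npoints B N = size (filter_mset (\<lambda>x. x \<in> B) N)"

definition configurations :: "real multiset set" where
  "configurations = {N. set_mset N \<subseteq> {0..1}}"

definition config_space :: "real multiset measure" where
  "config_space = sigma configurations
     {{N \<in> configurations. npoints B N = k} | B k. B \<in> sets borel \<and> B \<subseteq> {0..1}}"

text \<open>
  The rate may vanish, a case in which the Poisson distribution is the point mass at \<open>0\<close>
  (with \<open>0 ^ 0 = 1\<close>); this is why \<open>poisson_pmf\<close>, which needs a positive rate,
  is not used.
\<close>

definition poisson_process :: "'a measure \<Rightarrow> ('a \<Rightarrow> real multiset) \<Rightarrow> (real \<Rightarrow> real) \<Rightarrow> bool" where
  "poisson_process M N f \<longleftrightarrow>
     prob_space M \<and> N \<in> M \<rightarrow>\<^sub>M config_space \<and>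
     (\<forall>B k. B \<in> sets borel \<and> B \<subseteq> {0..1} \<longrightarrow>
        measure M {\<omega> \<in> space M. npoints B (N \<omega>) = k} =
          (LBINT t:B. f t) ^ k / fact k * exp (- (LBINT t:B. f t))) \<and>
     (\<forall>(m::nat) B. (\<forall>i<m. B i \<in> sets borel \<and> B i \<subseteq> {0..1}) \<and> disjoint_family_on B {..<m} \<longrightarrow>
        prob_space.indep_vars M (\<lambda>_. count_space UNIV) (\<lambda>i \<omega>. npoints (B i) (N \<omega>)) {..<m})"

text \<open>
  The law is determined because the joint laws of the counts generate the sigma-algebra of
  \<open>config_space\<close>; it exists whenever \<open>f\<close> is nonnegative and integrable on \<open>[0,1]\<close>.
\<close>

definition poisson_law :: "(real \<Rightarrow> real) \<Rightarrow> real multiset measure" where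
  "poisson_law f = (THE P. sets P = sets config_space \<and> poisson_process P (\<lambda>N. N) f)"

definition periodic_ext :: "(real \<Rightarrow> real) \<Rightarrow> real \<Rightarrow> real" where
  "periodic_ext lam t = lam (frac t)"

text \<open>
  The joint law of \<open>N\<^sup>1, \<dots>, N\<^sup>n\<close> (indexed by \<open>0, \<dots>, n - 1\<close>): the shifts are drawn
  independently with density \<open>g\<close>, and given the shifts the processes are drawn independently.
\<close>

definition observation_law :: "(real \<Rightarrow> real) \<Rightarrow> (real \<Rightarrow> real) \<Rightarrow> nat \<Rightarrow> (nat \<Rightarrow> real multiset) measure" where
  "observation_law g lam n =
     PiM {..<n} (\<lambda>_. density lborel (\<lambda>x. ennreal (g x))) \<bind>
       (\<lambda>\<tau>. PiM {..<n} (\<lambda>i. poisson_law (\<lambda>t. periodic_ext lam (t - \<tau> i))))"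

definition estimators :: "nat \<Rightarrow> ((nat \<Rightarrow> real multiset) \<Rightarrow> real \<Rightarrow> real) set" where
  "estimators n = PiM {..<n} (\<lambda>_. config_space) \<rightarrow>\<^sub>M L2_borel"

definition risk :: "(real \<Rightarrow> real) \<Rightarrow> nat \<Rightarrow> ((nat \<Rightarrow> real multiset) \<Rightarrow> real \<Rightarrow> real) \<Rightarrow> (real \<Rightarrow> real) \<Rightarrow> ennreal" where
  "risk g n est lam =
     (\<integral>\<^sup>+ N. ennreal ((L2_norm_01 (\<lambda>t. est N t - lam t))\<^sup>2) \<partial>observation_law g lam n)"

definition gamma_coeff :: "(real \<Rightarrow> real) \<Rightarrow> int \<Rightarrow> complex" where
  "gamma_coeff g l = (LINT t|lborel. complex_of_real (g t) * iexp (2 * pi * of_int l * t))"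

subsection \<open>Periodic Meyer wavelets\<close>

definition meyer_auxiliary :: "(real \<Rightarrow> real) \<Rightarrow> bool" where
  "meyer_auxiliary \<beta> \<longleftrightarrow>
     (\<forall>x. \<beta> x \<in> {0..1}) \<and>
     (\<forall>m x. (deriv ^^ m) \<beta> differentiable (at x)) \<and>
     (\<forall>x\<le>0. \<beta> x = 0) \<and> (\<forall>x\<ge>1. \<beta> x = 1) \<and> (\<forall>x. \<beta> x + \<beta> (1 - x) = 1)"

definition has_fourier_transform :: "(real \<Rightarrow> real) \<Rightarrow> (real \<Rightarrow> complex) \<Rightarrow> bool" where
  "has_fourier_transform f F \<longleftrightarrow> integrable lborel f \<and>
     (\<forall>\<omega>. F \<omega> = (LINT x|lborel. complex_of_real (f x) * iexp (- (\<omega> * x))))"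

definition meyer_scaling_hat :: "(real \<Rightarrow> real) \<Rightarrow> real \<Rightarrow> complex" where
  "meyer_scaling_hat \<beta> \<omega> =
     (if \<bar>\<omega>\<bar> \<le> 2 * pi / 3 then 1
      else if \<bar>\<omega>\<bar> \<le> 4 * pi / 3 then of_real (cos (pi / 2 * \<beta> (3 * \<bar>\<omega>\<bar> / (2 * pi) - 1)))
      else 0)"

definition meyer_wavelet_hat :: "(real \<Rightarrow> real) \<Rightarrow> real \<Rightarrow> complex" where
  "meyer_wavelet_hat \<beta> \<omega> =
     (if \<bar>\<omega>\<bar> < 2 * pi / 3 then 0
      else if \<bar>\<omega>\<bar> \<le> 4 * pi / 3 then
        iexp (- \<omega> / 2) * of_real (sin (pi / 2 * \<beta> (3 * \<bar>\<omega>\<bar> / (2 * pi) - 1)))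
      else if \<bar>\<omega>\<bar> \<le> 8 * pi / 3 then
        iexp (- \<omega> / 2) * of_real (cos (pi / 2 * \<beta> (3 * \<bar>\<omega>\<bar> / (4 * pi) - 1)))
      else 0)"

text \<open>
  The Fourier transform determines an integrable function up to null sets only; continuity selects
  the (smooth, rapidly decaying) Meyer function itself.
\<close>

definition meyer_scaling :: "(real \<Rightarrow> real) \<Rightarrow> (real \<Rightarrow> real) \<Rightarrow> bool" where
  "meyer_scaling \<beta> \<phi> \<longleftrightarrow>
     continuous_on UNIV \<phi> \<and> has_fourier_transform \<phi> (meyer_scaling_hat \<beta>)"

definition meyer_wavelet :: "(real \<Rightarrow> real) \<Rightarrow> (real \<Rightarrow> real) \<Rightarrow> bool" where
  "meyer_wavelet \<beta> \<psi> \<longleftrightarrow>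
     continuous_on UNIV \<psi> \<and> has_fourier_transform \<psi> (meyer_wavelet_hat \<beta>)"

definition periodized :: "(real \<Rightarrow> real) \<Rightarrow> nat \<Rightarrow> nat \<Rightarrow> real \<Rightarrow> real" where
  "periodized w j k t =
     2 powr (real j / 2) * (\<Sum>\<^sub>\<infinity>m\<in>(UNIV::int set). w (2 ^ j * (t + of_int m) - real k))"

subsection \<open>Besov balls\<close>

text \<open>
  The \<open>\<ell>\<^sup>p\<close> norm over an index set for \<open>1 \<le> p \<le> \<infinity>\<close>, with values in \<open>[0, \<infinity>]\<close>.
  For infinite \<open>p\<close>, \<open>enn2real (1 / p) = 0\<close>.
\<close>

definition lp_norm :: "ennreal \<Rightarrow> 'i set \<Rightarrow> ('i \<Rightarrow> real) \<Rightarrow> ennreal" where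
  "lp_norm p I a =
     (if p = \<infinity> then (SUP i\<in>I. ennreal \<bar>a i\<bar>)
      else let S = (\<Sum>\<^sub>\<infinity>i\<in>I. ennreal (\<bar>a i\<bar> powr enn2real p))
           in if S = \<infinity> then \<infinity> else ennreal (enn2real S powr enn2real (1 / p)))"

definition wavelet_coeff :: "(real \<Rightarrow> real) \<Rightarrow> (real \<Rightarrow> real) \<Rightarrow> nat \<Rightarrow> nat \<Rightarrow> real" where
  "wavelet_coeff w f j k = (LBINT t:{0..1}. f t * periodized w j k t)"

text \<open>The \<open>\<ell>\<^sup>p\<close> norms at a fixed level are finite, so the inner \<open>enn2real\<close> loses nothing.\<close>

definition besov_norm ::
  "(real \<Rightarrow> real) \<Rightarrow> (real \<Rightarrow> real) \<Rightarrow> nat \<Rightarrow> real \<Rightarrow> ennreal \<Rightarrow> ennreal \<Rightarrow> (real \<Rightarrow> real) \<Rightarrow> ennreal" where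
  "besov_norm \<phi> \<psi> j0 s p q f =
     lp_norm p {..<2 ^ j0} (wavelet_coeff \<phi> f j0) +
     lp_norm q {j0..} (\<lambda>j. 2 powr (real j * (s + 1 / 2 - enn2real (1 / p))) *
                            enn2real (lp_norm p {..<2 ^ j} (wavelet_coeff \<psi> f j)))"

definition besov_ball ::
  "(real \<Rightarrow> real) \<Rightarrow> (real \<Rightarrow> real) \<Rightarrow> nat \<Rightarrow> real \<Rightarrow> ennreal \<Rightarrow> ennreal \<Rightarrow> real \<Rightarrow> (real \<Rightarrow> real) set" where
  "besov_ball \<phi> \<psi> j0 s p q A = {f \<in> L2_01. besov_norm \<phi> \<psi> j0 s p q f \<le> ennreal A}"

end

theory Submission
  imports Defs
begin

text \<open>
  The intensities compared are perturbations of a constant \<open>\<rho>\<close> by sums of the bumps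
  \<open>e * K (t - k / M)\<close>, \<open>k < M\<close>, indexed by the vertices of a hypercube; here \<open>K\<close> is the Fejer kernel
  of degree \<open>M - 1\<close> times \<open>cos (4 * pi * M * t)\<close>. All frequencies of \<open>K\<close> lie strictly between \<open>M\<close> and
  \<open>3 * M\<close>, so that only the at most four dyadic levels comparable with \<open>M\<close> contribute to the Besov
  norm, whatever \<open>p\<close> and \<open>q\<close>, and averaging over the shifts damps \<open>K\<close> by the factor \<open>M powr - \<nu>\<close>.
  Positivity of the Fejer kernel, whose translates by \<open>k / M\<close> add up to the constant \<open>M\<close>, bounds the
  perturbations uniformly and yields a Bessel inequality for the bumps.

  A Poisson law with intensity \<open>\<lambda>\<close> has density \<open>\<Prod>x\<in>#N. \<lambda> x / \<rho>\<close> with respect to the one of constant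
  rate \<open>\<rho>\<close>, as long as both have the same total mass. The Laplace functional then gives the second
  moments of the mixed densities as integrals of exponentials of correlations of the perturbations.
  To first order the chi-square distance between two neighbours is the squared norm of the smoothed
  bump; the remaining terms are of order \<open>M powr (- 4 * s)\<close> and negligible because
  \<open>s > 2 * \<nu> + 1\<close>. With \<open>e * M\<close> of order \<open>M powr - s\<close> and \<open>M powr (2 * s + 2 * \<nu> + 1)\<close> of order \<open>n\<close>,
  neighbours cannot be distinguished from \<open>n\<close> observations, and averaging the risk over the
  hypercube gives the bound.
\<close>

text \<open>Trigonometric bumps are preferred to wavelets as perturbations because the shifts act on
  frequencies: averaging over them multiplies the Fourier coefficient of index \<open>l\<close> by a
  factor of modulus \<open>cmod (gamma_coeff g l)\<close>, and a cosine has vanishing wavelet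
  coefficients wherever the compactly supported Meyer transform is zero. The price is that the
  translates of a bump are not orthogonal, so a coordinate of the hypercube is read off by an inner
  product with a bump, and a Bessel inequality replaces Parseval. The carrier keeps the frequencies
  away from zero, so that every shifted intensity has the same mass. The other obstacle is that
  \<open>poisson_law\<close> is a definite description: a law must be built and shown unique before
  anything is known about it. Both tasks go through the functionals
  \<open>\<Prod>x\<in>#N. h x\<close>, which contain generating functions of counts, densities and
  second moments alike.\<close>

section \<open>Counting points in configurations\<close>

lemma space_config: "space config_space = configurations"
  unfolding config_space_def by (rule space_measure_of) auto

lemma sets_config: "sets config_space = sigma_sets configurations
     {{N \<in> configurations. npoints B N = k} | B k. B \<in> sets borel \<and> B \<subseteq> {0..1}}"
  unfolding config_space_def by (rule sets_measure_of) auto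

lemma npoints_simps [simp]: "npoints B {#} = 0"
  "npoints B (add_mset x N) = (if x \<in> B then Suc (npoints B N) else npoints B N)"
  by (auto simp: npoints_def)

lemma npoints_restrict: "N \<in> configurations \<Longrightarrow> npoints (B \<inter> {0..1}) N = npoints B N"
  unfolding npoints_def configurations_def
  by (intro arg_cong[where f=size] filter_mset_cong) auto

text \<open>The generating events use Borel subsets of the unit interval; a configuration has no
  points elsewhere, so any Borel set may be replaced by its trace.\<close>

lemma measurable_npoints [measurable]:
  assumes "B \<in> sets borel"
  shows "npoints B \<in> config_space \<rightarrow>\<^sub>M count_space UNIV"
proof (rule measurable_count_space_eq2_countable[THEN iffD2], safe)
  fix k :: nat
  have "npoints B -` {k} \<inter> space config_space = {N \<in> configurations. npoints (B \<inter> {0..1}) N = k}"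
    by (auto simp: space_config npoints_restrict)
  also have "\<dots> \<in> sets config_space"
    unfolding sets_config using assms by (intro sigma_sets.Basic CollectI exI[of _ "B \<inter> {0..1}"] exI[of _ k]) auto
  finally show "npoints B -` {k} \<inter> space config_space \<in> sets config_space" .
qed auto

text \<open>Grouping the points by the value of \<open>h\<close> leaves finitely many counts, which
  is what \<open>config_space\<close> makes measurable and what the Poisson axioms describe.\<close>

lemma prod_mset_finite_range:
  fixes h :: "real \<Rightarrow> real"
  assumes "finite (range h)"
  shows "(\<Prod>x\<in>#N. h x) = (\<Prod>v\<in>range h. v ^ npoints (h -` {v}) N)"
proof (induction N)
  case (add x N)
  have "(\<Prod>v\<in>range h. v ^ npoints (h -` {v}) (add_mset x N)) =
    (\<Prod>v\<in>range h. (if h x = v then v else 1) * v ^ npoints (h -` {v}) N)"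
    by (intro prod.cong) auto
  also have "\<dots> = h x * (\<Prod>v\<in>range h. v ^ npoints (h -` {v}) N)"
    using assms by (simp add: prod.distrib prod.delta')
  finally show ?case using add by simp
qed auto

text \<open>Thus the generating function of counts in possibly overlapping sets is again the
  integral of a multiplicative functional.\<close>

lemma prod_mset_indicators:
  fixes z :: "'i \<Rightarrow> real"
  shows "(\<Prod>x\<in>#N. \<Prod>i\<in>I. if x \<in> B i then z i else 1) = (\<Prod>i\<in>I. z i ^ npoints (B i) N)"
proof (induction N)
  case (add x N)
  have "(\<Prod>i\<in>I. z i ^ npoints (B i) (add_mset x N)) =
    (\<Prod>i\<in>I. (if x \<in> B i then z i else 1) * z i ^ npoints (B i) N)"
    by (intro prod.cong) auto
  then show ?case using add by (simp add: prod.distrib)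
qed auto

lemma tendsto_prod_mset:
  fixes h :: "'a \<Rightarrow> 'b \<Rightarrow> real"
  assumes "\<And>x. x \<in># N \<Longrightarrow> ((\<lambda>n. h n x) \<longlongrightarrow> l x) F"
  shows "((\<lambda>n. \<Prod>x\<in>#N. h n x) \<longlongrightarrow> (\<Prod>x\<in>#N. l x)) F"
  using assms by (induction N) (auto intro!: tendsto_mult)

text \<open>Simple functions approximate \<open>h\<close> pointwise, and a product over a finite
  multiset is continuous in its factors; for simple functions the product is a function of
  counts.\<close>

lemma measurable_prod_mset [measurable]:
  fixes h :: "real \<Rightarrow> real"
  assumes h: "h \<in> borel_measurable borel"
  shows "(\<lambda>N. \<Prod>x\<in>#N. h x) \<in> borel_measurable config_space"
proof -
  from borel_measurable_implies_sequence_metric[OF h, of 0] obtain s where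
    s: "\<And>i. simple_function borel (s i)" "\<And>x. (\<lambda>i. s i x) \<longlonglongrightarrow> h x" by auto
  show ?thesis
  proof (rule borel_measurable_LIMSEQ_metric[where f="\<lambda>i N. \<Prod>x\<in>#N. s i x"])
    fix i
    have fin: "finite (range (s i))" using s(1)[of i] by (auto simp: simple_function_def)
    have m: "s i -` {v} \<in> sets borel" for v
      using simple_functionD(2)[OF s(1), of i "{v}"] by simp
    show "(\<lambda>N. \<Prod>x\<in>#N. s i x) \<in> borel_measurable config_space"
      unfolding prod_mset_finite_range[OF fin]
    proof (intro borel_measurable_prod)
      fix v
      note [measurable] = measurable_npoints[OF m[of v]]
      show "(\<lambda>N. v ^ npoints (s i -` {v}) N) \<in> borel_measurable config_space" by measurable
    qed
  qed (auto intro!: tendsto_prod_mset s)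
qed

section \<open>Laws of count vectors from their generating functions\<close>

text \<open>The identity is available on the unit interval only. If the first \<open>k\<close>
  coefficients of the difference vanish, dividing by \<open>z ^ k\<close> leaves a power series
  \<open>G\<close> that is zero on the open interval and continuous at \<open>0\<close>, so its
  constant term is zero too.\<close>

lemma power_series_unique:
  fixes a b :: "nat \<Rightarrow> real"
  assumes a: "\<And>z. 0 \<le> z \<Longrightarrow> z \<le> 1 \<Longrightarrow> (\<lambda>k. a k * z ^ k) sums S z"
    and b: "\<And>z. 0 \<le> z \<Longrightarrow> z \<le> 1 \<Longrightarrow> (\<lambda>k. b k * z ^ k) sums S z"
  shows "a k = b k"
proof -
  define c where "c k = a k - b k" for k
  have c: "(\<lambda>k. c k * z ^ k) sums 0" if "0 \<le> z" "z \<le> 1" for z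
    using sums_diff[OF a[OF that] b[OF that]] by (simp add: c_def algebra_simps)
  have "c k = 0" for k
  proof (induction k rule: less_induct)
    case (less k)
    define G where "G z = (\<Sum>i. c (i + k) * z ^ i)" for z
    \<comment> \<open>Convergence at \<open>1\<close> gives a positive radius of convergence, hence
      continuity of \<open>G\<close> at \<open>0\<close>.\<close>
    have sm: "summable (\<lambda>i. c (i + k) * 1 ^ i)"
      using sums_summable[OF c[of 1]] summable_iff_shift[of c k] by simp
    have G0: "G z = 0" if "0 < z" "z < 1" for z
    proof -
      have "(\<lambda>i. c (i + k) * z ^ (i + k)) sums (0 - (\<Sum>i<k. c i * z ^ i))"
        using sums_split_initial_segment[OF c[of z], of k] that by simp
      moreover have "(\<Sum>i<k. c i * z ^ i) = 0" using less by (intro sum.neutral) auto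
      ultimately have "(\<lambda>i. (c (i + k) * z ^ (i + k)) / z ^ k) sums (0 / z ^ k)"
        by (intro sums_divide) simp
      then have "(\<lambda>i. c (i + k) * z ^ i) sums 0"
        using that by (simp add: power_add)
      then show ?thesis unfolding G_def by (simp add: sums_iff)
    qed
    have "isCont G 0" unfolding G_def by (rule isCont_powser[OF sm]) simp
    then have "(G \<longlongrightarrow> G 0) (at_right 0)"
      by (simp add: isCont_def filterlim_at_split)
    moreover have "(G \<longlongrightarrow> 0) (at_right 0)"
      by (rule tendsto_eventually) (auto simp: eventually_at_right[of 0 1] G0 intro!: exI[of _ 1])
    ultimately have "G 0 = 0" by (rule tendsto_unique[rotated]) simp
    moreover have "G 0 = c k" unfolding G_def using powser_zero[of "\<lambda>i. c (i + k)"] by simp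
    ultimately show ?case by simp
  qed
  then show ?thesis by (simp add: c_def)
qed

text \<open>The weight \<open>Y\<close> carries the remaining coordinates when several counts are
  treated in turn.\<close>

lemma nn_integral_pgf:
  assumes X [measurable]: "X \<in> M \<rightarrow>\<^sub>M count_space (UNIV :: nat set)"
    and Y [measurable]: "Y \<in> borel_measurable M"
  shows "(\<integral>\<^sup>+w. ennreal (z ^ X w) * Y w \<partial>M) = (\<Sum>k. ennreal (z ^ k) * (\<integral>\<^sup>+w. of_bool (X w = k) * Y w \<partial>M))"
proof -
  have "ennreal (z ^ X w) * Y w = (\<Sum>k. ennreal (z ^ k) * (of_bool (X w = k) * Y w))" for w
    by (subst suminf_finite[of "{X w}"]) auto
  then show ?thesis
    by (subst nn_integral_cong, assumption, subst nn_integral_suminf)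
       (auto simp: nn_integral_cmult)
qed

text \<open>The probability generating function determines the law, one coordinate at a time.\<close>

lemma pgf_step:
  assumes X [measurable]: "X \<in> M \<rightarrow>\<^sub>M count_space (UNIV :: nat set)" "X' \<in> M' \<rightarrow>\<^sub>M count_space UNIV"
    and Y [measurable]: "Y \<in> borel_measurable M" "Y' \<in> borel_measurable M'"
    and eq: "\<And>z. 0 \<le> z \<Longrightarrow> z \<le> 1 \<Longrightarrow>
      (\<integral>\<^sup>+w. ennreal (z ^ X w) * Y w \<partial>M) = (\<integral>\<^sup>+w. ennreal (z ^ X' w) * Y' w \<partial>M')"
    and fin: "(\<integral>\<^sup>+w. Y w \<partial>M) < \<infinity>"
  shows "(\<integral>\<^sup>+w. of_bool (X w = k) * Y w \<partial>M) = (\<integral>\<^sup>+w. of_bool (X' w = k) * Y' w \<partial>M')"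
proof -
  define a where "a k = (\<integral>\<^sup>+w. of_bool (X w = k) * Y w \<partial>M)" for k
  define b where "b k = (\<integral>\<^sup>+w. of_bool (X' w = k) * Y' w \<partial>M')" for k
  define S where "S z = (\<integral>\<^sup>+w. ennreal (z ^ X w) * Y w \<partial>M)" for z
  have Sa: "(\<Sum>k. ennreal (z ^ k) * a k) = S z" for z
    unfolding a_def S_def by (rule nn_integral_pgf[symmetric]) auto
  have Sb: "(\<Sum>k. ennreal (z ^ k) * b k) = S z" if "0 \<le> z" "z \<le> 1" for z
    unfolding b_def S_def eq[OF that] by (rule nn_integral_pgf[symmetric]) auto
  have Sfin: "S z < \<infinity>" if "0 \<le> z" "z \<le> 1" for z
  proof -
    have "S z \<le> (\<integral>\<^sup>+w. Y w \<partial>M)" unfolding S_def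
    proof (intro nn_integral_mono)
      fix w
      have "ennreal (z ^ X w) * Y w \<le> ennreal 1 * Y w"
        using that by (intro mult_right_mono ennreal_leI) (auto simp: power_le_one)
      then show "ennreal (z ^ X w) * Y w \<le> Y w" by simp
    qed
    with fin show ?thesis by (simp add: le_less_trans)
  qed
  \<comment> \<open>Finiteness at \<open>z = 1\<close> bounds every coefficient, so the series can
    be moved from extended to real numbers, where uniqueness of coefficients is known.\<close>
  have key: "(\<lambda>k. enn2real (d k) * z ^ k) sums enn2real (S z) \<and> (\<forall>k. d k < \<infinity>)"
    if z: "0 \<le> z" "z \<le> 1" and S1: "(\<Sum>k. ennreal (1 ^ k) * d k) = S 1"
      and Sz: "(\<Sum>k. ennreal (z ^ k) * d k) = S z" for d z
  proof -
    have "d k \<le> (\<Sum>k. d k)" for k using sum_le_suminf[of d "{k}"] by (simp)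
    then have f: "d k < \<infinity>" for k
      by (rule le_less_trans) (use S1 Sfin[of 1] in simp)
    have "ennreal (enn2real (d k) * z ^ k) = ennreal (z ^ k) * d k" for k
      using f[of k] z by (simp add: ennreal_mult' mult.commute[of "d k"])
    then have "(\<lambda>k. ennreal (enn2real (d k) * z ^ k)) sums S z"
      unfolding Sz[symmetric] by (simp add: summable_sums)
    also have "S z = ennreal (enn2real (S z))" using Sfin[OF z] by simp
    finally show ?thesis using z f by (subst (asm) sums_ennreal) auto
  qed
  have "enn2real (a k) = enn2real (b k)"
    by (rule power_series_unique[where S="\<lambda>z. enn2real (S z)"])
       (blast intro: key[OF _ _ Sa Sa, THEN conjunct1] key[OF _ _ Sb Sb, THEN conjunct1] zero_le_one order_refl)+
  moreover have "a k < \<infinity>" "b k < \<infinity>"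
    using key[OF zero_le_one order_refl Sa Sa] key[OF zero_le_one order_refl Sb Sb] by auto
  ultimately have "a k = b k" by (metis ennreal_enn2real infinity_ennreal_def)
  then show ?thesis by (simp add: a_def b_def)
qed

lemma pgf_joint:
  fixes X :: "nat \<Rightarrow> 'a \<Rightarrow> nat" and X' :: "nat \<Rightarrow> 'b \<Rightarrow> nat"
  assumes X: "\<And>i. i < m \<Longrightarrow> X i \<in> M \<rightarrow>\<^sub>M count_space UNIV"
      "\<And>i. i < m \<Longrightarrow> X' i \<in> M' \<rightarrow>\<^sub>M count_space UNIV"
    and fin: "finite_measure M"
    and eq: "\<And>z. (\<And>i. 0 \<le> z i \<and> z i \<le> 1) \<Longrightarrow>
      (\<integral>\<^sup>+w. ennreal (\<Prod>i<m. z i ^ X i w) \<partial>M) = (\<integral>\<^sup>+w. ennreal (\<Prod>i<m. z i ^ X' i w) \<partial>M')"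
  shows "(\<integral>\<^sup>+w. (\<Prod>i<m. of_bool (X i w = k i)) \<partial>M) = (\<integral>\<^sup>+w. (\<Prod>i<m. of_bool (X' i w = k i)) \<partial>M')"
proof -
  interpret finite_measure M by fact
  \<comment> \<open>\<open>F\<close> interpolates: coordinates below \<open>r\<close> are already
    point events, the others are still powers. The case \<open>r = 0\<close> is the hypothesis and
    \<open>r = m\<close> the claim.\<close>
  define F where "F z r i (x :: nat) = (if i < r then of_bool (x = k i) else ennreal (z i ^ x))" for z r i x
  have F_le: "F z r i x \<le> 1" if "0 \<le> z i \<and> z i \<le> 1" for z r i x
    using that by (auto simp: F_def power_le_one of_bool_def)
  have *: "(\<integral>\<^sup>+w. (\<Prod>i<m. F z r i (X i w)) \<partial>M) = (\<integral>\<^sup>+w. (\<Prod>i<m. F z r i (X' i w)) \<partial>M')"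
    if "r \<le> m" "\<And>i. 0 \<le> z i \<and> z i \<le> 1" for r z
    using that
  proof (induction r arbitrary: z)
    case 0
    then show ?case using eq[of z] by (simp add: F_def prod_ennreal)
  next
    case (Suc r)
    let ?J = "{..<m} - {r}"
    have split: "(\<Prod>i<m. f i) = f r * (\<Prod>i\<in>?J. f i)" for f :: "nat \<Rightarrow> ennreal"
      using Suc.prems(1) by (subst prod.remove[of _ r]) auto
    \<comment> \<open>Only the argument of index \<open>r\<close> is varied. The induction
      hypothesis is general in \<open>z\<close>, so it holds for all \<open>t\<close> in the unit
      interval, and the remaining factors serve as the weight in \<open>pgf_step\<close>.\<close>
    have upd: "(\<Prod>i<m. F (z(r := t)) r i (X i)) = ennreal (t ^ X r) * (\<Prod>i\<in>?J. F z r i (X i))"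
      for X :: "nat \<Rightarrow> nat" and t
      unfolding split by (intro arg_cong2[where f="(*)"] prod.cong) (auto simp: F_def)
    have nxt: "(\<Prod>i<m. F z (Suc r) i (X i)) = of_bool (X r = k r) * (\<Prod>i\<in>?J. F z r i (X i))"
      for X :: "nat \<Rightarrow> nat"
      unfolding split by (intro arg_cong2[where f="(*)"] prod.cong) (auto simp: F_def)
    have rm: "r < m" using Suc.prems by simp
    have Fm: "(\<lambda>w. \<Prod>i\<in>?J. F z r i (X i w)) \<in> borel_measurable L"
      if "\<And>i. i < m \<Longrightarrow> X i \<in> L \<rightarrow>\<^sub>M count_space UNIV" for X :: "nat \<Rightarrow> 'c \<Rightarrow> nat" and L
    proof (intro borel_measurable_prod_ennreal)
      fix i assume "i \<in> ?J"
      then have [measurable]: "X i \<in> L \<rightarrow>\<^sub>M count_space UNIV" by (intro that) simp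
      show "(\<lambda>w. F z r i (X i w)) \<in> borel_measurable L" by measurable
    qed
    show ?case unfolding nxt
    proof (rule pgf_step)
      fix t :: real assume t: "0 \<le> t" "t \<le> 1"
      show "(\<integral>\<^sup>+w. ennreal (t ^ X r w) * (\<Prod>i\<in>?J. F z r i (X i w)) \<partial>M) =
            (\<integral>\<^sup>+w. ennreal (t ^ X' r w) * (\<Prod>i\<in>?J. F z r i (X' i w)) \<partial>M')"
      proof -
        have "0 \<le> (z(r := t)) i \<and> (z(r := t)) i \<le> 1" for i using Suc.prems(2)[of i] t by simp
        from Suc.IH[of "z(r := t)", OF less_imp_le[OF rm] this] show ?thesis by (simp only: upd)
      qed
    next
      have "(\<integral>\<^sup>+w. (\<Prod>i\<in>?J. F z r i (X i w)) \<partial>M) \<le> (\<integral>\<^sup>+w. 1 \<partial>M)"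
        by (intro nn_integral_mono prod_le_1) (use Suc.prems(2) F_le in simp)
      then show "(\<integral>\<^sup>+w. (\<Prod>i\<in>?J. F z r i (X i w)) \<partial>M) < \<infinity>"
        by (rule le_less_trans) (use emeasure_finite[of "space M"] in \<open>simp add: less_top[symmetric]\<close>)
    next
      show "X r \<in> M \<rightarrow>\<^sub>M count_space UNIV" "X' r \<in> M' \<rightarrow>\<^sub>M count_space UNIV"
        by (fact X(1)[OF rm], fact X(2)[OF rm])
      show "(\<lambda>w. \<Prod>i\<in>?J. F z r i (X i w)) \<in> borel_measurable M"
        using X(1) by (rule Fm)
      show "(\<lambda>w. \<Prod>i\<in>?J. F z r i (X' i w)) \<in> borel_measurable M'"
        using X(2) by (rule Fm)
    qed
  qed
  have "(\<Prod>i<m. F z m i (x i)) = (\<Prod>i<m. of_bool (x i = k i))" for z x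
    by (intro prod.cong) (auto simp: F_def)
  then show ?thesis using *[of m "\<lambda>_. 0"] by simp
qed

section \<open>Uniqueness of the Poisson law\<close>

lemma npoints_level_sets:
  assumes "finite (range h)" "N \<in> configurations"
  shows "(\<Prod>x\<in>#N. h x) = (\<Prod>v\<in>range h. (v :: real) ^ npoints (h -` {v} \<inter> {0..1}) N)"
  using prod_mset_finite_range[OF assms(1), of N] assms(2) by (simp add: npoints_restrict)

text \<open>For a Poisson process the law of the counts in arbitrary (overlapping) sets is
  determined by the counts in the level sets of a step function, which are disjoint.\<close>

lemma poisson_process_pgf_determined:
  assumes P: "poisson_process P (\<lambda>N. N) f" and Q: "poisson_process Q (\<lambda>N. N) f"
    and sP: "sets P = sets config_space" and sQ: "sets Q = sets config_space"
    and h: "h \<in> borel_measurable borel" "finite (range h)" "\<And>x. 0 \<le> (h x :: real)"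
  shows "(\<integral>\<^sup>+N. ennreal (\<Prod>x\<in>#N. h x) \<partial>P) = (\<integral>\<^sup>+N. ennreal (\<Prod>x\<in>#N. h x) \<partial>Q)"
proof -
  \<comment> \<open>An injective enumeration of the values, since independence in
    \<open>poisson_process\<close> is stated for families indexed by an initial segment.\<close>
  obtain m v where v: "range h = v ` {i::nat. i < m}" "inj_on v {i. i < m}"
    using finite_imp_nat_seg_image_inj_on[OF h(2)] by metis
  define B where "B i = h -` {v i} \<inter> {0..1}" for i
  define q where "q i X = (\<Sum>k. ennreal (v i ^ k) * ennreal (X i k))" for i :: nat and X :: "nat \<Rightarrow> nat \<Rightarrow> real"
  have v0: "0 \<le> v i" if "i < m" for i
    using v(1) h(3) that by (metis (mono_tags, lifting) imageI mem_Collect_eq rangeE)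
  have B: "B i \<in> sets borel" "B i \<subseteq> {0..1}" for i
    using measurable_sets[OF h(1), of "{v i}"] by (auto simp: B_def)
  have disj: "disjoint_family_on B {..<m}"
    using v(2) by (auto simp: disjoint_family_on_def B_def inj_on_def)
  \<comment> \<open>The right-hand side mentions only \<open>f\<close> and \<open>h\<close>, so it
    is common to both laws; the level sets are disjoint, hence their counts are independent with
    known marginals.\<close>
  have *: "(\<integral>\<^sup>+N. ennreal (\<Prod>x\<in>#N. h x) \<partial>R) = 
     (\<Prod>i<m. \<Sum>k. ennreal (v i ^ k) * ennreal ((LBINT t:B i. f t) ^ k / fact k * exp (- (LBINT t:B i. f t))))"
    if R: "poisson_process R (\<lambda>N. N) f" and sR: "sets R = sets config_space" for R
  proof -
    interpret prob_space R using R by (simp add: poisson_process_def)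
    note spR = sets_eq_imp_space_eq[OF sR]
    have m[measurable]: "npoints (B i) \<in> R \<rightarrow>\<^sub>M count_space UNIV" for i
      using measurable_npoints[OF B(1)] by (subst measurable_cong_sets[OF sR refl])
    have ind: "indep_vars (\<lambda>_. count_space UNIV) (\<lambda>i N. npoints (B i) N) {..<m}"
      using R[unfolded poisson_process_def, THEN conjunct2, THEN conjunct2, THEN conjunct2, rule_format, of m B]
        B disj by simp
    have "(\<integral>\<^sup>+N. ennreal (\<Prod>x\<in>#N. h x) \<partial>R) = (\<integral>\<^sup>+N. (\<Prod>i<m. ennreal (v i ^ npoints (B i) N)) \<partial>R)"
    proof (intro nn_integral_cong)
      fix N assume "N \<in> space R"
      then have "N \<in> configurations" by (simp add: spR space_config)
      then have "(\<Prod>x\<in>#N. h x) = (\<Prod>w\<in>v ` {i. i < m}. w ^ npoints (h -` {w} \<inter> {0..1}) N)"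
        using npoints_level_sets[OF h(2)] by (simp only: v(1))
      also have "\<dots> = (\<Prod>i<m. v i ^ npoints (B i) N)"
        using v(2) by (subst prod.reindex) (simp_all add: B_def lessThan_def)
      finally show "ennreal (\<Prod>x\<in>#N. h x) = (\<Prod>i<m. ennreal (v i ^ npoints (B i) N))"
        using v0 by (subst prod_ennreal) auto
    qed
    also have "\<dots> = (\<Prod>i<m. \<integral>\<^sup>+N. ennreal (v i ^ npoints (B i) N) \<partial>R)"
      by (rule indep_vars_nn_integral)
         (auto intro!: indep_vars_compose2[OF ind])
    also have "\<dots> = (\<Prod>i<m. \<Sum>k. ennreal (v i ^ k) * ennreal ((LBINT t:B i. f t) ^ k / fact k * exp (- (LBINT t:B i. f t))))"
    proof (intro prod.cong refl)
      fix i
      have point: "(\<integral>\<^sup>+N. of_bool (npoints (B i) N = k) * 1 \<partial>R) = 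
        ennreal ((LBINT t:B i. f t) ^ k / fact k * exp (- (LBINT t:B i. f t)))" for k
      proof -
        have "(\<integral>\<^sup>+N. of_bool (npoints (B i) N = k) * 1 \<partial>R) = 
          (\<integral>\<^sup>+N. indicator {N \<in> space R. npoints (B i) N = k} N \<partial>R)"
          by (intro nn_integral_cong) (auto simp: indicator_def)
        also have "\<dots> = emeasure R {N \<in> space R. npoints (B i) N = k}"
          by (rule nn_integral_indicator) measurable
        finally show ?thesis using R B unfolding poisson_process_def
          by (simp add: emeasure_eq_measure)
      qed
      have "(\<integral>\<^sup>+N. ennreal (v i ^ npoints (B i) N) * 1 \<partial>R) = 
        (\<Sum>k. ennreal (v i ^ k) * (\<integral>\<^sup>+N. of_bool (npoints (B i) N = k) * 1 \<partial>R))"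
        by (rule nn_integral_pgf) auto
      then show "(\<integral>\<^sup>+N. ennreal (v i ^ npoints (B i) N) \<partial>R) = (\<Sum>k. ennreal (v i ^ k) * ennreal ((LBINT t:B i. f t) ^ k / fact k * exp (- (LBINT t:B i. f t))))"
        by (simp only: point) simp
    qed
    finally show ?thesis .
  qed
  show ?thesis unfolding *[OF P sP] *[OF Q sQ] ..
qed

text \<open>Single count constraints generate the sigma-algebra but are not closed under
  intersection. Finite lists of constraints are: two lists are concatenated.\<close>

lemma count_events_Int_stable:
  "Int_stable {{N \<in> configurations. \<forall>i<m. npoints (B i) N = k i} | m (B :: nat \<Rightarrow> _) k. \<forall>i. B i \<in> sets borel \<and> B i \<subseteq> {0..1}}"
    (is "Int_stable ?E")
proof (rule Int_stableI)
  fix a b assume "a \<in> ?E" "b \<in> ?E"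
  then obtain m :: nat and B k and m' :: nat and B' k' where
    a: "a = {N \<in> configurations. \<forall>i<m. npoints (B i) N = k i}" "\<forall>i. B i \<in> sets borel \<and> B i \<subseteq> {0..1}" and
    b: "b = {N \<in> configurations. \<forall>i<m'. npoints (B' i) N = k' i}" "\<forall>i. B' i \<in> sets borel \<and> B' i \<subseteq> {0..1}" by blast
  define C where "C i = (if i < m then B i else B' (i - m))" for i
  define l where "l i = (if i < m then k i else k' (i - m))" for i
  have "(\<forall>i<m + m'. npoints (C i) N = l i) \<longleftrightarrow>
      (\<forall>i<m. npoints (B i) N = k i) \<and> (\<forall>i<m'. npoints (B' i) N = k' i)" (is "?L \<longleftrightarrow> ?R") for N
  proof
    assume L: ?L
    show ?R
    proof (intro conjI allI impI)
      fix i assume "i < m" then show "npoints (B i) N = k i" using L[rule_format, of i] by (simp add: C_def l_def)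
    next
      fix i assume "i < m'" then show "npoints (B' i) N = k' i" using L[rule_format, of "m + i"] by (simp add: C_def l_def)
    qed
  qed (auto simp: C_def l_def)
  then have "a \<inter> b = {N \<in> configurations. \<forall>i<m + m'. npoints (C i) N = l i}"
    unfolding a b by auto
  moreover have "\<forall>i. C i \<in> sets borel \<and> C i \<subseteq> {0..1}" using a(2) b(2) by (simp add: C_def)
  ultimately show "a \<inter> b \<in> ?E" by blast
qed

text \<open>The independence axiom covers disjoint sets only, while the events of the generator
  involve overlapping ones. Their joint generating function is the integral of a multiplicative
  functional of a step function, which the axioms determine; its coefficients are the probabilities
  of the events.\<close>

lemma poisson_process_unique:
  assumes P: "poisson_process P (\<lambda>N. N) f" and Q: "poisson_process Q (\<lambda>N. N) f"
    and sP: "sets P = sets config_space" and sQ: "sets Q = sets config_space"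
  shows "P = Q"
proof -
  interpret P: prob_space P using P by (simp add: poisson_process_def)
  interpret Q: prob_space Q using Q by (simp add: poisson_process_def)
  note spP = sets_eq_imp_space_eq[OF sP] and spQ = sets_eq_imp_space_eq[OF sQ]
  let ?E = "{{N \<in> configurations. \<forall>i<m. npoints (B i) N = k i} | m (B :: nat \<Rightarrow> _) k. \<forall>i. B i \<in> sets borel \<and> B i \<subseteq> {0..1}}"
  have Esets: "?E \<subseteq> sets config_space"
  proof safe
    fix m k and B :: "nat \<Rightarrow> real set" assume B: "\<forall>i. B i \<in> sets borel \<and> B i \<subseteq> {0..1}"
    then have [measurable]: "npoints (B i) \<in> config_space \<rightarrow>\<^sub>M count_space UNIV" for i
      by (intro measurable_npoints) auto
    have "{N \<in> space config_space. \<forall>i\<in>{..<m}. npoints (B i) N = k i} \<in> sets config_space"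
      by measurable
    also have "{N \<in> space config_space. \<forall>i\<in>{..<m}. npoints (B i) N = k i} =
        {N \<in> configurations. \<forall>i<m. npoints (B i) N = k i}"
      by (auto simp: space_config)
    finally show "{N \<in> configurations. \<forall>i<m. npoints (B i) N = k i} \<in> sets config_space" .
  qed
  have gen: "sets config_space = sigma_sets configurations ?E"
  proof
    show "sigma_sets configurations ?E \<subseteq> sets config_space"
      using sets.sigma_sets_subset[OF Esets] by (simp add: space_config)
    show "sets config_space \<subseteq> sigma_sets configurations ?E"
      unfolding sets_config
    proof (rule sigma_sets_mono, safe)
      fix B :: "real set" and k assume "B \<in> sets borel" "B \<subseteq> {0..1}"
      then have "{N \<in> configurations. npoints B N = k} \<in> ?E"
        by (intro CollectI exI[of _ "1::nat"] exI[of _ "\<lambda>_. B"] exI[of _ "\<lambda>_. k"]) auto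
      then show "{N \<in> configurations. npoints B N = k} \<in> sigma_sets configurations ?E" by blast
    qed
  qed
  show ?thesis
  proof (rule measure_eqI_generator_eq[where E="?E" and \<Omega>=configurations and A="\<lambda>_. configurations"])
    show "Int_stable ?E" by (rule count_events_Int_stable)
    show "range (\<lambda>_. configurations) \<subseteq> ?E"
      by (auto intro!: exI[of _ "0::nat"] exI[of _ "\<lambda>_. {}"])
    fix X assume X: "X \<in> ?E"
    then obtain m :: nat and B k where XX: "X = {N \<in> configurations. \<forall>i<m. npoints (B i) N = k i}"
      and B: "\<And>i. B i \<in> sets borel" "\<And>i. B i \<subseteq> {0..1}" by auto
    have ind: "(\<Prod>i<m. of_bool (npoints (B i) N = k i)) = (indicator X N :: ennreal)" if "N \<in> configurations" for N
      using that unfolding XX by (auto simp: indicator_def of_bool_def intro!: prod.neutral)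
    have "(\<integral>\<^sup>+N. (\<Prod>i<m. of_bool (npoints (B i) N = k i)) \<partial>P) = (\<integral>\<^sup>+N. (\<Prod>i<m. of_bool (npoints (B i) N = k i)) \<partial>Q)"
    proof (rule pgf_joint)
      show "npoints (B i) \<in> P \<rightarrow>\<^sub>M count_space UNIV" "npoints (B i) \<in> Q \<rightarrow>\<^sub>M count_space UNIV" for i
        using measurable_npoints[OF B(1)] by (subst measurable_cong_sets[OF sP refl] measurable_cong_sets[OF sQ refl], assumption)+
      show "finite_measure P" by unfold_locales
      fix z :: "nat \<Rightarrow> real" assume z: "\<And>i. 0 \<le> z i \<and> z i \<le> 1"
      define h where "h x = (\<Prod>i<m. if x \<in> B i then z i else 1)" for x
      \<comment> \<open>The value of \<open>h\<close> at \<open>x\<close> depends only on which of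
        the sets contain \<open>x\<close>, so there are at most \<open>2 ^ m\<close> values.\<close>
      have "range h \<subseteq> (\<lambda>S. \<Prod>i<m. if i \<in> S then z i else 1) ` Pow {..<m}"
      proof safe
        fix x
        have "h x = (\<Prod>i<m. if i \<in> {i\<in>{..<m}. x \<in> B i} then z i else 1)"
          unfolding h_def by (intro prod.cong) auto
        then show "h x \<in> (\<lambda>S. \<Prod>i<m. if i \<in> S then z i else 1) ` Pow {..<m}" by blast
      qed
      then have fin: "finite (range h)" by (rule finite_subset) simp
      have hm: "h \<in> borel_measurable borel" unfolding h_def
        by (intro borel_measurable_prod measurable_If) (use B in auto)
      have h0: "0 \<le> h x" for x unfolding h_def using z by (intro prod_nonneg) auto
      show "(\<integral>\<^sup>+N. ennreal (\<Prod>i<m. z i ^ npoints (B i) N) \<partial>P) = (\<integral>\<^sup>+N. ennreal (\<Prod>i<m. z i ^ npoints (B i) N) \<partial>Q)"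
        using poisson_process_pgf_determined[OF P Q sP sQ hm fin h0]
        unfolding h_def prod_mset_indicators .
    qed
    then have "(\<integral>\<^sup>+N. indicator X N \<partial>P) = (\<integral>\<^sup>+N. indicator X N \<partial>Q)"
      by (subst (asm) (1 2) nn_integral_cong[OF ind]) (auto simp: spP spQ space_config)
    then show "emeasure P X = emeasure Q X"
      using X Esets by (simp add: sP sQ subset_eq)
  qed (auto simp: sP sQ gen spP)
qed

section \<open>Laplace functionals\<close>

text \<open>Given by its density so that the rate \<open>0\<close> is allowed; it occurs for sets
  that carry no intensity.\<close>

definition poisson_measure :: "real \<Rightarrow> nat measure" where
  "poisson_measure a = density (count_space UNIV) (\<lambda>k. ennreal (a ^ k / fact k * exp (- a)))"

lemma sets_poisson_measure [simp, measurable_cong]: "sets (poisson_measure a) = sets (count_space UNIV)"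
  and space_poisson_measure [simp]: "space (poisson_measure a) = UNIV"
  by (simp_all add: poisson_measure_def)

lemma poisson_measure_pgf:
  assumes "0 \<le> a" "0 \<le> z"
  shows "(\<integral>\<^sup>+k. ennreal (z ^ k) \<partial>poisson_measure a) = ennreal (exp (a * (z - 1)))"
proof -
  have "(\<lambda>k. exp (- a) * ((a * z) ^ k /\<^sub>R fact k)) sums (exp (- a) * exp (a * z))"
    by (intro sums_mult exp_converges)
  then have s: "(\<lambda>k. a ^ k / fact k * exp (- a) * z ^ k) sums exp (a * (z - 1))"
    by (simp add: exp_add[symmetric] power_mult_distrib field_simps)
  have "(\<integral>\<^sup>+k. ennreal (z ^ k) \<partial>poisson_measure a) = (\<Sum>k. ennreal (a ^ k / fact k * exp (- a) * z ^ k))"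
    unfolding poisson_measure_def using assms
    by (subst nn_integral_density) (auto simp: nn_integral_count_space_nat ennreal_mult[symmetric])
  also have "\<dots> = ennreal (exp (a * (z - 1)))"
    using s assms by (intro suminf_ennreal_eq) auto
  finally show ?thesis .
qed

lemma prob_space_poisson_measure: "0 \<le> a \<Longrightarrow> prob_space (poisson_measure a)"
  using poisson_measure_pgf[of a 1] by (intro prob_spaceI) simp

lemma emeasure_poisson_measure:
  "0 \<le> a \<Longrightarrow> emeasure (poisson_measure a) {k} = ennreal (a ^ k / fact k * exp (- a))"
  unfolding poisson_measure_def by (subst emeasure_density) (auto simp: nn_integral_count_space_indicator)

section \<open>Poisson processes characterised by their Laplace functional\<close>

text \<open>With \<open>h = exp (- u)\<close> this is the usual Laplace functional. Allowing any
  bounded \<open>h\<close>, also above \<open>1\<close>, makes changes of density and second moments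
  instances of the same formula.\<close>

definition has_laplace_functional :: "real multiset measure \<Rightarrow> (real \<Rightarrow> real) \<Rightarrow> bool" where
  "has_laplace_functional P f \<longleftrightarrow> sets P = sets config_space \<and>
    (\<forall>h b. h \<in> borel_measurable borel \<longrightarrow> (\<forall>x. 0 \<le> h x \<and> h x \<le> b) \<longrightarrow>
      (\<integral>\<^sup>+N. ennreal (\<Prod>x\<in>#N. h x) \<partial>P) = ennreal (exp (LBINT t:{0..1}. (h t - 1) * f t)))"

lemma laplace_prob_space: "has_laplace_functional P f \<Longrightarrow> prob_space P"
  unfolding has_laplace_functional_def
  by (intro prob_spaceI) (auto dest!: spec[of _ "\<lambda>_. 1"] intro!: exI[of _ 1])

lemma set_integrable_bounded:
  fixes f :: "real \<Rightarrow> real"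
  assumes "f \<in> borel_measurable borel" "\<And>x. \<bar>f x\<bar> \<le> c" "B \<in> sets borel" "B \<subseteq> {0..1}"
  shows "set_integrable lborel B f"
proof -
  have "emeasure lborel B \<le> emeasure lborel {0..1::real}" using assms by (intro emeasure_mono) auto
  then have "emeasure lborel B < \<infinity>" by (simp add: le_less_trans)
  then have "integrable lborel (\<lambda>x. c * indicator B x :: real)"
    using assms by (intro integrable_mult_right) auto
  then show ?thesis unfolding set_integrable_def
    by (rule Bochner_Integration.integrable_bound) 
       (use assms in \<open>auto simp: indicator_def intro!: AE_I2 order_trans[OF assms(2)]\<close>)
qed

text \<open>On disjoint sets \<open>h - 1\<close> is the sum of the indicators weighted by
  \<open>z i - 1\<close>, so the exponent is additive and the generating function
  factorises.\<close>

lemma laplace_pgf: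
  fixes z :: "nat \<Rightarrow> real"
  assumes P: "has_laplace_functional P f" and f: "f \<in> borel_measurable borel" "\<And>x. 0 \<le> f x" "\<And>x. f x \<le> c"
    and B: "\<And>i. i < m \<Longrightarrow> B i \<in> sets borel" "\<And>i. i < m \<Longrightarrow> B i \<subseteq> {0..1}" "disjoint_family_on B {..<m}"
    and z: "\<And>i. 0 \<le> z i \<and> z i \<le> 1"
  shows "(\<integral>\<^sup>+N. ennreal (\<Prod>i<m. z i ^ npoints (B i) N) \<partial>P) =
    (\<Prod>i<m. ennreal (exp ((LBINT t:B i. f t) * (z i - 1))))"
proof -
  define h where "h x = (\<Prod>i<m. if x \<in> B i then z i else 1)" for x
  have hm: "h \<in> borel_measurable borel" unfolding h_def
    by (intro borel_measurable_prod measurable_If) (use B in auto)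
  have h0: "0 \<le> h x \<and> h x \<le> 1" for x unfolding h_def using z
    by (auto intro!: prod_nonneg prod_le_1)
  have h_eq: "h x - 1 = (\<Sum>i<m. (z i - 1) * indicator (B i) x)" for x
  proof (cases "\<exists>j<m. x \<in> B j")
    case True
    then obtain j where j: "j < m" "x \<in> B j" by blast
    then have "x \<notin> B i" if "i < m" "i \<noteq> j" for i
      using B(3) that by (auto simp: disjoint_family_on_def)
    then have *: "i < m \<Longrightarrow> x \<in> B i \<longleftrightarrow> i = j" for i using j by auto
    have "h x = (\<Prod>i<m. if i = j then z i else 1)" unfolding h_def using * by (intro prod.cong) auto
    also have "\<dots> = z j" using j by simp
    finally have "h x - 1 = z j - 1" by simp
    also have "z j - 1 = (\<Sum>i<m. if i = j then z i - 1 else 0)" using j by simp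
    also have "\<dots> = (\<Sum>i<m. (z i - 1) * indicator (B i) x)" using * by (intro sum.cong) auto
    finally show ?thesis .
  qed (auto simp: h_def)
  have "(\<integral>\<^sup>+N. ennreal (\<Prod>i<m. z i ^ npoints (B i) N) \<partial>P) = (\<integral>\<^sup>+N. ennreal (\<Prod>x\<in>#N. h x) \<partial>P)"
    unfolding h_def prod_mset_indicators ..
  also have "\<dots> = ennreal (exp (LBINT t:{0..1}. (h t - 1) * f t))"
    using P hm h0 unfolding has_laplace_functional_def by blast
  also have "(LBINT t:{0..1}. (h t - 1) * f t) = (LBINT t. (\<Sum>i<m. (z i - 1) * (indicator (B i) t * f t)))"
    unfolding set_lebesgue_integral_def h_eq
  proof (intro Bochner_Integration.integral_cong refl)
    fix t
    have "indicator {0..1} t *\<^sub>R ((\<Sum>i<m. (z i - 1) * indicator (B i) t) * f t) =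
        (\<Sum>i<m. indicator {0..1} t * ((z i - 1) * indicator (B i) t * f t))"
      by (simp only: sum_distrib_left sum_distrib_right real_scaleR_def)
    also have "\<dots> = (\<Sum>i<m. (z i - 1) * (indicator (B i) t * f t))"
    proof (intro sum.cong refl)
      fix i assume "i \<in> {..<m}"
      then show "indicator {0..1} t * ((z i - 1) * indicator (B i) t * f t) = (z i - 1) * (indicator (B i) t * f t)"
        using B(2)[of i] by (cases "t \<in> B i") auto
    qed
    finally show "indicator {0..1} t *\<^sub>R ((\<Sum>i<m. (z i - 1) * indicator (B i) t) * f t) =
        (\<Sum>i<m. (z i - 1) * (indicator (B i) t * f t))" .
  qed
  also have "\<dots> = (\<Sum>i<m. (z i - 1) * (LBINT t:B i. f t))"
  proof -
    have "integrable lborel (\<lambda>t. indicator (B i) t * f t)" if "i < m" for i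
      using set_integrable_bounded[OF f(1), of c "B i"] f(2,3) B that by (simp add: set_integrable_def)
    then show ?thesis
      by (subst Bochner_Integration.integral_sum) (auto simp: set_lebesgue_integral_def)
  qed
  also have "ennreal (exp \<dots>) = (\<Prod>i<m. ennreal (exp ((LBINT t:B i. f t) * (z i - 1))))"
    by (simp add: exp_sum prod_ennreal mult.commute)
  finally show ?thesis .
qed

lemma set_integral_nonneg_real: "(\<And>x. 0 \<le> f x) \<Longrightarrow> 0 \<le> (LBINT t:B. (f t :: real))"
  unfolding set_lebesgue_integral_def by (intro integral_nonneg_AE) auto

text \<open>The generating function found for \<open>P\<close> is that of independent Poisson
  counts, so \<open>pgf_joint\<close> can compare \<open>P\<close> with a product of Poisson
  measures.\<close>

lemma laplace_joint_law:
  fixes B :: "nat \<Rightarrow> real set"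
  assumes P: "has_laplace_functional P f" and f: "f \<in> borel_measurable borel" "\<And>x. 0 \<le> f x" "\<And>x. f x \<le> c"
    and B: "\<And>i. i < m \<Longrightarrow> B i \<in> sets borel" "\<And>i. i < m \<Longrightarrow> B i \<subseteq> {0..1}" "disjoint_family_on B {..<m}"
  shows "emeasure P {N \<in> space P. \<forall>i<m. npoints (B i) N = k i} =
    (\<Prod>i<m. emeasure (poisson_measure (LBINT t:B i. f t)) {k i})"
proof -
  interpret P: prob_space P using P by (rule laplace_prob_space)
  have sP: "sets P = sets config_space" using P by (simp add: has_laplace_functional_def)
  define a where "a i = (LBINT t:B i. f t)" for i
  have a: "0 \<le> a i" for i unfolding a_def using f by (intro set_integral_nonneg_real)
  interpret L: product_prob_space "\<lambda>i. poisson_measure (a i)" "{..<m}"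
    using prob_space_poisson_measure[OF a] by (simp add: product_prob_space_def product_prob_space_axioms_def product_sigma_finite_def prob_space_imp_sigma_finite)
  have [measurable]: "npoints (B i) \<in> P \<rightarrow>\<^sub>M count_space UNIV" if "i < m" for i
    using measurable_npoints[OF B(1)[OF that]] by (subst measurable_cong_sets[OF sP refl])
  have "(\<integral>\<^sup>+N. (\<Prod>i<m. of_bool (npoints (B i) N = k i)) \<partial>P) =
    (\<integral>\<^sup>+x. (\<Prod>i<m. of_bool (x i = k i)) \<partial>PiM {..<m} (\<lambda>i. poisson_measure (a i)))"
  proof (rule pgf_joint[where X="\<lambda>i. npoints (B i)" and X'="\<lambda>i x. x i"])
    show "finite_measure P" by unfold_locales
    fix i assume i: "i < m"
    show "npoints (B i) \<in> P \<rightarrow>\<^sub>M count_space UNIV"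
      using measurable_npoints[OF B(1)[OF i]] by (subst measurable_cong_sets[OF sP refl])
    show "(\<lambda>x. x i) \<in> PiM {..<m} (\<lambda>i. poisson_measure (a i)) \<rightarrow>\<^sub>M count_space UNIV"
      using measurable_component_singleton[of i "{..<m}" "\<lambda>i. poisson_measure (a i)"] i
      by (simp add: measurable_cong_sets[OF refl sets_poisson_measure])
  next
    fix z :: "nat \<Rightarrow> real" assume z: "\<And>i. 0 \<le> z i \<and> z i \<le> 1"
    have "(\<integral>\<^sup>+x. ennreal (\<Prod>i<m. z i ^ x i) \<partial>PiM {..<m} (\<lambda>i. poisson_measure (a i))) =
      (\<integral>\<^sup>+x. (\<Prod>i<m. ennreal (z i ^ x i)) \<partial>PiM {..<m} (\<lambda>i. poisson_measure (a i)))"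
      using z by (intro nn_integral_cong) (simp add: prod_ennreal)
    also have "\<dots> = (\<Prod>i<m. \<integral>\<^sup>+x. ennreal (z i ^ x) \<partial>poisson_measure (a i))"
      by (rule L.product_nn_integral_prod) auto
    also have "\<dots> = (\<Prod>i<m. ennreal (exp (a i * (z i - 1))))"
      using z a by (simp add: poisson_measure_pgf)
    finally show "(\<integral>\<^sup>+N. ennreal (\<Prod>i<m. z i ^ npoints (B i) N) \<partial>P) =
      (\<integral>\<^sup>+x. ennreal (\<Prod>i<m. z i ^ x i) \<partial>PiM {..<m} (\<lambda>i. poisson_measure (a i)))"
      using laplace_pgf[OF P f B z] by (simp add: a_def)
  qed
  also have "\<dots> = (\<Prod>i<m. \<integral>\<^sup>+x. of_bool (x = k i) \<partial>poisson_measure (a i))"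
    by (rule L.product_nn_integral_prod) auto
  also have "(\<lambda>i. \<integral>\<^sup>+x. of_bool (x = k i) \<partial>poisson_measure (a i)) = (\<lambda>i. emeasure (poisson_measure (a i)) {k i})"
  proof
    fix i
    have "(\<integral>\<^sup>+x. of_bool (x = k i) \<partial>poisson_measure (a i)) = (\<integral>\<^sup>+x. indicator {k i} x \<partial>poisson_measure (a i))"
      by (intro nn_integral_cong) (auto simp: indicator_def)
    then show "(\<integral>\<^sup>+x. of_bool (x = k i) \<partial>poisson_measure (a i)) = emeasure (poisson_measure (a i)) {k i}" by simp
  qed
  also have "(\<integral>\<^sup>+N. (\<Prod>i<m. of_bool (npoints (B i) N = k i)) \<partial>P) = 
      (\<integral>\<^sup>+N. indicator {N \<in> space P. \<forall>i\<in>{..<m}. npoints (B i) N = k i} N \<partial>P)"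
    by (intro nn_integral_cong) (auto simp: indicator_def of_bool_def intro!: prod.neutral)
  also have "\<dots> = emeasure P {N \<in> space P. \<forall>i\<in>{..<m}. npoints (B i) N = k i}"
    by (rule nn_integral_indicator) measurable
  also have "{N \<in> space P. \<forall>i\<in>{..<m}. npoints (B i) N = k i} = {N \<in> space P. \<forall>i<m. npoints (B i) N = k i}" by auto
  finally show ?thesis by (simp add: a_def)
qed

lemma laplace_distr_npoints:
  assumes P: "has_laplace_functional P f" and f: "f \<in> borel_measurable borel" "\<And>x. 0 \<le> f x" "\<And>x. f x \<le> c"
    and B: "B \<in> sets borel" "B \<subseteq> {0..1}"
  shows "emeasure P {N \<in> space P. npoints B N = k} = emeasure (poisson_measure (LBINT t:B. f t)) {k}"
  using laplace_joint_law[OF P f, of "Suc 0" "\<lambda>_. B" "\<lambda>_. k"] B by (simp add: disjoint_family_on_def)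

lemma laplace_imp_poisson_process:
  assumes P: "has_laplace_functional P f" and f: "f \<in> borel_measurable borel" "\<And>x. 0 \<le> f x" "\<And>x. f x \<le> c"
  shows "poisson_process P (\<lambda>N. N) f"
  unfolding poisson_process_def
proof (intro conjI allI impI)
  show "prob_space P" using P by (rule laplace_prob_space)
  then interpret P: prob_space P .
  have sP: "sets P = sets config_space" using P by (simp add: has_laplace_functional_def)
  show "(\<lambda>N. N) \<in> P \<rightarrow>\<^sub>M config_space" by (rule measurable_ident_sets[OF sP])
  have pos: "0 \<le> (LBINT t:B. f t)" for B using f by (intro set_integral_nonneg_real)
  fix B :: "real set" and k assume B: "B \<in> sets borel \<and> B \<subseteq> {0..1}"
  show "P.prob {N \<in> space P. npoints B N = k} = (LBINT t:B. f t) ^ k / fact k * exp (- (LBINT t:B. f t))"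
    using laplace_distr_npoints[OF P f, of B k] B pos[of B]
    by (simp add: emeasure_poisson_measure P.emeasure_eq_measure)
next
  interpret P: prob_space P using P by (rule laplace_prob_space)
  have sP: "sets P = sets config_space" using P by (simp add: has_laplace_functional_def)
  fix m :: nat and B :: "nat \<Rightarrow> real set"
  assume B: "(\<forall>i<m. B i \<in> sets borel \<and> B i \<subseteq> {0..1}) \<and> disjoint_family_on B {..<m}"
  define a where "a i = (LBINT t:B i. f t)" for i
  have a: "0 \<le> a i" for i unfolding a_def using f by (intro set_integral_nonneg_real)
  interpret L: product_prob_space "\<lambda>i. poisson_measure (a i)" "{..<m}"
    using prob_space_poisson_measure[OF a] by (simp add: product_prob_space_def product_prob_space_axioms_def product_sigma_finite_def prob_space_imp_sigma_finite)
  have rv[measurable]: "npoints (B i) \<in> P \<rightarrow>\<^sub>M count_space UNIV" if "i \<in> {..<m}" for i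
    using measurable_npoints[of "B i"] B that by (subst measurable_cong_sets[OF sP refl]) auto
  show "P.indep_vars (\<lambda>_. count_space UNIV) (\<lambda>i N. npoints (B i) N) {..<m}"
  \<comment> \<open>The criterion for independence by product laws requires a nonempty index
    set.\<close>
  proof (cases "m = 0")
    case True
    then show ?thesis by (simp add: P.indep_vars_def P.indep_sets_def)
  next
    case False
    let ?S = "PiM {..<m} (\<lambda>_. count_space (UNIV :: nat set))"
    let ?X = "\<lambda>N. \<lambda>i\<in>{..<m}. npoints (B i) N"
    have marg: "distr P (count_space UNIV) (npoints (B i)) = poisson_measure (a i)" if "i \<in> {..<m}" for i
    proof (rule measure_eqI_countable[where A=UNIV])
      fix k
      have "emeasure (distr P (count_space UNIV) (npoints (B i))) {k} = emeasure P {N \<in> space P. npoints (B i) N = k}"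
        using rv[OF that] by (subst emeasure_distr) (auto intro!: arg_cong[where f="emeasure P"])
      then show "emeasure (distr P (count_space UNIV) (npoints (B i))) {k} = emeasure (poisson_measure (a i)) {k}"
        using laplace_distr_npoints[OF P f, of "B i" k] B that by (simp add: a_def)
    qed auto
    have setsS: "sets ?S = Pow (PiE {..<m} (\<lambda>_. UNIV))"
      by (subst count_space_PiM_finite) auto
    \<comment> \<open>The vectors of counts form a countable set, so the two laws are compared on
      singletons, where \<open>laplace_joint_law\<close> applies.\<close>
    have "distr P ?S ?X = PiM {..<m} (\<lambda>i. poisson_measure (a i))"
    proof (rule measure_eqI_countable[where A="PiE {..<m} (\<lambda>_. UNIV)"])
      show "sets (distr P ?S ?X) = Pow (PiE {..<m} (\<lambda>_. UNIV))" using setsS by simp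
      have "sets (PiM {..<m} (\<lambda>i. poisson_measure (a i))) = sets ?S" by (intro sets_PiM_cong) auto
      then show "sets (PiM {..<m} (\<lambda>i. poisson_measure (a i))) = Pow (PiE {..<m} (\<lambda>_. UNIV))" using setsS by simp
      show "countable (PiE {..<m} (\<lambda>_. UNIV :: nat set))" by (intro countable_PiE) auto
      fix k :: "nat \<Rightarrow> nat" assume k: "k \<in> PiE {..<m} (\<lambda>_. UNIV)"
      have "?X \<in> P \<rightarrow>\<^sub>M ?S" using rv by (intro measurable_restrict) auto
      then have "emeasure (distr P ?S ?X) {k} = emeasure P (?X -` {k} \<inter> space P)"
        using setsS k by (intro emeasure_distr) auto
      also have "?X -` {k} \<inter> space P = {N \<in> space P. \<forall>i<m. npoints (B i) N = k i}"
        using k by (auto simp: fun_eq_iff PiE_def extensional_def restrict_def)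
      also have "emeasure P \<dots> = (\<Prod>i<m. emeasure (poisson_measure (a i)) {k i})"
        unfolding a_def using B by (intro laplace_joint_law[OF P f]) auto
      also have "\<dots> = emeasure (PiM {..<m} (\<lambda>i. poisson_measure (a i))) (PiE {..<m} (\<lambda>i. {k i}))"
        by (subst L.emeasure_PiM) auto
      also have "PiE {..<m} (\<lambda>i. {k i}) = {k}" by (rule PiE_singleton) (use k in \<open>simp add: PiE_def\<close>)
      finally show "emeasure (distr P ?S ?X) {k} = emeasure (PiM {..<m} (\<lambda>i. poisson_measure (a i))) {k}" .
    qed
    also have "\<dots> = PiM {..<m} (\<lambda>i. distr P (count_space UNIV) (npoints (B i)))"
      by (intro PiM_cong) (auto simp: marg)
    finally show ?thesis using False rv
      by (subst P.indep_vars_iff_distr_eq_PiM') auto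
  qed
qed

text \<open>The only access to the definite description \<open>poisson_law\<close>: a measure with
  the right Laplace functional satisfies the Poisson axioms and, by uniqueness, is the law.\<close>

lemma poisson_law_eqI:
  assumes P: "has_laplace_functional P f" and f: "f \<in> borel_measurable borel" "\<And>x. 0 \<le> f x" "\<And>x. f x \<le> c"
  shows "poisson_law f = P"
  unfolding poisson_law_def
proof (rule the_equality)
  show *: "sets P = sets config_space \<and> poisson_process P (\<lambda>N. N) f"
    using laplace_imp_poisson_process[OF P f] P by (simp add: has_laplace_functional_def)
  show "Q = P" if "sets Q = sets config_space \<and> poisson_process Q (\<lambda>N. N) f" for Q
    using poisson_process_unique[of Q f P] that * by blast
qed

section \<open>Construction of the laws\<close>

lemma uniform_points_measurable:
  fixes K :: nat
  shows
  "(\<lambda>w. image_mset w (mset_set {..<K})) \<in>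
    PiM {..<K} (\<lambda>_. restrict_space lborel {0..1::real}) \<rightarrow>\<^sub>M config_space"
  unfolding config_space_def
proof (rule measurable_measure_of)
  show "(\<lambda>w. image_mset w (mset_set {..<K})) \<in> space (PiM {..<K} (\<lambda>_. restrict_space lborel {0..1::real})) \<rightarrow> configurations"
    by (auto simp: space_PiM PiE_def Pi_def configurations_def space_restrict_space elem_mset_set)
  fix A assume "A \<in> {{N \<in> configurations. npoints B N = k} | B k. B \<in> sets borel \<and> B \<subseteq> {0..1}}"
  then obtain B k where A: "A = {N \<in> configurations. npoints B N = k}" and B: "B \<in> sets borel" "B \<subseteq> {0..1}" by blast
  have np: "npoints B (image_mset w (mset_set S)) = (\<Sum>j\<in>S. if w j \<in> B then 1 else 0)" if "finite S" for w S
    using that by (induction S rule: finite_induct) auto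
  let ?M = "PiM {..<K} (\<lambda>_. restrict_space lborel {0..1::real})"
  have [measurable]: "(\<lambda>w. w j) \<in> ?M \<rightarrow>\<^sub>M borel" if "j \<in> {..<K}" for j
  proof -
    have "(\<lambda>w. w j) \<in> ?M \<rightarrow>\<^sub>M restrict_space lborel {0..1::real}" using that by measurable
    moreover have "(\<lambda>x. x) \<in> restrict_space lborel {0..1::real} \<rightarrow>\<^sub>M borel"
      by (rule measurable_restrict_space1) simp
    ultimately show ?thesis by (rule measurable_compose)
  qed
  note B(1)[measurable]
  have "{w \<in> space ?M. (\<Sum>j\<in>{..<K}. if w j \<in> B then 1 else 0 :: nat) = k} \<in> sets ?M"
    by measurable
  also have "{w \<in> space ?M. (\<Sum>j\<in>{..<K}. if w j \<in> B then 1 else 0 :: nat) = k} =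
      (\<lambda>w. image_mset w (mset_set {..<K})) -` A \<inter> space ?M"
    unfolding A using np[of "{..<K}"]
    by (auto simp: space_PiM PiE_def Pi_def configurations_def space_restrict_space elem_mset_set)
  finally show "(\<lambda>w. image_mset w (mset_set {..<K})) -` A \<inter> space ?M \<in> sets ?M" .
qed auto

text \<open>The classical construction: a Poisson number of independent uniform points. With
  \<open>K\<close> points the functional is \<open>I ^ K\<close>, and the generating function of the
  Poisson number at \<open>I\<close> is \<open>exp (\<rho> * (I - 1))\<close>.\<close>

lemma homogeneous_poisson_exists:
  assumes rho: "0 < \<rho>"
  shows "\<exists>P. has_laplace_functional P (\<lambda>_. \<rho>)"
proof -
  define U where "U = restrict_space lborel {0..1::real}"
  interpret U: prob_space U unfolding U_def
    by (rule prob_spaceI) (simp add: emeasure_restrict_space space_restrict_space)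
  define Q where "Q K = distr (PiM {..<K} (\<lambda>_. U)) config_space (\<lambda>w. image_mset w (mset_set {..<K}))" for K :: nat
  have m[measurable]: "(\<lambda>w. image_mset w (mset_set {..<K})) \<in> PiM {..<K} (\<lambda>_. U) \<rightarrow>\<^sub>M config_space" for K :: nat
    unfolding U_def by (rule uniform_points_measurable)
  have pQ: "prob_space (Q K)" for K
    unfolding Q_def by (intro prob_space.prob_space_distr prob_space_PiM U.prob_space_axioms m)
  have "Q \<in> count_space UNIV \<rightarrow>\<^sub>M subprob_algebra config_space"
    using pQ by (auto simp: space_subprob_algebra Q_def intro: prob_space_imp_subprob_space)
  then have Qm: "Q \<in> poisson_measure \<rho> \<rightarrow>\<^sub>M subprob_algebra config_space"
    by (subst measurable_cong_sets[OF sets_poisson_measure refl])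
  define P where "P = poisson_measure \<rho> \<bind> Q"
  show ?thesis unfolding has_laplace_functional_def
  proof (intro exI[of _ P] conjI allI impI)
    show "sets P = sets config_space" unfolding P_def
      by (rule sets_bind) (auto simp: Q_def)
    fix h :: "real \<Rightarrow> real" and b assume hm[measurable]: "h \<in> borel_measurable borel" and hb: "\<forall>x. 0 \<le> h x \<and> h x \<le> b"
    define I where "I = (LBINT t:{0..1}. h t)"
    have int: "set_integrable lborel {0..1} h"
      using hb by (intro set_integrable_bounded[where c=b] hm) auto
    have I0: "0 \<le> I" unfolding I_def set_lebesgue_integral_def using hb by (intro integral_nonneg_AE) auto
    have hU: "(\<integral>\<^sup>+x. ennreal (h x) \<partial>U) = ennreal I"
    proof -
      have "(\<integral>\<^sup>+x. ennreal (h x) \<partial>U) = (\<integral>\<^sup>+x. ennreal (indicator {0..1} x * h x) \<partial>lborel)"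
        unfolding U_def by (subst nn_integral_restrict_space) (auto simp: indicator_def intro!: nn_integral_cong)
      also have "\<dots> = ennreal I" 
        using int hb unfolding I_def set_lebesgue_integral_def set_integrable_def
        by (subst nn_integral_eq_integral) auto
      finally show ?thesis .
    qed
    interpret PU: product_prob_space "\<lambda>_::nat. U" by unfold_locales
    have QK: "(\<integral>\<^sup>+N. ennreal (\<Prod>x\<in>#N. h x) \<partial>Q K) = ennreal (I ^ K)" for K
    proof -
      have hU': "(\<lambda>x. ennreal (h x)) \<in> borel_measurable U"
        unfolding U_def by (intro measurable_restrict_space1) simp
      have "(\<integral>\<^sup>+N. ennreal (\<Prod>x\<in>#N. h x) \<partial>Q K) =
         (\<integral>\<^sup>+w. ennreal (\<Prod>x\<in>#image_mset w (mset_set {..<K}). h x) \<partial>PiM {..<K} (\<lambda>_. U))"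
        unfolding Q_def by (rule nn_integral_distr) auto
      also have "\<dots> = (\<integral>\<^sup>+w. (\<Prod>j<K. ennreal (h (w j))) \<partial>PiM {..<K} (\<lambda>_. U))"
        using hb by (intro nn_integral_cong)
          (simp add: prod_ennreal prod_unfold_prod_mset[symmetric] multiset.map_comp o_def)
      also have "\<dots> = (\<Prod>j<K. \<integral>\<^sup>+x. ennreal (h x) \<partial>U)"
        by (rule PU.product_nn_integral_prod[where f="\<lambda>_ x. ennreal (h x)"]) (auto intro: hU')
      finally show ?thesis using I0 by (simp add: hU ennreal_power)
    qed
    have "(\<integral>\<^sup>+N. ennreal (\<Prod>x\<in>#N. h x) \<partial>P) = (\<integral>\<^sup>+K. ennreal (I ^ K) \<partial>poisson_measure \<rho>)"
      unfolding P_def by (subst nn_integral_bind[OF _ Qm]) (auto simp: QK)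
    also have "\<dots> = ennreal (exp (\<rho> * (I - 1)))" using rho I0 by (simp add: poisson_measure_pgf)
    also have "\<rho> * (I - 1) = (LBINT t:{0..1}. (h t - 1) * \<rho>)"
      unfolding I_def using int by (simp add: set_integral_diff set_integrable_def mult.commute) (simp add: set_lebesgue_integral_def)
    finally show "(\<integral>\<^sup>+N. ennreal (\<Prod>x\<in>#N. h x) \<partial>P) = ennreal (exp (LBINT t:{0..1}. (h t - 1) * \<rho>))" .
  qed
qed

lemma laplace_homogeneous:
  "0 < \<rho> \<Longrightarrow> has_laplace_functional (poisson_law (\<lambda>_. \<rho>)) (\<lambda>_. \<rho>)"
  using homogeneous_poisson_exists[of \<rho>] poisson_law_eqI[of _ "\<lambda>_. \<rho>" \<rho>] by auto

lemma prod_mset_nonneg_real: "(\<And>x. 0 \<le> (f x :: real)) \<Longrightarrow> 0 \<le> (\<Prod>x\<in>#N. f x)"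
  by (induction N) auto

text \<open>The density is itself multiplicative, so it merges with the test function into
  \<open>h * f / \<rho>\<close>. Equal total mass makes the normalising factor, the exponential of
  the difference of the masses, equal to \<open>1\<close>.\<close>

lemma laplace_density:
  assumes P: "has_laplace_functional P (\<lambda>_. \<rho>)" and rho: "0 < \<rho>"
    and f: "f \<in> borel_measurable borel" "\<And>x. 0 \<le> f x" "\<And>x. f x \<le> c"
    and tot: "(LBINT t:{0..1}. f t) = \<rho>"
  shows "has_laplace_functional (density P (\<lambda>N. ennreal (\<Prod>x\<in>#N. f x / \<rho>))) f"
proof -
  have sP: "sets P = sets config_space" using P by (simp add: has_laplace_functional_def)
  have [measurable]: "(\<lambda>N. \<Prod>x\<in>#N. h x) \<in> borel_measurable P" if "h \<in> borel_measurable borel" for h :: "real \<Rightarrow> real"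
    using measurable_prod_mset[OF that] by (subst measurable_cong_sets[OF sP refl])
  note f(1)[measurable]
  show ?thesis unfolding has_laplace_functional_def
  proof (intro conjI allI impI)
    show "sets (density P (\<lambda>N. ennreal (\<Prod>x\<in>#N. f x / \<rho>))) = sets config_space" by (simp add: sP)
    fix h :: "real \<Rightarrow> real" and b assume hm[measurable]: "h \<in> borel_measurable borel" and hb: "\<forall>x. 0 \<le> h x \<and> h x \<le> b"
    have b0: "0 \<le> b" using hb order_trans by blast
    have bd: "\<bar>h x * f x\<bar> \<le> b * c" for x using hb f(2,3) b0 by (auto simp: abs_mult intro!: mult_mono)
    have "(\<integral>\<^sup>+N. ennreal (\<Prod>x\<in>#N. h x) \<partial>density P (\<lambda>N. ennreal (\<Prod>x\<in>#N. f x / \<rho>))) =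
      (\<integral>\<^sup>+N. ennreal (\<Prod>x\<in>#N. f x / \<rho>) * ennreal (\<Prod>x\<in>#N. h x) \<partial>P)"
      by (rule nn_integral_density) auto
    also have "\<dots> = (\<integral>\<^sup>+N. ennreal (\<Prod>x\<in>#N. h x * f x / \<rho>) \<partial>P)"
      using f(2) rho hb by (intro nn_integral_cong)
        (simp add: ennreal_mult'[symmetric] prod_mset_nonneg_real prod_mset.distrib[symmetric] mult.commute)
    also have "\<dots> = ennreal (exp (LBINT t:{0..1}. (h t * f t / \<rho> - 1) * \<rho>))"
    proof -
      have "0 \<le> h x * f x / \<rho> \<and> h x * f x / \<rho> \<le> b * c / \<rho>" for x
        using hb f(2,3) rho bd[of x] by (auto intro!: divide_right_mono)
      then show ?thesis using P[unfolded has_laplace_functional_def] by (elim conjE allE impE) auto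
    qed
    also have "(LBINT t:{0..1}. (h t * f t / \<rho> - 1) * \<rho>) = (LBINT t:{0..1}. h t * f t - \<rho>)"
      using rho by (intro arg_cong[where f="set_lebesgue_integral lborel {0..1}"]) (simp add: fun_eq_iff field_simps)
    also have "\<dots> = (LBINT t:{0..1}. h t * f t) - \<rho>"
      using set_integrable_bounded[of "\<lambda>t. h t * f t" "b * c" "{0..1}"] bd
      by (subst set_integral_diff) (auto simp: set_integrable_def set_lebesgue_integral_def)
    also have "\<dots> = (LBINT t:{0..1}. (h t - 1) * f t)"
      unfolding tot[symmetric] left_diff_distrib mult_1
      using set_integrable_bounded[of "\<lambda>t. h t * f t" "b * c" "{0..1}"] bd
        set_integrable_bounded[of f c "{0..1}"] f
      by (subst set_integral_diff) auto
    finally show "(\<integral>\<^sup>+N. ennreal (\<Prod>x\<in>#N. h x) \<partial>density P (\<lambda>N. ennreal (\<Prod>x\<in>#N. f x / \<rho>))) =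
      ennreal (exp (LBINT t:{0..1}. (h t - 1) * f t))" .
  qed
qed

lemma poisson_law_density:
  assumes rho: "0 < \<rho>" and f: "f \<in> borel_measurable borel" "\<And>x. 0 \<le> f x" "\<And>x. f x \<le> c"
    and tot: "(LBINT t:{0..1}. f t) = \<rho>"
  shows "poisson_law f = density (poisson_law (\<lambda>_. \<rho>)) (\<lambda>N. ennreal (\<Prod>x\<in>#N. f x / \<rho>))"
  by (rule poisson_law_eqI[OF laplace_density[OF laplace_homogeneous[OF rho] rho f tot] f])

section \<open>A modulated Fejer kernel\<close>

definition fejer :: "nat \<Rightarrow> real \<Rightarrow> real" where
  "fejer M t = (\<Sum>j\<in>{- int M<..<int M}. (1 - \<bar>of_int j\<bar> / M) * cos (2 * pi * of_int j * t))"

definition carrier_fejer :: "nat \<Rightarrow> real \<Rightarrow> real" where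
  "carrier_fejer M t = fejer M t * cos (4 * pi * M * t)"

text \<open>The Fourier coefficients of \<open>carrier_fejer M\<close>: the triangle of the Fejer
  kernel with its peak moved from \<open>0\<close> to \<open>2 * M\<close>.\<close>

definition triangle_coeff :: "nat \<Rightarrow> int \<Rightarrow> real" where
  "triangle_coeff M l = 1 - \<bar>of_int l - 2 * real M\<bar> / M"

text \<open>The difference \<open>j\<close> is attained by \<open>M - \<bar>j\<bar>\<close> pairs.
  In the induction the new row and column contribute each difference of modulus at most
  \<open>M\<close> exactly once.\<close>

lemma sum_differences:
  fixes \<phi> :: "int \<Rightarrow> real"
  shows "(\<Sum>a<M. \<Sum>b<M. \<phi> (int a - int b)) = (\<Sum>j\<in>{- int M<..<int M}. (real M - \<bar>of_int j\<bar>) * \<phi> j)"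
proof (induction M)
  case (Suc M)
  let ?I = "{- int M<..<int M}"
  have split: "{- int (Suc M)<..<int (Suc M)} = (int ` {..<M} \<union> {int M}) \<union> (\<lambda>b. - int (Suc b)) ` {..<M}" (is "_ = ?A \<union> ?B")
  proof
    show "{- int (Suc M)<..<int (Suc M)} \<subseteq> ?A \<union> ?B"
    proof
      fix j assume j: "j \<in> {- int (Suc M)<..<int (Suc M)}"
      show "j \<in> ?A \<union> ?B"
      proof (cases "0 \<le> j")
        case True
        then have "j = int (nat j)" "nat j < M \<or> nat j = M" using j by auto
        then show ?thesis by (metis UnCI image_eqI insertCI lessThan_iff)
      next
        case False
        then have "j = - int (Suc (nat (- j - 1)))" "nat (- j - 1) < M" using j by auto
        then show ?thesis by blast
      qed
    qed
  qed auto
  have all: "(\<Sum>j\<in>{- int (Suc M)<..<int (Suc M)}. \<phi> j) = (\<Sum>a<M. \<phi> (int M - int a)) + \<phi> 0 + (\<Sum>b<M. \<phi> (int b - int M))"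
  proof -
    have "(\<Sum>j\<in>{- int (Suc M)<..<int (Suc M)}. \<phi> j) = (\<Sum>j\<in>int ` {..<Suc M}. \<phi> j) + (\<Sum>j\<in>?B. \<phi> j)"
      unfolding split by (subst sum.union_disjoint) (auto simp: lessThan_Suc insert_commute)
    also have "(\<Sum>j\<in>int ` {..<Suc M}. \<phi> j) = (\<Sum>a<Suc M. \<phi> (int a))"
      by (subst sum.reindex) (auto simp: inj_on_def)
    also have "\<dots> = (\<Sum>a<Suc M. \<phi> (int M - int a))"
      by (rule sum.reindex_bij_witness[of _ "\<lambda>a. M - a" "\<lambda>a. M - a"]) (auto simp: of_nat_diff)
    also have "(\<Sum>j\<in>?B. \<phi> j) = (\<Sum>a<M. \<phi> (- int (Suc a)))"
      by (subst sum.reindex) (auto simp: inj_on_def)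
    also have "\<dots> = (\<Sum>b<M. \<phi> (int b - int M))"
      by (rule sum.reindex_bij_witness[of _ "\<lambda>a. M - Suc a" "\<lambda>a. M - Suc a"]) (auto simp: of_nat_diff algebra_simps)
    finally show ?thesis by simp
  qed
  have "(\<Sum>a<Suc M. \<Sum>b<Suc M. \<phi> (int a - int b)) =
    (\<Sum>a<M. \<Sum>b<M. \<phi> (int a - int b)) + (\<Sum>a<M. \<phi> (int a - int M)) + (\<Sum>b<M. \<phi> (int M - int b)) + \<phi> 0"
    by (simp add: sum.distrib)
  also have "\<dots> = (\<Sum>j\<in>?I. (real M - \<bar>of_int j\<bar>) * \<phi> j) + (\<Sum>j\<in>{- int (Suc M)<..<int (Suc M)}. \<phi> j)"
    unfolding Suc all by simp
  also have "(\<Sum>j\<in>?I. (real M - \<bar>of_int j\<bar>) * \<phi> j) = (\<Sum>j\<in>{- int (Suc M)<..<int (Suc M)}. (real M - \<bar>of_int j\<bar>) * \<phi> j)"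
    by (rule sum.mono_neutral_left) (auto simp: abs_if)
  also have "\<dots> + (\<Sum>j\<in>{- int (Suc M)<..<int (Suc M)}. \<phi> j) = (\<Sum>j\<in>{- int (Suc M)<..<int (Suc M)}. (real (Suc M) - \<bar>of_int j\<bar>) * \<phi> j)"
    by (simp add: sum.distrib[symmetric] algebra_simps)
  finally show ?case .
qed simp

text \<open>\<open>M\<close> times the kernel is the squared modulus of the sum of the exponentials
  with frequencies \<open>0\<close> to \<open>M - 1\<close>.\<close>

lemma fejer_nonneg: "0 \<le> fejer M t"
proof (cases "M = 0")
  case False
  have "M * fejer M t = (\<Sum>j\<in>{- int M<..<int M}. (real M - \<bar>of_int j\<bar>) * cos (2 * pi * of_int j * t))"
    unfolding fejer_def sum_distrib_left using False by (intro sum.cong) (auto simp: field_simps)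
  also have "\<dots> = (\<Sum>a<M. \<Sum>b<M. cos (2 * pi * of_int (int a - int b) * t))"
    by (rule sum_differences[symmetric])
  also have "\<dots> = (\<Sum>a<M. \<Sum>b<M. cos (2 * pi * a * t) * cos (2 * pi * b * t) + sin (2 * pi * a * t) * sin (2 * pi * b * t))"
    by (intro sum.cong refl) (simp add: cos_diff[symmetric] algebra_simps)
  also have "\<dots> = (\<Sum>a<M. cos (2 * pi * a * t))\<^sup>2 + (\<Sum>a<M. sin (2 * pi * a * t))\<^sup>2"
    by (simp add: power2_eq_square sum_product sum.distrib)
  finally have "0 \<le> M * fejer M t" by simp
  then show ?thesis using False by (simp add: zero_le_mult_iff)
qed (simp add: fejer_def)

text \<open>A geometric sum over a nontrivial root of unity of order dividing \<open>M\<close>;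
  \<open>\<bar>j\<bar> < M\<close> excludes the trivial root. Hence only the mean survives when the
  \<open>M\<close> translates of the kernel are added.\<close>

lemma sum_roots_of_unity:
  fixes j :: int
  assumes "0 < M" "\<bar>j\<bar> < int M" "j \<noteq> 0"
  shows "(\<Sum>k<M. cos (2 * pi * of_int j * (t - real k / M))) = 0"
proof -
  define w where "w = cis (- (2 * pi * of_int j / M))"
  have "w ^ M = cis (M * (- (2 * pi * of_int j / M)))" unfolding w_def by (rule Complex.DeMoivre)
  also have "M * (- (2 * pi * of_int j / M)) = 2 * pi * of_int (- j)" using assms by simp
  also have "cis \<dots> = 1" by (rule cis_multiple_2pi) simp
  finally have wM: "w ^ M = 1" .
  have w1: "w \<noteq> 1"
  proof
    assume "w = 1"
    then have "cos (2 * pi * of_int j / M) = 1" by (simp add: w_def complex_eq_iff)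
    then obtain n :: int where "2 * pi * of_int j / M = of_int n * 2 * pi" by (auto simp: cos_one_2pi_int)
    then have "real_of_int j = of_int n * M" using assms by (simp add: field_simps)
    then have "real_of_int j = real_of_int (n * int M)" by simp
    then have j: "j = n * int M" by (simp only: of_int_eq_iff)
    then have "n \<noteq> 0" using assms(3) by auto
    then have "1 * int M \<le> \<bar>n\<bar> * int M" by (intro mult_right_mono) auto
    also have "\<bar>n\<bar> * int M = \<bar>j\<bar>" unfolding j abs_mult by simp
    finally show False using assms(2) by simp
  qed
  have "(\<Sum>k<M. cis (2 * pi * of_int j * (t - real k / M))) = cis (2 * pi * of_int j * t) * (\<Sum>k<M. w ^ k)"
    unfolding sum_distrib_left w_def Complex.DeMoivre cis_mult by (intro sum.cong refl arg_cong[where f=cis]) (simp add: algebra_simps)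
  also have "\<dots> = 0" using geometric_sum[OF w1, of M] wM by simp
  finally have "Re (\<Sum>k<M. cis (2 * pi * of_int j * (t - real k / M))) = 0" by simp
  then show ?thesis by simp
qed

lemma fejer_partition:
  assumes "0 < M"
  shows "(\<Sum>k<M. fejer M (t - real k / M)) = M"
proof -
  have "(\<Sum>k<M. fejer M (t - real k / M)) =
    (\<Sum>j\<in>{- int M<..<int M}. (1 - \<bar>of_int j\<bar> / M) * (\<Sum>k<M. cos (2 * pi * of_int j * (t - real k / M))))"
    unfolding fejer_def sum_distrib_left by (rule sum.swap)
  also have "\<dots> = (\<Sum>j\<in>{- int M<..<int M}. if j = 0 then real M else 0)"
    using sum_roots_of_unity[OF assms] by (intro sum.cong) auto
  finally show ?thesis using assms by simp
qed

lemma carrier_fejer_le: "\<bar>carrier_fejer M t\<bar> \<le> fejer M t"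
  unfolding carrier_fejer_def abs_mult using fejer_nonneg[of M t] abs_cos_le_one[of "4 * pi * M * t"]
  by (simp add: mult_left_le)

text \<open>The product formula for cosines yields the frequencies \<open>2 * M + j\<close> and
  \<open>2 * M - j\<close>; the triangle is even in \<open>j\<close>, so both halves agree.\<close>

lemma carrier_fejer_cos:
  "carrier_fejer M t = (\<Sum>l\<in>{int M<..<3 * int M}. triangle_coeff M l * cos (2 * pi * of_int l * t))"
proof -
  let ?I = "{- int M<..<int M}"
  let ?c = "\<lambda>j::int. 1 - \<bar>of_int j\<bar> / real M"
  have "carrier_fejer M t = (\<Sum>j\<in>?I. ?c j * (cos (2 * pi * of_int (2 * int M + j) * t) + cos (2 * pi * of_int (2 * int M - j) * t)) / 2)"
    unfolding carrier_fejer_def fejer_def sum_distrib_right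
    by (intro sum.cong refl) (simp add: cos_add cos_diff algebra_simps)
  also have "\<dots> = ((\<Sum>j\<in>?I. ?c j * cos (2 * pi * of_int (2 * int M + j) * t)) + (\<Sum>j\<in>?I. ?c j * cos (2 * pi * of_int (2 * int M - j) * t))) / 2"
    by (simp only: distrib_left sum.distrib sum_divide_distrib[symmetric])
  also have "(\<Sum>j\<in>?I. ?c j * cos (2 * pi * of_int (2 * int M - j) * t)) = (\<Sum>j\<in>?I. ?c j * cos (2 * pi * of_int (2 * int M + j) * t))"
    by (rule sum.reindex_bij_witness[of _ uminus uminus]) auto
  also have "(\<Sum>j\<in>?I. ?c j * cos (2 * pi * of_int (2 * int M + j) * t)) = 
      (\<Sum>l\<in>{int M<..<3 * int M}. triangle_coeff M l * cos (2 * pi * of_int l * t))"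
    by (rule sum.reindex_bij_witness[of _ "\<lambda>l. l - 2 * int M" "\<lambda>j. 2 * int M + j"])
       (auto simp: triangle_coeff_def)
  finally show ?thesis by simp
qed

lemma triangle_coeff_bounds: "l \<in> {int M<..<3 * int M} \<Longrightarrow> 0 \<le> triangle_coeff M l \<and> triangle_coeff M l \<le> 1"
  unfolding triangle_coeff_def by (auto simp: abs_if divide_simps split: if_splits)

lemma triangle_coeff_sum_squares:
  assumes "0 < M"
  shows "real M / 3 \<le> (\<Sum>l\<in>{int M<..<3 * int M}. (triangle_coeff M l)\<^sup>2)"
proof -
  \<comment> \<open>Only the rising side of the triangle is kept, where the coefficients are
    \<open>1 / M\<close>, \<open>2 / M\<close>, up to \<open>1\<close>; the sum of the first
    \<open>M\<close> squares is at least \<open>M ^ 3 / 3\<close>.\<close>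
  have "real m ^ 3 / 3 \<le> (\<Sum>i<m. (real (Suc i))\<^sup>2)" for m
    by (induction m) (auto simp: power3_eq_cube power2_eq_square algebra_simps)
  from this[of M] have "real M ^ 3 / 3 / (real M)\<^sup>2 \<le> (\<Sum>i<M. (real (Suc i))\<^sup>2) / (real M)\<^sup>2"
    by (rule divide_right_mono) simp
  also have "real M ^ 3 / 3 / (real M)\<^sup>2 = real M / 3" using assms by (simp add: power3_eq_cube power2_eq_square)
  also have "(\<Sum>i<M. (real (Suc i))\<^sup>2) / (real M)\<^sup>2 = (\<Sum>i<M. (triangle_coeff M (int M + 1 + int i))\<^sup>2)"
    unfolding sum_divide_distrib power_divide[symmetric] using assms
    by (intro sum.cong) (auto simp: triangle_coeff_def abs_if field_simps)
  also have "\<dots> = (\<Sum>l\<in>(\<lambda>i. int M + 1 + int i) ` {..<M}. (triangle_coeff M l)\<^sup>2)"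
    by (subst sum.reindex) (auto simp: inj_on_def)
  also have "\<dots> \<le> (\<Sum>l\<in>{int M<..<3 * int M}. (triangle_coeff M l)\<^sup>2)"
    using assms by (intro sum_mono2) auto
  finally show ?thesis .
qed

text \<open>The carrier has period \<open>1 / (2 * M)\<close>, so a translation by
  \<open>k / M\<close> moves only the positive factor. All bumps therefore share one carrier, which
  the Bessel inequality exploits.\<close>

lemma carrier_fejer_shift:
  "carrier_fejer M (t - real k / M) = fejer M (t - real k / M) * cos (4 * pi * M * t)"
proof (cases "M = 0")
  case False
  have "4 * pi * M * (t - real k / M) = 4 * pi * M * t - 2 * pi * of_int (2 * int k)" using False by (simp add: field_simps)
  also have "cos \<dots> = cos (4 * pi * M * t)"
    unfolding cos_diff using cos_integer_2pi[of "of_int (2 * int k)"] sin_integer_2pi[of "of_int (2 * int k)"]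
    by simp
  finally show ?thesis by (simp add: carrier_fejer_def)
qed (simp add: carrier_fejer_def fejer_def)

lemma carrier_fejer_periodic: "carrier_fejer M (t + of_int m) = carrier_fejer M t"
proof -
  have "cos (2 * pi * of_int l * (t + of_int m)) = cos (2 * pi * of_int l * t)" for l :: int
    using cos_integer_2pi[of "of_int (l * m)"] sin_integer_2pi[of "of_int (l * m)"]
    by (simp add: distrib_left cos_add mult.assoc)
  then show ?thesis unfolding carrier_fejer_cos by simp
qed

lemma continuous_on_carrier_fejer [continuous_intros]:
  fixes f :: "real \<Rightarrow> real"
  shows "continuous_on S f \<Longrightarrow> continuous_on S (\<lambda>t. carrier_fejer M (f t))"
  unfolding carrier_fejer_def fejer_def by (auto intro!: continuous_intros)

section \<open>Orthogonality relations for cosines\<close>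

lemma integral_cos_period:
  assumes "n \<noteq> (0 :: int)"
  shows "(LBINT t:{0..1}. cos (2 * pi * of_int n * t - c)) = 0"
proof -
  let ?F = "\<lambda>t. sin (2 * pi * of_int n * t - c) / (2 * pi * of_int n)"
  have "(\<integral>t. cos (2 * pi * of_int n * t - c) * indicator {0..1} t \<partial>lborel) = ?F 1 - ?F 0"
  proof (rule integral_FTC_Icc_real)
    fix t :: real
    show "(?F has_real_derivative cos (2 * pi * of_int n * t - c)) (at t)"
      using assms by (auto intro!: derivative_eq_intros)
  qed (auto intro!: continuous_intros)
  also have "?F 1 - ?F 0 = 0"
    using sin_integer_2pi[of "of_int n"] cos_integer_2pi[of "of_int n"] by (simp add: sin_diff)
  finally show ?thesis by (simp add: set_lebesgue_integral_def mult.commute)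
qed

lemma integral_cos_cos:
  fixes l m :: int
  assumes "0 < l" "0 < m"
  shows "(LBINT t:{0..1}. cos (2 * pi * of_int l * t - a) * cos (2 * pi * of_int m * t - b)) =
    (if l = m then cos (a - b) / 2 else 0)"
proof -
  have "(LBINT t:{0..1}. cos (2 * pi * of_int l * t - a) * cos (2 * pi * of_int m * t - b)) =
    (LBINT t:{0..1}. (cos (2 * pi * of_int (l - m) * t - (a - b)) + cos (2 * pi * of_int (l + m) * t - (a + b))) / 2)"
    by (intro set_lebesgue_integral_cong) (auto simp: cos_add cos_diff sin_diff sin_add algebra_simps)
  also have "\<dots> = ((LBINT t:{0..1}. cos (2 * pi * of_int (l - m) * t - (a - b))) + (LBINT t:{0..1}. cos (2 * pi * of_int (l + m) * t - (a + b)))) / 2"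
    by (subst set_integral_divide_zero, subst set_integral_add) (auto intro!: borel_integrable_atLeastAtMost' continuous_intros)
  also have "(LBINT t:{0..1}. cos (2 * pi * of_int (l + m) * t - (a + b))) = 0"
    by (rule integral_cos_period) (use assms in auto)
  also have "(LBINT t:{0..1}. cos (2 * pi * of_int (l - m) * t - (a - b))) = (if l = m then cos (a - b) else 0)"
    using integral_cos_period[of "l - m" "a - b"] by (auto simp: set_lebesgue_integral_def cos_minus[of "a - b", symmetric] simp del: cos_minus)
  also have "((if l = m then cos (a - b) else 0) + 0) / 2 = (if l = m then cos (a - b) / 2 else 0)" by simp
  finally show ?thesis .
qed

lemma set_integral_finite_sum:
  fixes f :: "'i \<Rightarrow> 'a \<Rightarrow> real"
  assumes "\<And>i. i \<in> I \<Longrightarrow> set_integrable M A (f i)"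
  shows "(LINT x:A|M. (\<Sum>i\<in>I. f i x)) = (\<Sum>i\<in>I. LINT x:A|M. f i x)"
  using assms unfolding set_lebesgue_integral_def set_integrable_def
  by (simp add: sum_distrib_left Bochner_Integration.integral_sum)

text \<open>Orthogonality leaves a trigonometric polynomial in \<open>a - b\<close>; this is the
  form in which the average over two independent shifts can be computed.\<close>

lemma carrier_fejer_inner:
  "(LBINT t:{0..1}. carrier_fejer M (t - a) * carrier_fejer M (t - b)) =
    (\<Sum>l\<in>{int M<..<3 * int M}. (triangle_coeff M l)\<^sup>2 * cos (2 * pi * of_int l * (a - b))) / 2"
proof -
  let ?L = "{int M<..<3 * int M}"
  let ?t = "triangle_coeff M"
  have "(LBINT t:{0..1}. carrier_fejer M (t - a) * carrier_fejer M (t - b)) =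
    (LBINT t:{0..1}. (\<Sum>l\<in>?L. \<Sum>m\<in>?L. ?t l * ?t m * (cos (2 * pi * of_int l * t - 2 * pi * of_int l * a) * cos (2 * pi * of_int m * t - 2 * pi * of_int m * b))))"
    unfolding carrier_fejer_cos sum_product
    by (intro set_lebesgue_integral_cong) (auto simp: algebra_simps)
  also have "\<dots> = (\<Sum>l\<in>?L. \<Sum>m\<in>?L. ?t l * ?t m * (LBINT t:{0..1}. (cos (2 * pi * of_int l * t - 2 * pi * of_int l * a) * cos (2 * pi * of_int m * t - 2 * pi * of_int m * b))))"
  proof -
    have int: "set_integrable lborel {0..1} (\<lambda>t. d * (cos (2 * pi * of_int l * t - u) * cos (2 * pi * of_int m * t - v)))" for l m :: int and d u v
      by (intro borel_integrable_atLeastAtMost' continuous_intros)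
    show ?thesis
      by (subst set_integral_finite_sum, (intro borel_integrable_atLeastAtMost' continuous_intros)[1],
          intro sum.cong refl, subst set_integral_finite_sum, rule int, intro sum.cong refl set_integral_mult_right)
  qed
  also have "\<dots> = (\<Sum>l\<in>?L. \<Sum>m\<in>?L. if m = l then (?t l)\<^sup>2 * cos (2 * pi * of_int l * (a - b)) / 2 else 0)"
  proof (intro sum.cong refl)
    fix l m assume "l \<in> ?L" "m \<in> ?L"
    then have *: "0 < l" "0 < m" by auto
    show "?t l * ?t m * (LBINT t:{0..1}. (cos (2 * pi * of_int l * t - 2 * pi * of_int l * a) * cos (2 * pi * of_int m * t - 2 * pi * of_int m * b))) =
      (if m = l then (?t l)\<^sup>2 * cos (2 * pi * of_int l * (a - b)) / 2 else 0)"
      unfolding integral_cos_cos[OF *] by (simp add: power2_eq_square right_diff_distrib)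
  qed
  finally show ?thesis by (simp add: sum_divide_distrib)
qed

lemma carrier_fejer_norm:
  assumes "0 < M"
  shows "real M / 6 \<le> (LBINT t:{0..1}. (carrier_fejer M (t - a))\<^sup>2)"
proof -
  have "(LBINT t:{0..1}. (carrier_fejer M (t - a))\<^sup>2) = (\<Sum>l\<in>{int M<..<3 * int M}. (triangle_coeff M l)\<^sup>2) / 2"
    unfolding power2_eq_square[of "carrier_fejer _ _"] carrier_fejer_inner by simp
  then show ?thesis using triangle_coeff_sum_squares[OF assms] by linarith
qed

section \<open>Wavelet coefficients of trigonometric functions\<close>

text \<open>The unit intervals between integers tile the line, and moving each of them to the unit
  interval turns \<open>v\<close> into its translates; absolute integrability permits exchanging sum
  and integral.\<close>

lemma periodization_integral:
  fixes v :: "real \<Rightarrow> real"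
  assumes v: "integrable lborel v"
  shows "(LBINT t:{0..1}. (\<Sum>\<^sub>\<infinity>m\<in>(UNIV :: int set). v (t + of_int m))) = (LBINT t. v t)"
proof -
  have vm[measurable]: "v \<in> borel_measurable borel" using v by simp
  define e where "e = int_decode"
  have e: "bij_betw e UNIV UNIV" unfolding e_def by (rule bij_int_decode)
  \<comment> \<open>\<open>f i\<close> is a unit piece of \<open>v\<close> moved to the unit
    interval, \<open>g i\<close> the same piece in place. Half-open intervals make the pieces
    \<open>g i\<close> disjoint, the closed one matches the integral of the statement; they differ
    at a single point.\<close>
  define f where "f i t = indicator {0..1} t * v (t + of_int (e i))" for i :: nat and t :: real
  define g where "g i t = indicator {of_int (e i)..<of_int (e i) + 1} t * v t" for i :: nat and t :: real
  have ind: "indicator {of_int (e i)..<of_int (e i) + 1} t = (of_bool (i = inv e \<lfloor>t\<rfloor>) :: real)" for i t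
  proof -
    have "t \<in> {of_int (e i)..<of_int (e i) + 1} \<longleftrightarrow> \<lfloor>t\<rfloor> = e i" by (simp add: floor_eq_iff)
    also have "\<dots> \<longleftrightarrow> i = inv e \<lfloor>t\<rfloor>" using e by (metis bij_inv_eq_iff)
    finally show ?thesis by (simp add: indicator_def)
  qed
  have g_eq: "g i t = (if i = inv e \<lfloor>t\<rfloor> then v t else 0)" for i t
    unfolding g_def ind by simp
  have g_sums: "(\<lambda>i. g i t) sums v t" for t
    unfolding g_eq using sums_single[of "inv e \<lfloor>t\<rfloor>" "\<lambda>_. v t"] by simp
  have g_abs: "summable (\<lambda>i. norm (g i t))" for t
    by (rule summable_finite[of "{inv e \<lfloor>t\<rfloor>}"]) (auto simp: g_eq)
  have g_int: "integrable lborel (g i)" for i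
    unfolding g_def using integrable_mult_indicator[OF _ v, of "{of_int (e i)..<of_int (e i) + 1}"] by simp
  have f_int: "integrable lborel (f i)" for i
  proof -
    have "integrable lborel (\<lambda>t. v (of_int (e i) + 1 * t))"
      using lborel_integrable_real_affine[OF v, of 1 "of_int (e i)"] by simp
    from integrable_mult_indicator[OF _ this, of "{0..1}"] show ?thesis unfolding f_def by (simp add: add.commute)
  qed
  have fg: "(\<integral>t. F (f i t) \<partial>lborel) = (\<integral>t. F (g i t) \<partial>lborel)" if F: "F \<in> borel_measurable borel" for F :: "real \<Rightarrow> real" and i
  proof -
    have "(\<integral>t. F (indicator {of_int (e i)..of_int (e i) + 1} t * v t) \<partial>lborel) =
      (\<integral>t. F (indicator {of_int (e i)..of_int (e i) + 1} (of_int (e i) + 1 * t) * v (of_int (e i) + 1 * t)) \<partial>lborel)"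
      using lborel_integral_real_affine[of 1 "\<lambda>t. F (indicator {of_int (e i)..of_int (e i) + 1} t * v t)" "of_int (e i)"] by simp
    also have "\<dots> = (\<integral>t. F (f i t) \<partial>lborel)"
      unfolding f_def by (intro Bochner_Integration.integral_cong refl) (auto simp: indicator_def add.commute)
    also have "(\<integral>t. F (indicator {of_int (e i)..of_int (e i) + 1} t * v t) \<partial>lborel) = (\<integral>t. F (g i t) \<partial>lborel)"
    proof (rule integral_cong_AE)
      show "AE t in lborel. F (indicator {of_int (e i)..of_int (e i) + 1} t * v t) = F (g i t)"
        using AE_lborel_singleton[of "of_int (e i) + 1"] 
        by eventually_elim (auto simp: g_def indicator_def)
    qed (use F in \<open>auto simp: g_def\<close>)
    finally show ?thesis by simp
  qed
  have sm: "summable (\<lambda>i. \<integral>t. norm (g i t) \<partial>lborel)"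
  proof (rule summableI_nonneg_bounded[where x="\<integral>t. norm (v t) \<partial>lborel"])
    fix n
    have "(\<Sum>i<n. norm (g i t)) \<le> norm (v t)" for t
    proof -
      have "(\<Sum>i<n. norm (g i t)) = (\<Sum>i<n. if i = inv e \<lfloor>t\<rfloor> then norm (v t) else 0)"
        by (intro sum.cong) (auto simp: g_eq)
      then show ?thesis by simp
    qed
    then have "(\<integral>t. (\<Sum>i<n. norm (g i t)) \<partial>lborel) \<le> (\<integral>t. norm (v t) \<partial>lborel)"
      using v g_int by (intro integral_mono integrable_sum integrable_norm) auto
    then show "(\<Sum>i<n. \<integral>t. norm (g i t) \<partial>lborel) \<le> (\<integral>t. norm (v t) \<partial>lborel)"
      using g_int by (subst (asm) Bochner_Integration.integral_sum) auto
  qed simp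
  have smf: "summable (\<lambda>i. \<integral>t. norm (f i t) \<partial>lborel)"
    using sm fg[of norm] by simp
  have ae: "AE t in lborel. summable (\<lambda>i. norm (f i t))"
  proof -
    have "(\<integral>\<^sup>+t. (\<Sum>i. ennreal (norm (f i t))) \<partial>lborel) = (\<Sum>i. \<integral>\<^sup>+t. ennreal (norm (f i t)) \<partial>lborel)"
      using f_int by (intro nn_integral_suminf) auto
    also have "\<dots> = (\<Sum>i. ennreal (\<integral>t. norm (f i t) \<partial>lborel))"
      using f_int by (intro suminf_cong nn_integral_eq_integral) auto
    also have "\<dots> \<noteq> \<infinity>" using smf by (simp add: suminf_ennreal2)
    finally have "AE t in lborel. (\<Sum>i. ennreal (norm (f i t))) \<noteq> \<infinity>"
      using f_int by (intro nn_integral_noteq_infinite) (auto intro!: borel_measurable_suminf)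
    then show ?thesis by eventually_elim (auto intro!: summable_suminf_not_top)
  qed
  \<comment> \<open>\<open>infsum\<close> is \<open>0\<close> by default where the series is not
    absolutely summable. This explicit form gives measurability everywhere, and by \<open>ae\<close>
    the default occurs on a null subset of the unit interval only.\<close>
  have infs: "(\<Sum>\<^sub>\<infinity>m\<in>(UNIV :: int set). v (t + of_int m)) =
      (if (\<Sum>i. ennreal \<bar>v (t + of_int (e i))\<bar>) = \<infinity> then 0 else (\<Sum>i. v (t + of_int (e i))))" for t
  proof -
    have re: "(\<Sum>\<^sub>\<infinity>m\<in>(UNIV :: int set). v (t + of_int m)) = (\<Sum>\<^sub>\<infinity>i. v (t + of_int (e i)))"
      by (rule infsum_reindex_bij_betw[OF e, symmetric])
    show ?thesis
    proof (cases "(\<Sum>i. ennreal \<bar>v (t + of_int (e i))\<bar>) = \<infinity>")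
      case True
      have "\<not> (\<lambda>i. v (t + of_int (e i))) summable_on UNIV"
      proof
        assume "(\<lambda>i. v (t + of_int (e i))) summable_on UNIV"
        then have "(\<lambda>i. norm (v (t + of_int (e i)))) summable_on UNIV"
          by (subst (asm) summable_on_iff_abs_summable_on_real)
        then have "summable (\<lambda>i. norm (v (t + of_int (e i))))"
          by (subst (asm) summable_on_UNIV_nonneg_real_iff) auto
        then show False using True by (simp add: suminf_ennreal2)
      qed
      then show ?thesis using True by (simp add: re infsum_not_exists)
    next
      case False
      then have s: "summable (\<lambda>i. norm (v (t + of_int (e i))))"
        by (auto intro!: summable_suminf_not_top)
      have "(\<Sum>\<^sub>\<infinity>i. v (t + of_int (e i))) = (\<Sum>i. v (t + of_int (e i)))"
        by (rule infsumI[OF norm_summable_imp_has_sum[OF s summable_sums[OF summable_norm_cancel[OF s]]]])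
      then show ?thesis using False by (simp add: re)
    qed
  qed
  have "(LBINT t:{0..1}. (\<Sum>\<^sub>\<infinity>m\<in>(UNIV :: int set). v (t + of_int m))) = (\<integral>t. (\<Sum>i. f i t) \<partial>lborel)"
    unfolding set_lebesgue_integral_def
  proof (rule integral_cong_AE)
    show "(\<lambda>t. indicator {0..1} t *\<^sub>R (\<Sum>\<^sub>\<infinity>m\<in>(UNIV :: int set). v (t + of_int m))) \<in> borel_measurable lborel"
      unfolding infs by measurable
    show "(\<lambda>t. \<Sum>i. f i t) \<in> borel_measurable lborel"
      unfolding f_def by measurable
    show "AE t in lborel. indicator {0..1} t *\<^sub>R (\<Sum>\<^sub>\<infinity>m\<in>(UNIV :: int set). v (t + of_int m)) = (\<Sum>i. f i t)"
      using ae
    proof eventually_elim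
      fix t assume s: "summable (\<lambda>i. norm (f i t))"
      show "indicator {0..1} t *\<^sub>R (\<Sum>\<^sub>\<infinity>m\<in>(UNIV :: int set). v (t + of_int m)) = (\<Sum>i. f i t)"
      proof (cases "t \<in> {0..1}")
        case True
        then have "f i t = v (t + of_int (e i))" for i by (simp add: f_def)
        then show ?thesis using True s by (simp add: infs suminf_ennreal2)
      qed (simp add: f_def)
    qed
  qed
  also have "\<dots> = (\<Sum>i. \<integral>t. f i t \<partial>lborel)"
    by (rule integral_suminf[OF f_int ae smf])
  also have "\<dots> = (\<Sum>i. \<integral>t. g i t \<partial>lborel)" using fg[of "\<lambda>x. x"] by simp
  also have "\<dots> = (\<integral>t. (\<Sum>i. g i t) \<partial>lborel)"
    using g_abs by (intro integral_suminf[symmetric] g_int sm) auto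
  also have "\<dots> = (\<integral>t. v t \<partial>lborel)" using g_sums by (simp add: sums_iff)
  finally show ?thesis .
qed

text \<open>A \<open>1\<close>-periodic factor can be moved under the periodising sum, so the
  coefficient becomes an integral over the whole line against the original wavelet, here in the
  variable \<open>y = 2 ^ j * t - k\<close>.\<close>

lemma wavelet_coeff_unfold:
  assumes w: "integrable lborel w"
    and b: "b \<in> borel_measurable borel" "\<And>t. \<bar>b t\<bar> \<le> c" "\<And>t m. b (t + of_int (m :: int)) = b t"
  shows "wavelet_coeff w b j k = 2 powr (- real j / 2) * (LBINT y. b ((y + real k) / 2 ^ j) * w y)"
    and "integrable lborel (\<lambda>y. b ((y + real k) / 2 ^ j) * w y)"
proof -
  define v where "v t = b t * w (2 ^ j * t - real k)" for t
  have [measurable]: "w \<in> borel_measurable borel" "b \<in> borel_measurable borel" using w b by auto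
  have bd: "integrable lborel (\<lambda>y. B y * W y)" if "B \<in> borel_measurable borel" "\<And>y. \<bar>B y\<bar> \<le> c" "integrable lborel W"
    for B W :: "real \<Rightarrow> real"
  proof (rule Bochner_Integration.integrable_bound)
    show "integrable lborel (\<lambda>y. c * W y)" using that by simp
    have [measurable]: "W \<in> borel_measurable borel" "B \<in> borel_measurable borel" using that by auto
    show "(\<lambda>y. B y * W y) \<in> borel_measurable lborel" by simp
    show "AE y in lborel. norm (B y * W y) \<le> norm (c * W y)"
      using that(2) by (intro AE_I2) (simp add: abs_mult, meson abs_ge_self abs_ge_zero mult_right_mono order_trans)
  qed
  have "integrable lborel (\<lambda>t. w (- real k + 2 ^ j * t))"
    by (rule lborel_integrable_real_affine[OF w]) simp
  then have v: "integrable lborel v" unfolding v_def using b by (intro bd) (simp_all add: algebra_simps)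
  have "wavelet_coeff w b j k = (LBINT t:{0..1}. 2 powr (real j / 2) * (\<Sum>\<^sub>\<infinity>m\<in>(UNIV :: int set). v (t + of_int m)))"
    unfolding wavelet_coeff_def periodized_def v_def b(3)
    by (simp add: infsum_cmult_right' mult.left_commute)
  also have "\<dots> = 2 powr (real j / 2) * (LBINT t. v t)"
    by (simp add: periodization_integral[OF v])
  also have "(LBINT t. v t) = (LBINT y. v ((real k) / 2 ^ j + (1 / 2 ^ j) * y)) / 2 ^ j"
    using lborel_integral_real_affine[of "1 / 2 ^ j" v "real k / 2 ^ j"] by simp
  also have "(\<lambda>y. v ((real k) / 2 ^ j + (1 / 2 ^ j) * y)) = (\<lambda>y. b ((y + real k) / 2 ^ j) * w y)"
    by (rule ext) (simp add: v_def field_simps)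
  also have "2 powr (real j / 2) * ((LBINT y. b ((y + real k) / 2 ^ j) * w y) / 2 ^ j) = 2 powr (- real j / 2) * (LBINT y. b ((y + real k) / 2 ^ j) * w y)"
  proof -
    have "2 powr (real j / 2) / 2 ^ j = 2 powr (real j / 2 - real j)"
      by (subst powr_diff) (simp add: powr_realpow)
    also have "real j / 2 - real j = - real j / 2" by simp
    finally show ?thesis by (simp add: divide_simps mult_ac)
  qed
  finally show "wavelet_coeff w b j k = 2 powr (- real j / 2) * (LBINT y. b ((y + real k) / 2 ^ j) * w y)" .
  show "integrable lborel (\<lambda>y. b ((y + real k) / 2 ^ j) * w y)"
    using b(2) by (intro bd w) auto
qed

lemma wavelet_coeff_le:
  assumes w: "integrable lborel w"
    and b: "b \<in> borel_measurable borel" "\<And>t. \<bar>b t\<bar> \<le> c" "\<And>t m. b (t + of_int (m :: int)) = b t"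
  shows "\<bar>wavelet_coeff w b j k\<bar> \<le> 2 powr (- real j / 2) * (c * (LBINT y. \<bar>w y\<bar>))"
proof -
  have "\<bar>LBINT y. b ((y + real k) / 2 ^ j) * w y\<bar> \<le> (LBINT y. \<bar>b ((y + real k) / 2 ^ j) * w y\<bar>)"
    by (rule integral_abs_bound)
  also have "\<dots> \<le> (LBINT y. c * \<bar>w y\<bar>)"
  proof (rule integral_mono)
    show "integrable lborel (\<lambda>y. \<bar>b ((y + real k) / 2 ^ j) * w y\<bar>)"
      by (rule integrable_abs[OF wavelet_coeff_unfold(2)[OF w b]])
    show "integrable lborel (\<lambda>y. c * \<bar>w y\<bar>)" using w by simp
    show "\<bar>b ((y + real k) / 2 ^ j) * w y\<bar> \<le> c * \<bar>w y\<bar>" for y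
      unfolding abs_mult by (intro mult_right_mono b(2)) auto
  qed
  finally show ?thesis
    unfolding wavelet_coeff_unfold(1)[OF w b] by (simp add: abs_mult)
qed

lemma cos_periodic_shift: "cos (2 * pi * of_int l * (t + of_int m) - a) = cos (2 * pi * of_int l * t - a)"
proof -
  have "2 * pi * of_int l * (t + of_int m) - a = (2 * pi * of_int l * t - a) + 2 * pi * of_int (l * m)"
    by (simp add: algebra_simps)
  then show ?thesis
    using cos_integer_2pi[of "of_int (l * m)"] sin_integer_2pi[of "of_int (l * m)"] by (simp only: cos_add) simp
qed

text \<open>After unfolding, the addition formula makes the coefficient a combination of the real
  and imaginary parts of the transform at one single frequency.\<close>

lemma wavelet_coeff_cos_eq_0:
  assumes w: "has_fourier_transform w F" and F: "F (- (2 * pi * of_int l / 2 ^ j)) = 0"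
  shows "wavelet_coeff w (\<lambda>t. cos (2 * pi * of_int l * t - a)) j k = 0"
proof -
  have wi: "integrable lborel w" using w by (simp add: has_fourier_transform_def)
  define om where "om = 2 * pi * of_int l / 2 ^ j"
  have [measurable]: "w \<in> borel_measurable borel" using wi by simp
  have e: "iexp (om * x) = cis (om * x)" for x by (simp add: cis_conv_exp)
  have int: "integrable lborel (\<lambda>x. complex_of_real (w x) * cis (om * x))"
    unfolding e[symmetric]
    using wi by (rule Bochner_Integration.integrable_bound[OF _ _ AE_I2]) (auto simp: norm_mult)
  have "(LINT x|lborel. complex_of_real (w x) * iexp (om * x)) = 0"
    using w F unfolding has_fourier_transform_def om_def by simp
  then have z: "(LINT x|lborel. complex_of_real (w x) * cis (om * x)) = 0"
    unfolding e .
  have c0: "(LINT x|lborel. w x * cos (om * x)) = 0"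
    using integral_Re[OF int] by (simp add: z)
  have s0: "(LINT x|lborel. w x * sin (om * x)) = 0"
    using integral_Im[OF int] by (simp add: z)
  have ic: "integrable lborel (\<lambda>x. w x * cos (om * x))" "integrable lborel (\<lambda>x. w x * sin (om * x))"
    using wi by (auto intro!: Bochner_Integration.integrable_bound[OF wi] AE_I2 simp: abs_mult mult_left_le)
  define d where "d = om * real k - a"
  have "(LBINT y. cos (2 * pi * of_int l * ((y + real k) / 2 ^ j) - a) * w y) = (LBINT y. cos d * (w y * cos (om * y)) - sin d * (w y * sin (om * y)))"
  proof (intro Bochner_Integration.integral_cong refl)
    fix y
    have "2 * pi * of_int l * ((y + real k) / 2 ^ j) - a = om * y + d" by (simp add: om_def d_def field_simps)
    then show "cos (2 * pi * of_int l * ((y + real k) / 2 ^ j) - a) * w y = cos d * (w y * cos (om * y)) - sin d * (w y * sin (om * y))"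
      by (simp add: cos_add algebra_simps)
  qed
  also have "\<dots> = 0" using ic by (simp add: c0 s0)
  finally show ?thesis
    by (subst wavelet_coeff_unfold(1)[OF wi _ _ cos_periodic_shift, where c=1]) auto
qed

section \<open>The space of square-integrable functions\<close>

text \<open>From \<open>(p / 2 - q)\<^sup>2 \<ge> 0\<close>. Integrated over two probability
  densities it bounds their affinity below by \<open>1\<close> minus a quarter of the integral of
  \<open>p\<^sup>2 / q\<close>.\<close>

lemma min_ge_quadratic:
  fixes p q :: real
  assumes "0 \<le> p" "0 < q"
  shows "p - p\<^sup>2 / (4 * q) \<le> min p q"
proof -
  have "0 \<le> (p / 2 - q)\<^sup>2 / q" using assms by simp
  also have "(p / 2 - q)\<^sup>2 / q = p\<^sup>2 / (4 * q) - p + q" using assms by (simp add: power2_eq_square field_simps)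
  finally have "p - p\<^sup>2 / (4 * q) \<le> q" by simp
  moreover have "0 \<le> p\<^sup>2 / (4 * q)" using assms by simp
  ultimately show ?thesis by simp
qed

text \<open>No number is close to two points at distance \<open>\<bar>d\<bar>\<close>; the midpoint
  attains the minimum. This forces an error at one of two neighbouring vertices.\<close>

lemma two_squares_ge:
  fixes z b d :: real
  shows "d\<^sup>2 / 2 \<le> (z - b)\<^sup>2 + (z - (b + d))\<^sup>2"
proof -
  have "0 \<le> (2 * (z - b) - d)\<^sup>2 / 2" by simp
  then show ?thesis by (simp add: power2_eq_square algebra_simps)
qed

lemma L2_diff_mem:
  assumes "f \<in> L2_01" "h \<in> L2_01"
  shows "(\<lambda>t. f t - h t) \<in> L2_01"
    and "set_integrable lborel {0..1} (\<lambda>t. f t * h t)"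
proof -
  \<comment> \<open>Membership in \<open>L2_01\<close> says nothing outside the unit interval, so
    all functions are cut off there first.\<close>
  define F where "F t = indicator {0..1} t * f t" for t :: real
  define H where "H t = indicator {0..1} t * h t" for t :: real
  have [measurable]: "F \<in> borel_measurable lborel" "H \<in> borel_measurable lborel"
    using assms unfolding L2_01_def set_borel_measurable_def F_def[abs_def] H_def[abs_def] by auto
  have sq: "indicator {0..1} t *\<^sub>R (f t)\<^sup>2 = (F t)\<^sup>2" "indicator {0..1} t *\<^sub>R (h t)\<^sup>2 = (H t)\<^sup>2" for t
    by (auto simp: F_def H_def indicator_def)
  have i: "integrable lborel (\<lambda>t. (F t)\<^sup>2)" "integrable lborel (\<lambda>t. (H t)\<^sup>2)"
    using assms unfolding L2_01_def set_integrable_def by (simp_all only: sq mem_Collect_eq)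
  have FH: "integrable lborel (\<lambda>t. F t * H t)"
  proof (rule Bochner_Integration.integrable_bound[OF Bochner_Integration.integrable_add[OF i] _ AE_I2])
    fix t
    have "2 * \<bar>F t\<bar> * \<bar>H t\<bar> \<le> (F t)\<^sup>2 + (H t)\<^sup>2"
      using sum_squares_bound[of "\<bar>F t\<bar>" "\<bar>H t\<bar>"] by simp
    then show "norm (F t * H t) \<le> norm ((F t)\<^sup>2 + (H t)\<^sup>2)"
      unfolding real_norm_def abs_mult mult.assoc
      using abs_ge_self[of "(F t)\<^sup>2 + (H t)\<^sup>2"] zero_le_mult_iff[of "\<bar>F t\<bar>" "\<bar>H t\<bar>"] by linarith
  qed simp
  have "indicator {0..1} t *\<^sub>R (f t * h t) = F t * H t" for t by (auto simp: F_def H_def indicator_def)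
  then show "set_integrable lborel {0..1} (\<lambda>t. f t * h t)" unfolding set_integrable_def using FH by simp
  have "integrable lborel (\<lambda>t. (F t)\<^sup>2 - 2 * (F t * H t) + (H t)\<^sup>2)" using i FH by auto
  moreover have "(F t)\<^sup>2 - 2 * (F t * H t) + (H t)\<^sup>2 = indicator {0..1} t *\<^sub>R (f t - h t)\<^sup>2" for t
    by (auto simp: F_def H_def indicator_def power2_eq_square algebra_simps)
  moreover have "(\<lambda>t. F t - H t) \<in> borel_measurable lborel" by simp
  moreover have "F t - H t = indicator {0..1} t *\<^sub>R (f t - h t)" for t by (auto simp: F_def H_def indicator_def)
  ultimately show "(\<lambda>t. f t - h t) \<in> L2_01"
    unfolding L2_01_def set_borel_measurable_def set_integrable_def by simp
qed

lemma L2_norm_nonneg: "0 \<le> L2_norm_01 f"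
  unfolding L2_norm_01_def set_lebesgue_integral_def by (intro real_sqrt_ge_zero integral_nonneg_AE) auto

lemma L2_norm_sq: "(L2_norm_01 f)\<^sup>2 = (LBINT t:{0..1}. (f t)\<^sup>2)"
  unfolding L2_norm_01_def set_lebesgue_integral_def
  by (intro real_sqrt_pow2 integral_nonneg_AE) auto

lemma quadratic_discriminant:
  fixes a b c :: real
  assumes "\<And>x. 0 \<le> a - 2 * x * b + x\<^sup>2 * c" "0 \<le> a" "0 \<le> c"
  shows "b\<^sup>2 \<le> a * c"
proof (cases "c = 0")
  case True
  have "b = 0"
  proof (rule ccontr)
    assume "b \<noteq> 0"
    \<comment> \<open>For \<open>c = 0\<close> the polynomial is affine; at this point it equals
      \<open>- a - 2\<close>.\<close>
    then show False using assms(1)[of "(a + 1) / b"] True assms(2) by simp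
  qed
  then show ?thesis using True by simp
next
  case False
  then have "0 \<le> c * (a - 2 * (b / c) * b + (b / c)\<^sup>2 * c)" using assms(1)[of "b / c"] assms(3) by simp
  also have "\<dots> = a * c - b\<^sup>2" using False by (simp add: power2_eq_square field_simps)
  finally show ?thesis by simp
qed

lemma continuous_in_L2_01:
  assumes "continuous_on {0..1} g"
  shows "g \<in> L2_01"
  unfolding L2_01_def set_borel_measurable_def
  using borel_measurable_continuous_on_indicator[OF _ assms]
    borel_integrable_atLeastAtMost'[OF continuous_on_power[OF assms, of 2]] by simp

text \<open>The weight will be a translate of the Fejer kernel. A continuous weight is bounded on
  the unit interval, so the weighted integrals of a square-integrable \<open>f\<close>
  exist.\<close>

lemma weighted_Cauchy_Schwarz:
  assumes f: "f \<in> L2_01" and h: "continuous_on {0..1} h" and w: "continuous_on {0..1} w" "\<And>t. 0 \<le> w t"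
  shows "(LBINT t:{0..1}. f t * (w t * h t))\<^sup>2 \<le> (LBINT t:{0..1}. (f t)\<^sup>2 * w t) * (LBINT t:{0..1}. (h t)\<^sup>2 * w t)"
    and "set_integrable lborel {0..1} (\<lambda>t. (f t)\<^sup>2 * w t)"
    and "set_integrable lborel {0..1} (\<lambda>t. f t * (w t * h t))"
proof -
  have "bounded (w ` {0..1})"
    by (rule compact_imp_bounded[OF compact_continuous_image[OF w(1)]]) simp
  then obtain B where "\<forall>y\<in>w ` {0..1}. norm y \<le> B" unfolding bounded_iff by blast
  then have B: "\<And>t. t \<in> {0..1} \<Longrightarrow> norm (w t) \<le> B" by blast
  have wm: "(\<lambda>t. indicator {0..1} t * w t) \<in> borel_measurable lborel"
    using borel_measurable_continuous_on_indicator[OF _ w(1)] by simp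
  have fm: "(\<lambda>t. indicator {0..1} t * f t) \<in> borel_measurable lborel"
    using f by (simp add: L2_01_def set_borel_measurable_def)
  show i1: "set_integrable lborel {0..1} (\<lambda>t. (f t)\<^sup>2 * w t)"
    unfolding set_integrable_def
  proof (rule Bochner_Integration.integrable_bound[OF _ _ AE_I2])
    show "integrable lborel (\<lambda>t. B * (indicator {0..1} t *\<^sub>R (f t)\<^sup>2))"
      using f by (intro integrable_mult_right) (simp add: L2_01_def set_integrable_def)
    have "(\<lambda>t. (indicator {0..1} t * f t)\<^sup>2 * (indicator {0..1} t * w t)) \<in> borel_measurable lborel"
      using wm fm by measurable
    also have "(\<lambda>t. (indicator {0..1} t * f t)\<^sup>2 * (indicator {0..1} t * w t)) = (\<lambda>t. indicator {0..1} t *\<^sub>R ((f t)\<^sup>2 * w t))"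
      by (auto simp: indicator_def)
    finally show "(\<lambda>t. indicator {0..1} t *\<^sub>R ((f t)\<^sup>2 * w t)) \<in> borel_measurable lborel" .
    show "norm (indicator {0..1} t *\<^sub>R ((f t)\<^sup>2 * w t)) \<le> norm (B * (indicator {0..1} t *\<^sub>R (f t)\<^sup>2))" for t
    proof (cases "t \<in> {0..1}")
      case True
      have "w t * (f t)\<^sup>2 \<le> \<bar>B\<bar> * (f t)\<^sup>2" using B[OF True] w(2)[of t] by (intro mult_right_mono) auto
      moreover have "0 \<le> w t * (f t)\<^sup>2" using w(2) by simp
      ultimately show ?thesis using True w(2)[of t] by (simp add: abs_mult mult.commute)
    qed simp
  qed
  show i2: "set_integrable lborel {0..1} (\<lambda>t. f t * (w t * h t))"
    using L2_diff_mem(2)[OF f continuous_in_L2_01[OF continuous_on_mult[OF w(1) h]]] .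
  have i3: "set_integrable lborel {0..1} (\<lambda>t. (h t)\<^sup>2 * w t)"
    using h w by (intro borel_integrable_atLeastAtMost' continuous_intros)
  show "(LBINT t:{0..1}. f t * (w t * h t))\<^sup>2 \<le> (LBINT t:{0..1}. (f t)\<^sup>2 * w t) * (LBINT t:{0..1}. (h t)\<^sup>2 * w t)"
  proof (rule quadratic_discriminant)
    fix x
    have "0 \<le> (LBINT t:{0..1}. (f t - x * h t)\<^sup>2 * w t)"
      unfolding set_lebesgue_integral_def using w(2) by (intro integral_nonneg_AE) auto
    also have "(LBINT t:{0..1}. (f t - x * h t)\<^sup>2 * w t) =
      (LBINT t:{0..1}. (f t)\<^sup>2 * w t - 2 * x * (f t * (w t * h t)) + x\<^sup>2 * ((h t)\<^sup>2 * w t))"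
      by (intro arg_cong[where f="set_lebesgue_integral lborel {0..1}"] ext) (simp add: power2_eq_square algebra_simps)
    also have "\<dots> = (LBINT t:{0..1}. (f t)\<^sup>2 * w t) - 2 * x * (LBINT t:{0..1}. f t * (w t * h t)) + x\<^sup>2 * (LBINT t:{0..1}. (h t)\<^sup>2 * w t)"
      using i1 i2 i3 by (simp add: set_integral_add set_integral_diff)
    finally show "0 \<le> (LBINT t:{0..1}. (f t)\<^sup>2 * w t) - 2 * x * (LBINT t:{0..1}. f t * (w t * h t)) + x\<^sup>2 * (LBINT t:{0..1}. (h t)\<^sup>2 * w t)" .
  qed (use w(2) in \<open>auto simp: set_lebesgue_integral_def intro!: integral_nonneg_AE\<close>)
qed

lemma L2_norm_triangle:
  assumes f: "f \<in> L2_01" and h: "h \<in> L2_01"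
  shows "L2_norm_01 (\<lambda>t. f t + h t) \<le> L2_norm_01 f + L2_norm_01 h"
proof (rule power2_le_imp_le)
  let ?I = "\<lambda>g. LBINT t:{0..1}. g t"
  have i: "set_integrable lborel {0..1} (\<lambda>t. (f t)\<^sup>2)" "set_integrable lborel {0..1} (\<lambda>t. (h t)\<^sup>2)"
    "set_integrable lborel {0..1} (\<lambda>t. f t * h t)"
    using f h L2_diff_mem(2)[OF f h] by (auto simp: L2_01_def)
  have "(?I (\<lambda>t. f t * h t))\<^sup>2 \<le> ?I (\<lambda>t. (f t)\<^sup>2) * ?I (\<lambda>t. (h t)\<^sup>2)"
  proof (rule quadratic_discriminant)
    fix x
    have "0 \<le> ?I (\<lambda>t. (f t - x * h t)\<^sup>2)"
      unfolding set_lebesgue_integral_def by (intro integral_nonneg_AE) auto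
    also have "?I (\<lambda>t. (f t - x * h t)\<^sup>2) = ?I (\<lambda>t. (f t)\<^sup>2 - 2 * x * (f t * h t) + x\<^sup>2 * (h t)\<^sup>2)"
      by (intro arg_cong[where f="set_lebesgue_integral lborel {0..1}"] ext) (simp add: power2_eq_square algebra_simps)
    also have "\<dots> = ?I (\<lambda>t. (f t)\<^sup>2) - 2 * x * ?I (\<lambda>t. f t * h t) + x\<^sup>2 * ?I (\<lambda>t. (h t)\<^sup>2)"
      using i by (simp add: set_integral_add set_integral_diff)
    finally show "0 \<le> ?I (\<lambda>t. (f t)\<^sup>2) - 2 * x * ?I (\<lambda>t. f t * h t) + x\<^sup>2 * ?I (\<lambda>t. (h t)\<^sup>2)" .
  qed (auto simp: set_lebesgue_integral_def intro!: integral_nonneg_AE)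
  then have "(?I (\<lambda>t. f t * h t))\<^sup>2 \<le> (L2_norm_01 f * L2_norm_01 h)\<^sup>2"
    by (simp add: power_mult_distrib L2_norm_sq)
  then have cs: "?I (\<lambda>t. f t * h t) \<le> L2_norm_01 f * L2_norm_01 h"
    by (rule power2_le_imp_le) (intro mult_nonneg_nonneg L2_norm_nonneg)
  have "(L2_norm_01 (\<lambda>t. f t + h t))\<^sup>2 = ?I (\<lambda>t. (f t)\<^sup>2 + 2 * (f t * h t) + (h t)\<^sup>2)"
    unfolding L2_norm_sq
    by (intro arg_cong[where f="set_lebesgue_integral lborel {0..1}"] ext) (simp add: power2_eq_square algebra_simps)
  also have "\<dots> = ?I (\<lambda>t. (f t)\<^sup>2) + 2 * ?I (\<lambda>t. f t * h t) + ?I (\<lambda>t. (h t)\<^sup>2)"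
    using i by (simp add: set_integral_add)
  also have "\<dots> \<le> (L2_norm_01 f)\<^sup>2 + 2 * (L2_norm_01 f * L2_norm_01 h) + (L2_norm_01 h)\<^sup>2"
    using cs by (simp add: L2_norm_sq)
  also have "\<dots> = (L2_norm_01 f + L2_norm_01 h)\<^sup>2" by (simp add: power2_eq_square algebra_simps)
  finally show "(L2_norm_01 (\<lambda>t. f t + h t))\<^sup>2 \<le> (L2_norm_01 f + L2_norm_01 h)\<^sup>2" .
qed (use L2_norm_nonneg in auto)

text \<open>By the triangle inequality balls are open in the sense of \<open>L2_open\<close>; this
  makes the loss of an estimator measurable.\<close>

lemma measurable_L2_dist:
  assumes g: "g \<in> L2_01"
  shows "(\<lambda>f. L2_norm_01 (\<lambda>t. f t - g t)) \<in> borel_measurable L2_borel"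
proof (rule borel_measurableI_less)
  fix c
  have sp: "space L2_borel = L2_01" "sets L2_borel = sigma_sets L2_01 {U. L2_open U}"
    unfolding L2_borel_def by (rule space_measure_of sets_measure_of; auto simp: L2_open_def)+
  let ?U = "{f \<in> L2_01. L2_norm_01 (\<lambda>t. f t - g t) < c}"
  have "L2_open ?U" unfolding L2_open_def
  proof (intro conjI ballI)
    fix f assume f: "f \<in> ?U"
    show "\<exists>e>0. \<forall>h\<in>L2_01. L2_norm_01 (\<lambda>t. h t - f t) < e \<longrightarrow> h \<in> ?U"
    proof (intro exI[of _ "c - L2_norm_01 (\<lambda>t. f t - g t)"] conjI ballI impI)
      fix h assume h: "h \<in> L2_01" "L2_norm_01 (\<lambda>t. h t - f t) < c - L2_norm_01 (\<lambda>t. f t - g t)"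
      have "L2_norm_01 (\<lambda>t. (h t - f t) + (f t - g t)) \<le> L2_norm_01 (\<lambda>t. h t - f t) + L2_norm_01 (\<lambda>t. f t - g t)"
        using f g h by (intro L2_norm_triangle L2_diff_mem) auto
      then show "h \<in> ?U" using h by simp
    qed (use f in auto)
  qed auto
  then have "?U \<in> sets L2_borel" unfolding sp by (intro sigma_sets.Basic) simp
  then show "{f \<in> space L2_borel. L2_norm_01 (\<lambda>t. f t - g t) < c} \<in> sets L2_borel" unfolding sp(1) .
qed

section \<open>The observation law as a mixture density\<close>

text \<open>The density, with respect to the Poisson law of constant rate \<open>\<rho>\<close>, of
  the one with intensity \<open>\<rho> + f\<close> shifted by \<open>\<tau>\<close>; there is no
  exponential factor when the masses agree.\<close>

definition likelihood :: "real \<Rightarrow> (real \<Rightarrow> real) \<Rightarrow> real \<Rightarrow> real multiset \<Rightarrow> real" where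
  "likelihood \<rho> f \<tau> N = (\<Prod>x\<in>#N. 1 + f (x - \<tau>) / \<rho>)"

lemma laplace_integral:
  assumes "has_laplace_functional P f" "h \<in> borel_measurable borel" "\<And>x. 0 \<le> h x" "\<And>x. h x \<le> b"
  shows "(\<integral>\<^sup>+N. ennreal (\<Prod>x\<in>#N. h x) \<partial>P) = ennreal (exp (LBINT t:{0..1}. (h t - 1) * f t))"
  using assms unfolding has_laplace_functional_def by blast

text \<open>The bound \<open>\<rho> / 2\<close> keeps every factor of the likelihood between
  \<open>1 / 2\<close> and \<open>3 / 2\<close>. The mean is zero for each shift so that shifted
  intensities keep the mass \<open>\<rho>\<close>. Continuity gives joint measurability in shift and
  configuration.\<close>

locale perturbation =
  fixes \<rho> :: real and f :: "real \<Rightarrow> real"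
  assumes rho: "0 < \<rho>"
    and cont: "continuous_on UNIV f"
    and small: "\<And>t. \<bar>f t\<bar> \<le> \<rho> / 2"
    and periodic: "\<And>t m. f (t + of_int (m :: int)) = f t"
    and mean_zero: "\<And>\<tau>. (LBINT t:{0..1}. f (t - \<tau>)) = 0"
begin

lemma f_measurable [measurable]: "f \<in> borel_measurable borel"
  using cont by (rule borel_measurable_continuous_onI)

lemma factor_bounds: "1 / 2 \<le> 1 + f t / \<rho>" "1 + f t / \<rho> \<le> 3 / 2"
  using small[of t] rho by (auto simp: abs_le_iff field_simps)

lemma factor_nonneg: "0 \<le> 1 + f t / \<rho>"
  using factor_bounds(1)[of t] by linarith

lemma likelihood_bounds:
  "(1 / 2) ^ size N \<le> likelihood \<rho> f \<tau> N" "likelihood \<rho> f \<tau> N \<le> (3 / 2) ^ size N"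
proof -
  have "(1 / 2) ^ size N \<le> likelihood \<rho> f \<tau> N \<and> likelihood \<rho> f \<tau> N \<le> (3 / 2) ^ size N"
  proof (induction N)
    case (add x N)
    have L0: "0 \<le> likelihood \<rho> f \<tau> N" using add by (auto intro: order_trans[of 0 "(1/2) ^ size N"])
    have "(1 / 2) * (1 / 2) ^ size N \<le> (1 + f (x - \<tau>) / \<rho>) * likelihood \<rho> f \<tau> N"
      using add factor_bounds(1)[of "x - \<tau>"] factor_nonneg by (intro mult_mono) auto
    moreover have "(1 + f (x - \<tau>) / \<rho>) * likelihood \<rho> f \<tau> N \<le> (3 / 2) * (3 / 2) ^ size N"
      using add L0 factor_bounds(2)[of "x - \<tau>"] by (intro mult_mono) auto
    ultimately show ?case by (simp add: likelihood_def)
  qed (simp add: likelihood_def)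
  then show "(1 / 2) ^ size N \<le> likelihood \<rho> f \<tau> N" "likelihood \<rho> f \<tau> N \<le> (3 / 2) ^ size N" by auto
qed

lemma likelihood_nonneg: "0 \<le> likelihood \<rho> f \<tau> N"
  using likelihood_bounds(1)[of N \<tau>] zero_le_power[of "1/2::real" "size N"] by linarith

lemma poisson_law_shift:
  "poisson_law (\<lambda>t. periodic_ext (\<lambda>t. \<rho> + f t) (t - \<tau>)) =
    density (poisson_law (\<lambda>_. \<rho>)) (\<lambda>N. ennreal (likelihood \<rho> f \<tau> N))"
proof -
  have pe: "periodic_ext (\<lambda>t. \<rho> + f t) t = \<rho> + f t" for t
    using periodic[of t "- \<lfloor>t\<rfloor>"] by (simp add: periodic_ext_def frac_def)
  have int: "set_integrable lborel {0..1} (\<lambda>t. f (t - \<tau>))"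
    using small by (intro set_integrable_bounded[where c="\<rho> / 2"]) auto
  have "poisson_law (\<lambda>t. \<rho> + f (t - \<tau>)) =
    density (poisson_law (\<lambda>_. \<rho>)) (\<lambda>N. ennreal (\<Prod>x\<in>#N. (\<rho> + f (x - \<tau>)) / \<rho>))"
  proof (rule poisson_law_density[OF rho])
    show "(LBINT t:{0..1}. \<rho> + f (t - \<tau>)) = \<rho>"
      using int mean_zero[of \<tau>] by (subst set_integral_add) (auto simp: set_integrable_def set_lebesgue_integral_def)
    show "0 \<le> \<rho> + f (t - \<tau>)" "\<rho> + f (t - \<tau>) \<le> 2 * \<rho>" for t
      using small[of "t - \<tau>"] rho by (auto simp: abs_le_iff)
  qed simp
  also have "(\<lambda>N. ennreal (\<Prod>x\<in>#N. (\<rho> + f (x - \<tau>)) / \<rho>)) = (\<lambda>N. ennreal (likelihood \<rho> f \<tau> N))"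
    using rho by (simp add: likelihood_def add_divide_distrib)
  finally show ?thesis unfolding pe .
qed

text \<open>The likelihood is continuous in the shift and measurable in the configuration. Rounding
  the shift down to multiples of \<open>1 / (i + 1)\<close> leaves countably many values, and the
  limit recovers the likelihood.\<close>

lemma measurable_likelihood:
  "(\<lambda>(\<tau>, N). likelihood \<rho> f \<tau> N) \<in> borel_measurable (borel \<Otimes>\<^sub>M config_space)"
proof (rule borel_measurable_LIMSEQ_metric[where f="\<lambda>i (\<tau>, N). likelihood \<rho> f (of_int \<lfloor>real (Suc i) * \<tau>\<rfloor> / real (Suc i)) N"])
  fix i
  have "(\<lambda>x. likelihood \<rho> f (of_int m / real (Suc i)) (snd x)) \<in> borel_measurable (borel \<Otimes>\<^sub>M config_space)" for m :: int
    unfolding likelihood_def by measurable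
  then have "(\<lambda>x. likelihood \<rho> f (of_int \<lfloor>real (Suc i) * fst x\<rfloor> / real (Suc i)) (snd x)) \<in> borel_measurable (borel \<Otimes>\<^sub>M config_space)"
    by (rule measurable_compose_countable) measurable
  then show "(\<lambda>(\<tau>, N). likelihood \<rho> f (of_int \<lfloor>real (Suc i) * \<tau>\<rfloor> / real (Suc i)) N) \<in> borel_measurable (borel \<Otimes>\<^sub>M config_space)"
    by (simp add: case_prod_beta')
next
  fix x :: "real \<times> real multiset"
  obtain \<tau> N where x: "x = (\<tau>, N)" by force
  have lim: "(\<lambda>i. of_int \<lfloor>real (Suc i) * \<tau>\<rfloor> / real (Suc i)) \<longlonglongrightarrow> \<tau>"
  proof (rule tendsto_sandwich[where f="\<lambda>i. \<tau> - 1 / real (Suc i)" and h="\<lambda>_. \<tau>"])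
    show "(\<lambda>i. \<tau> - 1 / real (Suc i)) \<longlonglongrightarrow> \<tau>"
      using tendsto_diff[OF tendsto_const LIMSEQ_inverse_real_of_nat, of \<tau>] by (simp add: inverse_eq_divide)
    show "\<forall>\<^sub>F i in sequentially. \<tau> - 1 / real (Suc i) \<le> of_int \<lfloor>real (Suc i) * \<tau>\<rfloor> / real (Suc i)"
    proof (intro always_eventually allI)
      fix i
      have "real (Suc i) * \<tau> - 1 \<le> of_int \<lfloor>real (Suc i) * \<tau>\<rfloor>" by linarith
      then have "(real (Suc i) * \<tau> - 1) / real (Suc i) \<le> of_int \<lfloor>real (Suc i) * \<tau>\<rfloor> / real (Suc i)"
        by (rule divide_right_mono) simp
      then show "\<tau> - 1 / real (Suc i) \<le> of_int \<lfloor>real (Suc i) * \<tau>\<rfloor> / real (Suc i)"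
        by (simp add: diff_divide_distrib del: of_nat_Suc)
    qed
    show "\<forall>\<^sub>F i in sequentially. of_int \<lfloor>real (Suc i) * \<tau>\<rfloor> / real (Suc i) \<le> \<tau>"
    proof (intro always_eventually allI)
      fix i
      have "of_int \<lfloor>real (Suc i) * \<tau>\<rfloor> \<le> real (Suc i) * \<tau>" by linarith
      then show "of_int \<lfloor>real (Suc i) * \<tau>\<rfloor> / real (Suc i) \<le> \<tau>"
        by (simp add: pos_divide_le_eq mult.commute del: of_nat_Suc)
    qed
  qed simp
  have "(\<lambda>i. likelihood \<rho> f (of_int \<lfloor>real (Suc i) * \<tau>\<rfloor> / real (Suc i)) N) \<longlonglongrightarrow> likelihood \<rho> f \<tau> N"
    unfolding likelihood_def
  proof (intro tendsto_prod_mset tendsto_intros)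
    fix y
    have "isCont f (y - \<tau>)" using cont by (simp add: continuous_on_eq_continuous_at)
    then show "(\<lambda>i. f (y - of_int \<lfloor>real (Suc i) * \<tau>\<rfloor> / real (Suc i))) \<longlonglongrightarrow> f (y - \<tau>)"
      by (rule isCont_tendsto_compose) (intro tendsto_intros lim)
  qed (use rho in auto)
  then show "(\<lambda>i. case x of (\<tau>, N) \<Rightarrow> likelihood \<rho> f (of_int \<lfloor>real (Suc i) * \<tau>\<rfloor> / real (Suc i)) N) \<longlonglongrightarrow> (case x of (\<tau>, N) \<Rightarrow> likelihood \<rho> f \<tau> N)"
    by (simp add: x)
qed

end

locale shift_density =
  fixes g :: "real \<Rightarrow> real"
  assumes g_measurable [measurable]: "g \<in> borel_measurable borel"
    and g_nonneg: "\<And>x. 0 \<le> g x"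
    and g_total: "(\<integral>\<^sup>+ x. ennreal (g x) \<partial>lborel) = 1"
begin

definition shift_law :: "real measure" where
  "shift_law = density lborel (\<lambda>x. ennreal (g x))"

lemma sets_shift_law [simp, measurable_cong]: "sets shift_law = sets borel"
  and space_shift_law [simp]: "space shift_law = UNIV"
  by (simp_all add: shift_law_def)

lemma prob_space_shift_law: "prob_space shift_law"
  by (rule prob_spaceI) (simp add: shift_law_def emeasure_density g_total)

end

locale shifted_perturbation = shift_density + perturbation
begin

definition base_law :: "real multiset measure" where
  "base_law = poisson_law (\<lambda>_. \<rho>)"

lemma base_laplace: "has_laplace_functional base_law (\<lambda>_. \<rho>)"
  unfolding base_law_def by (rule laplace_homogeneous[OF rho])

lemma sets_base_law [simp, measurable_cong]: "sets base_law = sets config_space"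
  using base_laplace by (simp add: has_laplace_functional_def)

lemma prob_space_base_law: "prob_space base_law"
  using base_laplace by (rule laplace_prob_space)

text \<open>The density, with respect to \<open>base_law\<close>, of one observed process with its
  shift averaged out.\<close>

definition mixture :: "real multiset \<Rightarrow> ennreal" where
  "mixture N = (\<integral>\<^sup>+\<tau>. ennreal (likelihood \<rho> f \<tau> N) \<partial>shift_law)"

lemma measurable_likelihood_pair [measurable]:
  "(\<lambda>x. likelihood \<rho> f (fst x) (snd x)) \<in> borel_measurable (borel \<Otimes>\<^sub>M config_space)"
  using measurable_likelihood by (simp add: case_prod_beta')

lemma measurable_likelihood_compose [measurable (raw)]:
  assumes "a \<in> M \<rightarrow>\<^sub>M borel" "b \<in> M \<rightarrow>\<^sub>M config_space"
  shows "(\<lambda>x. likelihood \<rho> f (a x) (b x)) \<in> borel_measurable M"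
  using measurable_compose[OF measurable_Pair[OF assms] measurable_likelihood_pair] by simp

lemma measurable_mixture [measurable]: "mixture \<in> borel_measurable config_space"
proof -
  interpret G: prob_space shift_law by (rule prob_space_shift_law)
  show ?thesis unfolding mixture_def[abs_def] by measurable
qed

lemma likelihood_total: "(\<integral>\<^sup>+N. ennreal (likelihood \<rho> f t N) \<partial>base_law) = 1"
proof -
  have "(\<integral>\<^sup>+N. ennreal (\<Prod>x\<in>#N. 1 + f (x - t) / \<rho>) \<partial>base_law) = ennreal (exp (LBINT s:{0..1}. (1 + f (s - t) / \<rho> - 1) * \<rho>))"
  proof (rule laplace_integral[OF base_laplace])
    show "0 \<le> 1 + f (x - t) / \<rho>" "1 + f (x - t) / \<rho> \<le> 3 / 2" for x
      using factor_bounds(2)[of "x - t"] factor_nonneg[of "x - t"] by auto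
  qed simp
  then show ?thesis using rho mean_zero[of t] by (simp add: likelihood_def)
qed

lemma observation_kernel:
  fixes \<tau> :: "nat \<Rightarrow> real"
  shows "PiM {..<n} (\<lambda>i. poisson_law (\<lambda>t. periodic_ext (\<lambda>t. \<rho> + f t) (t - \<tau> i))) =
    density (PiM {..<n} (\<lambda>_. base_law)) (\<lambda>N. \<Prod>i<n. ennreal (likelihood \<rho> f (\<tau> i) (N i)))"
proof -
  define D where "D i = density base_law (\<lambda>N. ennreal (likelihood \<rho> f (\<tau> i) N))" for i :: nat
  interpret B: prob_space base_law by (rule prob_space_base_law)
  interpret BB: product_sigma_finite "\<lambda>_::nat. base_law" by unfold_locales
  have sD: "sets (D i) = sets config_space" for i by (simp add: D_def)
  have m: "(\<lambda>N. ennreal (likelihood \<rho> f (\<tau> i) N)) \<in> borel_measurable base_law" for i :: nat by measurable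
  have "sigma_finite_measure (D i)" for i
    unfolding D_def by (subst B.sigma_finite_iff_density_finite[OF m]) auto
  then interpret DD: product_sigma_finite D by (simp add: product_sigma_finite_def)
  have "density (PiM {..<n} (\<lambda>_. base_law)) (\<lambda>N. \<Prod>i<n. ennreal (likelihood \<rho> f (\<tau> i) (N i))) = PiM {..<n} D"
  proof (rule DD.PiM_eqI)
    show "sets (density (PiM {..<n} (\<lambda>_. base_law)) (\<lambda>N. \<Prod>i<n. ennreal (likelihood \<rho> f (\<tau> i) (N i)))) = sets (PiM {..<n} D)"
      by (simp add: sD cong: sets_PiM_cong)
    fix A assume "\<And>i. i \<in> {..<n} \<Longrightarrow> A i \<in> sets (D i)"
    then have A[measurable]: "\<And>i. i \<in> {..<n} \<Longrightarrow> A i \<in> sets config_space" by (simp add: sD)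
    then have Am: "PiE {..<n} A \<in> sets (PiM {..<n} (\<lambda>_. base_law))" by (intro sets_PiM_I_finite) auto
    have "emeasure (density (PiM {..<n} (\<lambda>_. base_law)) (\<lambda>N. \<Prod>i<n. ennreal (likelihood \<rho> f (\<tau> i) (N i)))) (PiE {..<n} A) =
      (\<integral>\<^sup>+N. (\<Prod>i<n. ennreal (likelihood \<rho> f (\<tau> i) (N i))) * indicator (PiE {..<n} A) N \<partial>PiM {..<n} (\<lambda>_. base_law))"
      by (rule emeasure_density[OF _ Am]) measurable
    also have "\<dots> = (\<integral>\<^sup>+N. (\<Prod>i<n. ennreal (likelihood \<rho> f (\<tau> i) (N i)) * indicator (A i) (N i)) \<partial>PiM {..<n} (\<lambda>_. base_law))"
    proof (intro nn_integral_cong)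
      fix N assume "N \<in> space (PiM {..<n} (\<lambda>_. base_law))"
      then have "N \<in> extensional {..<n}" by (auto simp: space_PiM PiE_def)
      then have "(\<Prod>i<n. indicator (A i) (N i) :: ennreal) = indicator (PiE {..<n} A) N"
        by (auto simp: indicator_def PiE_def Pi_def)
      then show "(\<Prod>i<n. ennreal (likelihood \<rho> f (\<tau> i) (N i))) * indicator (PiE {..<n} A) N =
        (\<Prod>i<n. ennreal (likelihood \<rho> f (\<tau> i) (N i)) * indicator (A i) (N i))"
        by (simp add: prod.distrib)
    qed
    also have "\<dots> = (\<Prod>i<n. \<integral>\<^sup>+N. ennreal (likelihood \<rho> f (\<tau> i) N) * indicator (A i) N \<partial>base_law)"
      using A by (intro BB.product_nn_integral_prod) auto
    also have "\<dots> = (\<Prod>i<n. emeasure (D i) (A i))"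
      using A unfolding D_def by (intro prod.cong refl) (simp add: emeasure_density)
    finally show "emeasure (density (PiM {..<n} (\<lambda>_. base_law)) (\<lambda>N. \<Prod>i<n. ennreal (likelihood \<rho> f (\<tau> i) (N i)))) (PiE {..<n} A) =
      (\<Prod>i<n. emeasure (D i) (A i))" .
  qed simp
  then show ?thesis unfolding poisson_law_shift D_def base_law_def by simp
qed

text \<open>Given the shifts the likelihoods multiply, and the shifts are independent, so by Tonelli
  the average of the product is the product of the averages: the observations are independent with
  density \<open>mixture\<close>.\<close>

lemma observation_integral:
  assumes F [measurable]: "F \<in> borel_measurable (PiM {..<n} (\<lambda>_. config_space))"
  shows "(\<integral>\<^sup>+N. F N \<partial>observation_law g (\<lambda>t. \<rho> + f t) n) =
    (\<integral>\<^sup>+N. F N * (\<Prod>i<n. mixture (N i)) \<partial>PiM {..<n} (\<lambda>_. base_law))"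
proof -
  let ?G = "PiM {..<n} (\<lambda>_. shift_law)" and ?B = "PiM {..<n} (\<lambda>_. base_law)"
  interpret G: prob_space shift_law by (rule prob_space_shift_law)
  interpret B: prob_space base_law by (rule prob_space_base_law)
  interpret GG: product_prob_space "\<lambda>_::nat. shift_law" "{..<n}" by unfold_locales
  interpret BB: product_prob_space "\<lambda>_::nat. base_law" "{..<n}" by unfold_locales
  interpret PG: prob_space ?G by (rule prob_space_PiM) unfold_locales
  interpret PB: prob_space ?B by (rule prob_space_PiM) unfold_locales
  interpret P: pair_sigma_finite ?G ?B by unfold_locales
  let ?L = "\<lambda>\<tau> N. \<Prod>i<n. ennreal (likelihood \<rho> f (\<tau> i) (N i))"
  define K where "K \<tau> = density ?B (?L \<tau>)" for \<tau>
  have FB[measurable]: "F \<in> borel_measurable ?B"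
    by (subst measurable_cong_sets[OF sets_PiM_cong refl]) auto
  have L[measurable]: "(\<lambda>x. ?L (fst x) (snd x)) \<in> borel_measurable (?G \<Otimes>\<^sub>M ?B)" by measurable
  have L1[measurable]: "?L \<tau> \<in> borel_measurable ?B" for \<tau> by measurable
  have Kprob: "prob_space (K \<tau>)" for \<tau>
  proof (rule prob_spaceI)
    have "emeasure (K \<tau>) (space (K \<tau>)) = (\<integral>\<^sup>+N. ?L \<tau> N \<partial>?B)"
      unfolding K_def by (simp add: emeasure_density cong: nn_integral_cong)
    also have "\<dots> = (\<Prod>i<n. \<integral>\<^sup>+N. ennreal (likelihood \<rho> f (\<tau> i) N) \<partial>base_law)"
      by (intro BB.product_nn_integral_prod) auto
    finally show "emeasure (K \<tau>) (space (K \<tau>)) = 1" by (simp add: likelihood_total)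
  qed
  have sK: "sets (K \<tau>) = sets ?B" for \<tau> by (simp add: K_def)
  have Km: "K \<in> ?G \<rightarrow>\<^sub>M subprob_algebra ?B"
  proof (rule measurable_subprob_algebra)
    fix A assume A[measurable]: "A \<in> sets ?B"
    have "emeasure (K \<tau>) A = (\<integral>\<^sup>+N. ?L \<tau> N * indicator A N \<partial>?B)" for \<tau>
      unfolding K_def by (rule emeasure_density) auto
    then show "(\<lambda>\<tau>. emeasure (K \<tau>) A) \<in> borel_measurable ?G"
      by (simp only:) measurable
  qed (auto simp: sK intro: Kprob prob_space_imp_subprob_space)
  have "observation_law g (\<lambda>t. \<rho> + f t) n = ?G \<bind> K"
    unfolding observation_law_def observation_kernel K_def shift_law_def ..
  then have "(\<integral>\<^sup>+N. F N \<partial>observation_law g (\<lambda>t. \<rho> + f t) n) = (\<integral>\<^sup>+\<tau>. \<integral>\<^sup>+N. F N \<partial>K \<tau> \<partial>?G)"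
    using nn_integral_bind[OF FB Km] by simp
  also have "\<dots> = (\<integral>\<^sup>+\<tau>. \<integral>\<^sup>+N. ?L \<tau> N * F N \<partial>?B \<partial>?G)"
    unfolding K_def by (intro nn_integral_cong nn_integral_density) auto
  also have "\<dots> = (\<integral>\<^sup>+N. \<integral>\<^sup>+\<tau>. ?L \<tau> N * F N \<partial>?G \<partial>?B)"
    by (rule P.Fubini'[symmetric]) measurable
  also have "\<dots> = (\<integral>\<^sup>+N. F N * (\<Prod>i<n. mixture (N i)) \<partial>?B)"
  proof (intro nn_integral_cong)
    fix N assume N: "N \<in> space ?B"
    then have Ni: "N i \<in> space config_space" if "i < n" for i
      using that sets_eq_imp_space_eq[OF sets_base_law] by (auto simp: space_PiM)
    have m: "(\<lambda>t. ennreal (likelihood \<rho> f t (N i))) \<in> borel_measurable shift_law" if "i < n" for i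
      using Ni[OF that] by measurable
    have "(\<integral>\<^sup>+\<tau>. ?L \<tau> N * F N \<partial>?G) = (\<integral>\<^sup>+\<tau>. ?L \<tau> N \<partial>?G) * F N"
      using m by (intro nn_integral_multc borel_measurable_prod_ennreal measurable_compose[OF measurable_component_singleton]) auto
    also have "(\<integral>\<^sup>+\<tau>. ?L \<tau> N \<partial>?G) = (\<Prod>i<n. mixture (N i))"
      unfolding mixture_def using m
      by (intro GG.product_nn_integral_prod[where f="\<lambda>i t. ennreal (likelihood \<rho> f t (N i))"]) auto
    finally show "(\<integral>\<^sup>+\<tau>. ?L \<tau> N * F N \<partial>?G) = F N * (\<Prod>i<n. mixture (N i))" by (simp add: mult.commute)
  qed
  finally show ?thesis .
qed

end

section \<open>The chi-square distance between two mixtures\<close>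

definition shift_corr :: "(real \<Rightarrow> real) \<Rightarrow> (real \<Rightarrow> real) \<Rightarrow> real \<Rightarrow> real \<Rightarrow> real" where
  "shift_corr f h \<tau> \<tau>' = (LBINT t:{0..1}. f (t - \<tau>) * h (t - \<tau>'))"

lemma measurable_size [measurable]: "size \<in> config_space \<rightarrow>\<^sub>M count_space UNIV"
  using measurable_npoints[of UNIV] by (simp add: npoints_def[abs_def])

context shifted_perturbation
begin

lemma mixture_real:
  "mixture N = ennreal (enn2real (mixture N))" "(1 / 2) ^ size N \<le> enn2real (mixture N)"
proof -
  interpret G: prob_space shift_law by (rule prob_space_shift_law)
  have "mixture N \<le> (\<integral>\<^sup>+\<tau>. ennreal ((3 / 2) ^ size N) \<partial>shift_law)"
    unfolding mixture_def by (intro nn_integral_mono ennreal_leI likelihood_bounds)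
  also have "\<dots> = ennreal ((3 / 2) ^ size N)" using G.emeasure_space_1 by simp
  finally have "mixture N < top" by (rule le_less_trans) simp
  then show e: "mixture N = ennreal (enn2real (mixture N))" by simp
  have "(\<integral>\<^sup>+\<tau>. ennreal ((1 / 2) ^ size N) \<partial>shift_law) \<le> mixture N"
    unfolding mixture_def by (intro nn_integral_mono ennreal_leI likelihood_bounds)
  also have "(\<integral>\<^sup>+\<tau>. ennreal ((1 / 2) ^ size N) \<partial>shift_law) = ennreal ((1 / 2) ^ size N)" using G.emeasure_space_1 by simp
  finally show "(1 / 2) ^ size N \<le> enn2real (mixture N)"
    by (subst (asm) e) (simp add: ennreal_le_iff)
qed

lemma mixture_total: "(\<integral>\<^sup>+N. mixture N \<partial>base_law) = 1"
proof -
  interpret G: prob_space shift_law by (rule prob_space_shift_law)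
  interpret B: prob_space base_law by (rule prob_space_base_law)
  interpret P: pair_sigma_finite shift_law base_law by unfold_locales
  have "(\<integral>\<^sup>+N. mixture N \<partial>base_law) = (\<integral>\<^sup>+\<tau>. \<integral>\<^sup>+N. ennreal (likelihood \<rho> f \<tau> N) \<partial>base_law \<partial>shift_law)"
    unfolding mixture_def by (rule P.Fubini') measurable
  then show ?thesis using G.emeasure_space_1 by (simp add: likelihood_total)
qed

end

lemma measurable_shift_corr [measurable]:
  assumes [measurable]: "f \<in> borel_measurable borel" "h \<in> borel_measurable borel"
  shows "(\<lambda>x. shift_corr f h (fst x) (snd x)) \<in> borel_measurable (borel \<Otimes>\<^sub>M borel)"
  unfolding shift_corr_def set_lebesgue_integral_def
  by (rule sigma_finite_measure.borel_measurable_lebesgue_integral[OF lborel.sigma_finite_measure_axioms]) measurable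

lemma shift_corr_le:
  assumes "f \<in> borel_measurable borel" "h \<in> borel_measurable borel" "\<And>t. \<bar>f t\<bar> \<le> s" "\<And>t. \<bar>h t\<bar> \<le> s"
  shows "\<bar>shift_corr f h \<tau> \<tau>'\<bar> \<le> s\<^sup>2"
proof -
  have s0: "0 \<le> s" using assms(3)[of 0] by linarith
  have le: "\<bar>f (t - \<tau>) * h (t - \<tau>')\<bar> \<le> s\<^sup>2" for t
    unfolding abs_mult power2_eq_square using assms s0 by (intro mult_mono) auto
  have i: "set_integrable lborel {0..1} (\<lambda>t. f (t - \<tau>) * h (t - \<tau>'))"
    by (rule set_integrable_bounded[OF _ le]) (use assms in auto)
  have "\<bar>LBINT t. indicator {0..1} t *\<^sub>R (f (t - \<tau>) * h (t - \<tau>'))\<bar> \<le>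
      (LBINT t. \<bar>indicator {0..1} t *\<^sub>R (f (t - \<tau>) * h (t - \<tau>'))\<bar>)"
    by (rule integral_abs_bound)
  also have "\<dots> \<le> (LBINT t. indicator {0..1::real} t *\<^sub>R s\<^sup>2)"
  proof (rule integral_mono)
    show "integrable lborel (\<lambda>t. \<bar>indicator {0..1} t *\<^sub>R (f (t - \<tau>) * h (t - \<tau>'))\<bar>)"
      using i by (intro integrable_abs) (simp add: set_integrable_def)
    show "\<bar>indicator {0..1} t *\<^sub>R (f (t - \<tau>) * h (t - \<tau>'))\<bar> \<le> indicator {0..1} t *\<^sub>R s\<^sup>2" for t
      using le[of t] by (auto simp: indicator_def)
  qed simp
  finally show ?thesis by (simp add: shift_corr_def set_lebesgue_integral_def)
qed

text \<open>The weight \<open>2 ^ size N\<close> compensates the lower bound \<open>(1 / 2) ^ size N\<close> of the likelihoods,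
  and merely turns the unit-mean perturbations into a Poisson process of doubled rate.\<close>

lemma cross_moment:
  assumes F: "shifted_perturbation g \<rho> f" and H: "shifted_perturbation g \<rho> h"
  shows "(\<integral>\<^sup>+N. ennreal (2 ^ size N) * (shifted_perturbation.mixture g \<rho> f N * shifted_perturbation.mixture g \<rho> h N) \<partial>shifted_perturbation.base_law \<rho>) =
    (\<integral>\<^sup>+x. ennreal (exp (\<rho> + 2 / \<rho> * shift_corr f h (fst x) (snd x))) \<partial>(shift_density.shift_law g \<Otimes>\<^sub>M shift_density.shift_law g))"
proof -
  interpret F: shifted_perturbation g \<rho> f by fact
  interpret H: shifted_perturbation g \<rho> h by fact
  interpret G: prob_space F.shift_law by (rule F.prob_space_shift_law)
  interpret B: prob_space F.base_law by (rule F.prob_space_base_law)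
  interpret GG: pair_prob_space F.shift_law F.shift_law by unfold_locales
  interpret P: pair_sigma_finite "F.shift_law \<Otimes>\<^sub>M F.shift_law" F.base_law by unfold_locales
  let ?L = "\<lambda>N x. ennreal (2 ^ size N * (likelihood \<rho> f (fst x) N * likelihood \<rho> h (snd x) N))"
  have p2: "2 ^ size N = (\<Prod>x\<in>#N. 2 :: real)" for N :: "real multiset" by simp
  have sp: "N \<in> space config_space" if "N \<in> space F.base_law" for N
    using that sets_eq_imp_space_eq[OF F.sets_base_law] by simp
  have prod: "ennreal (2 ^ size N) * (F.mixture N * H.mixture N) = (\<integral>\<^sup>+x. ?L N x \<partial>(F.shift_law \<Otimes>\<^sub>M F.shift_law))"
    if N[measurable]: "N \<in> space config_space" for N
  proof -
    have "(\<integral>\<^sup>+x. ?L N x \<partial>(F.shift_law \<Otimes>\<^sub>M F.shift_law)) = (\<integral>\<^sup>+\<tau>. \<integral>\<^sup>+\<tau>'. ?L N (\<tau>, \<tau>') \<partial>F.shift_law \<partial>F.shift_law)"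
      by (rule G.nn_integral_fst[symmetric]) measurable
    also have "\<dots> = (\<integral>\<^sup>+\<tau>. ennreal (2 ^ size N) * ennreal (likelihood \<rho> f \<tau> N) * H.mixture N \<partial>F.shift_law)"
      unfolding H.mixture_def using F.likelihood_nonneg H.likelihood_nonneg
      by (subst nn_integral_cmult[symmetric]) (auto simp: ennreal_mult mult.assoc)
    also have "\<dots> = ennreal (2 ^ size N) * F.mixture N * H.mixture N"
      unfolding F.mixture_def
      by (subst nn_integral_multc, measurable, subst nn_integral_cmult) auto
    finally show ?thesis by (simp add: mult.assoc)
  qed
  have "(\<integral>\<^sup>+N. ennreal (2 ^ size N) * (F.mixture N * H.mixture N) \<partial>F.base_law) =
    (\<integral>\<^sup>+N. \<integral>\<^sup>+x. ?L N x \<partial>(F.shift_law \<Otimes>\<^sub>M F.shift_law) \<partial>F.base_law)"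
    by (intro nn_integral_cong prod sp)
  also have "\<dots> = (\<integral>\<^sup>+x. \<integral>\<^sup>+N. ?L N x \<partial>F.base_law \<partial>(F.shift_law \<Otimes>\<^sub>M F.shift_law))"
    by (rule P.Fubini') measurable
  also have "\<dots> = (\<integral>\<^sup>+x. ennreal (exp (\<rho> + 2 / \<rho> * shift_corr f h (fst x) (snd x))) \<partial>(F.shift_law \<Otimes>\<^sub>M F.shift_law))"
  proof (intro nn_integral_cong)
    fix x :: "real \<times> real"
    obtain \<tau> \<tau>' where x: "x = (\<tau>, \<tau>')" by force
    let ?h = "\<lambda>t. 2 * ((1 + f (t - \<tau>) / \<rho>) * (1 + h (t - \<tau>') / \<rho>))"
    have "(\<integral>\<^sup>+N. ?L N x \<partial>F.base_law) = (\<integral>\<^sup>+N. ennreal (\<Prod>t\<in>#N. ?h t) \<partial>F.base_law)"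
      unfolding x p2 likelihood_def by (simp add: prod_mset.distrib)
    also have "\<dots> = ennreal (exp (LBINT t:{0..1}. (?h t - 1) * \<rho>))"
    proof (rule laplace_integral[OF F.base_laplace])
      show "0 \<le> ?h t" for t using F.factor_nonneg H.factor_nonneg by simp
      have "(1 + f (t - \<tau>) / \<rho>) * (1 + h (t - \<tau>') / \<rho>) \<le> 3 / 2 * (3 / 2)" for t
        using F.factor_bounds(2) H.factor_bounds(2) F.factor_nonneg H.factor_nonneg by (intro mult_mono) auto
      then show "?h t \<le> 2 * (3 / 2 * (3 / 2))" for t by (intro mult_left_mono) auto
    qed simp
    also have "(LBINT t:{0..1}. (?h t - 1) * \<rho>) = (LBINT t:{0..1}. \<rho> + 2 * f (t - \<tau>) + 2 * h (t - \<tau>') + 2 / \<rho> * (f (t - \<tau>) * h (t - \<tau>')))"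
      using F.rho by (intro arg_cong[where f="set_lebesgue_integral lborel {0..1}"] ext) (simp add: field_simps)
    \<comment> \<open>Both linear terms integrate to zero, so that only the correlation remains; the
      summand \<open>\<rho>\<close> stems from the weight.\<close>
    also have "\<dots> = \<rho> + 2 / \<rho> * shift_corr f h \<tau> \<tau>'"
    proof -
      have i: "set_integrable lborel {0..1} (\<lambda>t. f (t - \<tau>))" "set_integrable lborel {0..1} (\<lambda>t. h (t - \<tau>'))"
        using F.small H.small by (auto intro!: set_integrable_bounded[where c="\<rho> / 2"])
      have "\<bar>f (t - \<tau>) * h (t - \<tau>')\<bar> \<le> \<rho> / 2 * (\<rho> / 2)" for t
        unfolding abs_mult using F.small H.small F.rho by (intro mult_mono) auto
      then have i2: "set_integrable lborel {0..1} (\<lambda>t. f (t - \<tau>) * h (t - \<tau>'))"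
        by (intro set_integrable_bounded[where c="\<rho> / 2 * (\<rho> / 2)"]) auto
      have i0: "set_integrable lborel {0..1} (\<lambda>t::real. \<rho>)" by (simp add: set_integrable_def)
      have "(LBINT t:{0..1::real}. \<rho>) = \<rho>" by (simp add: set_lebesgue_integral_def)
      then show ?thesis using i i2 i0 F.mean_zero[of \<tau>] H.mean_zero[of \<tau>']
        by (simp add: set_integral_add shift_corr_def)
    qed
    finally show "(\<integral>\<^sup>+N. ?L N x \<partial>F.base_law) = ennreal (exp (\<rho> + 2 / \<rho> * shift_corr f h (fst x) (snd x)))"
      by (simp add: x)
  qed
  finally show ?thesis .
qed

lemma exp_quadratic_bound:
  fixes x :: real
  assumes "\<bar>x\<bar> \<le> 1"
  shows "\<bar>exp x - 1 - x\<bar> \<le> 2 * x\<^sup>2"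
proof -
  obtain t where t: "\<bar>t\<bar> \<le> \<bar>x\<bar>" "exp x = (\<Sum>m<2. x ^ m / fact m) + exp t / fact 2 * x ^ 2"
    using Maclaurin_exp_le[of x 2] by auto
  then have eq: "exp x - 1 - x = exp t / 2 * x\<^sup>2" by (simp add: numeral_2_eq_2)
  have "exp t \<le> exp 1" using t(1) assms by simp
  also have "exp (1 :: real) \<le> 3" by (rule exp_le)
  finally have "exp t / 2 * x\<^sup>2 \<le> 2 * x\<^sup>2" by (intro mult_right_mono) auto
  then show ?thesis unfolding eq by (simp add: abs_mult)
qed

context shifted_perturbation
begin

lemma mixture_product_total:
  fixes n :: nat
  shows "(\<integral>\<^sup>+N. (\<Prod>i<n. mixture (N i)) \<partial>PiM {..<n} (\<lambda>_. base_law)) = 1"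
proof -
  interpret B: prob_space base_law by (rule prob_space_base_law)
  interpret BB: product_sigma_finite "\<lambda>_::nat. base_law" by unfold_locales
  have "(\<integral>\<^sup>+N. (\<Prod>i<n. mixture (N i)) \<partial>PiM {..<n} (\<lambda>_. base_law)) = (\<Prod>i<n. \<integral>\<^sup>+N. mixture N \<partial>base_law)"
    by (rule BB.product_nn_integral_prod[where f="\<lambda>_. mixture"]) auto
  then show ?thesis by (simp add: mixture_total)
qed

end

lemma ennreal_add_cancel_right: "a + ennreal r \<le> b + ennreal r \<Longrightarrow> a \<le> (b :: ennreal)"
  by (simp add: ennreal_add_left_cancel_le add.commute[of _ "ennreal r"])

text \<open>Expanding the square gives four exponentials of correlations. Their linear parts combine
  by bilinearity into the correlation of \<open>f - h\<close>, bounded through \<open>V\<close>;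
  with \<open>\<eta> = 2 / \<rho> * s\<^sup>2\<close> each of the four remainders is at most
  \<open>2 * \<eta>\<^sup>2\<close>, which explains the factor \<open>8\<close>.\<close>

lemma chi_square_bound:
  assumes F: "shifted_perturbation g \<rho> f" and H: "shifted_perturbation g \<rho> h"
    and s: "\<And>t. \<bar>f t\<bar> \<le> s" "\<And>t. \<bar>h t\<bar> \<le> s" "2 / \<rho> * s\<^sup>2 \<le> 1"
    and V: "(\<integral>x. shift_corr (\<lambda>t. f t - h t) (\<lambda>t. f t - h t) (fst x) (snd x)
        \<partial>(shift_density.shift_law g \<Otimes>\<^sub>M shift_density.shift_law g)) \<le> V"
    and V0: "0 \<le> V"
  defines "\<delta> \<equiv> exp \<rho> * (2 / \<rho> * V + 8 * (2 / \<rho> * s\<^sup>2)\<^sup>2)"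
  shows "(\<integral>\<^sup>+N. ennreal (2 ^ size N * (enn2real (shifted_perturbation.mixture g \<rho> f N) -
      enn2real (shifted_perturbation.mixture g \<rho> h N))\<^sup>2) \<partial>shifted_perturbation.base_law \<rho>) \<le> ennreal \<delta>"
proof -
  interpret F: shifted_perturbation g \<rho> f by fact
  interpret H: shifted_perturbation g \<rho> h by fact
  interpret G: prob_space F.shift_law by (rule F.prob_space_shift_law)
  interpret B: prob_space F.base_law by (rule F.prob_space_base_law)
  interpret GG: pair_prob_space F.shift_law F.shift_law by unfold_locales
  let ?P = "F.shift_law \<Otimes>\<^sub>M F.shift_law"
  define \<eta> where "\<eta> = 2 / \<rho> * s\<^sup>2"
  have eta0: "0 \<le> \<eta>" unfolding \<eta>_def using F.rho by simp
  define X where "X a b x = 2 / \<rho> * shift_corr a b (fst x) (snd x)" for a b :: "real \<Rightarrow> real" and x :: "real \<times> real"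
  have Xm[measurable]: "X a b \<in> borel_measurable ?P" if [measurable]: "a \<in> borel_measurable borel" "b \<in> borel_measurable borel" for a b
    unfolding X_def[abs_def] by measurable
  have Xb: "\<bar>X a b x\<bar> \<le> \<eta>" if "a \<in> {f, h}" "b \<in> {f, h}" for a b x
  proof -
    have "\<bar>shift_corr a b (fst x) (snd x)\<bar> \<le> s\<^sup>2" using that s(1,2) by (intro shift_corr_le) auto
    then have "2 / \<rho> * \<bar>shift_corr a b (fst x) (snd x)\<bar> \<le> \<eta>" unfolding \<eta>_def using F.rho by (intro mult_left_mono) auto
    then show ?thesis unfolding X_def abs_mult using F.rho by simp
  qed
  have ab: "a \<in> borel_measurable borel" if "a \<in> {f, h}" for a using that by auto
  have int_bdd: "integrable ?P u" if "u \<in> borel_measurable ?P" "\<And>x. \<bar>u x\<bar> \<le> c" for u :: "real \<times> real \<Rightarrow> real" and c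
    by (rule GG.integrable_const_bound[where B=c]) (use that in auto)
  have Xi: "integrable ?P (X a b)" if "a \<in> {f, h}" "b \<in> {f, h}" for a b
    by (rule int_bdd[OF Xm[OF ab[OF that(1)] ab[OF that(2)]] Xb[OF that]])
  have Ei: "integrable ?P (\<lambda>x. exp (\<rho> + X a b x))" if "a \<in> {f, h}" "b \<in> {f, h}" for a b
  proof (rule int_bdd)
    have [measurable]: "X a b \<in> borel_measurable ?P" using Xm[OF ab[OF that(1)] ab[OF that(2)]] .
    show "(\<lambda>x. exp (\<rho> + X a b x)) \<in> borel_measurable ?P" by measurable
    show "\<bar>exp (\<rho> + X a b x)\<bar> \<le> exp (\<rho> + \<eta>)" for x using Xb[OF that, of x] by simp
  qed
  define J where "J a b = (\<integral>x. exp (\<rho> + X a b x) \<partial>?P)" for a b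
  have J0: "0 \<le> J a b" for a b unfolding J_def by simp
  let ?mf = "F.mixture" and ?mh = "H.mixture"
  have JE: "(\<integral>\<^sup>+x. ennreal (exp (\<rho> + 2 / \<rho> * shift_corr a b (fst x) (snd x))) \<partial>?P) = ennreal (J a b)"
    if "a \<in> {f, h}" "b \<in> {f, h}" for a b
    unfolding J_def using Ei[OF that] by (subst nn_integral_eq_integral[symmetric]) (auto simp: X_def)
  have M: "(\<integral>\<^sup>+N. ennreal (2 ^ size N) * (?mf N * ?mf N) \<partial>F.base_law) = ennreal (J f f)"
    "(\<integral>\<^sup>+N. ennreal (2 ^ size N) * (?mf N * ?mh N) \<partial>F.base_law) = ennreal (J f h)"
    "(\<integral>\<^sup>+N. ennreal (2 ^ size N) * (?mh N * ?mf N) \<partial>F.base_law) = ennreal (J h f)"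
    "(\<integral>\<^sup>+N. ennreal (2 ^ size N) * (?mh N * ?mh N) \<partial>F.base_law) = ennreal (J h h)"
    using cross_moment[OF F F] cross_moment[OF F H] cross_moment[OF H F] cross_moment[OF H H] JE by simp_all
  have lin: "J f f - J f h - J h f + J h h \<le> \<delta>"
  proof -
    have pt: "exp (\<rho> + X f f x) - exp (\<rho> + X f h x) - exp (\<rho> + X h f x) + exp (\<rho> + X h h x) \<le>
      exp \<rho> * ((X f f x - X f h x - X h f x + X h h x) + 8 * \<eta>\<^sup>2)" for x
    proof -
      have R: "\<bar>exp (X a b x) - 1 - X a b x\<bar> \<le> 2 * \<eta>\<^sup>2" if "a \<in> {f, h}" "b \<in> {f, h}" for a b
      proof -
        have "\<bar>exp (X a b x) - 1 - X a b x\<bar> \<le> 2 * (X a b x)\<^sup>2"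
          using Xb[OF that, of x] s(3) unfolding \<eta>_def by (intro exp_quadratic_bound) linarith
        also have "(X a b x)\<^sup>2 \<le> \<eta>\<^sup>2" using Xb[OF that, of x] eta0 by (simp add: abs_le_square_iff[symmetric])
        finally show ?thesis by simp
      qed
      have "exp (X f f x) - exp (X f h x) - exp (X h f x) + exp (X h h x) \<le> (X f f x - X f h x - X h f x + X h h x) + 8 * \<eta>\<^sup>2"
        using R[of f f] R[of f h] R[of h f] R[of h h] by (simp add: abs_le_iff)
      then have "exp \<rho> * (exp (X f f x) - exp (X f h x) - exp (X h f x) + exp (X h h x)) \<le> exp \<rho> * ((X f f x - X f h x - X h f x + X h h x) + 8 * \<eta>\<^sup>2)"
        by (intro mult_left_mono) auto
      then show ?thesis by (simp add: exp_add algebra_simps)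
    qed
    have comb: "X f f x - X f h x - X h f x + X h h x = 2 / \<rho> * shift_corr (\<lambda>t. f t - h t) (\<lambda>t. f t - h t) (fst x) (snd x)" for x
    proof -
      have bd: "\<bar>a (t - u) * b (t - v)\<bar> \<le> \<rho> / 2 * (\<rho> / 2)" if "a \<in> {f, h}" "b \<in> {f, h}" for a b t u v
        unfolding abs_mult using that F.small H.small F.rho by (intro mult_mono) auto
      have i: "set_integrable lborel {0..1} (\<lambda>t. a (t - fst x) * b (t - snd x))" if "a \<in> {f, h}" "b \<in> {f, h}" for a b
        using that by (intro set_integrable_bounded[OF _ bd[OF that]]) auto
      have "shift_corr (\<lambda>t. f t - h t) (\<lambda>t. f t - h t) (fst x) (snd x) =
        (LBINT t:{0..1}. f (t - fst x) * f (t - snd x) - f (t - fst x) * h (t - snd x) - h (t - fst x) * f (t - snd x) + h (t - fst x) * h (t - snd x))"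
        unfolding shift_corr_def by (intro arg_cong[where f="set_lebesgue_integral lborel {0..1}"] ext) (simp add: algebra_simps)
      also have "\<dots> = shift_corr f f (fst x) (snd x) - shift_corr f h (fst x) (snd x) - shift_corr h f (fst x) (snd x) + shift_corr h h (fst x) (snd x)"
        unfolding shift_corr_def using i by (simp add: set_integral_add set_integral_diff)
      finally have S: "shift_corr (\<lambda>t. f t - h t) (\<lambda>t. f t - h t) (fst x) (snd x) = \<dots>" .
      show ?thesis unfolding X_def S by (simp only: distrib_left right_diff_distrib)
    qed
    have "J f f - J f h - J h f + J h h = (\<integral>x. exp (\<rho> + X f f x) - exp (\<rho> + X f h x) - exp (\<rho> + X h f x) + exp (\<rho> + X h h x) \<partial>?P)"
      unfolding J_def using Ei by simp
    also have "\<dots> \<le> (\<integral>x. exp \<rho> * ((X f f x - X f h x - X h f x + X h h x) + 8 * \<eta>\<^sup>2) \<partial>?P)"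
      using Ei Xi by (intro integral_mono pt) auto
    also have "\<dots> = exp \<rho> * ((\<integral>x. X f f x - X f h x - X h f x + X h h x \<partial>?P) + 8 * \<eta>\<^sup>2)"
      using Xi GG.prob_space by (subst integral_mult_right_zero, subst Bochner_Integration.integral_add) auto
    also have "(\<integral>x. X f f x - X f h x - X h f x + X h h x \<partial>?P) \<le> 2 / \<rho> * V"
      unfolding comb integral_mult_right_zero using V F.rho by (intro mult_left_mono) auto
    finally show ?thesis unfolding \<delta>_def \<eta>_def by simp
  qed
  \<comment> \<open>The expansion is written without subtraction, which is truncated on extended
    nonnegative reals; the mixed terms are cancelled at the very end.\<close>
  have sq: "ennreal (2 ^ size N * (enn2real (?mf N) - enn2real (?mh N))\<^sup>2) + (ennreal (2 ^ size N) * (?mf N * ?mh N) + ennreal (2 ^ size N) * (?mh N * ?mf N)) =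
      ennreal (2 ^ size N) * (?mf N * ?mf N) + ennreal (2 ^ size N) * (?mh N * ?mh N)" for N
  proof -
    define a where "a = enn2real (?mf N)"
    define b where "b = enn2real (?mh N)"
    have ab: "?mf N = ennreal a" "?mh N = ennreal b" "0 \<le> a" "0 \<le> b"
      using F.mixture_real(1)[of N] H.mixture_real(1)[of N] by (auto simp: a_def b_def)
    show ?thesis unfolding ab using ab(3,4)
      by (simp add: ennreal_mult'[symmetric] ennreal_plus[symmetric] del: ennreal_plus)
         (simp add: power2_eq_square algebra_simps)
  qed
  let ?I = "\<integral>\<^sup>+N. ennreal (2 ^ size N * (enn2real (?mf N) - enn2real (?mh N))\<^sup>2) \<partial>F.base_law"
  have m: "(\<lambda>N. ennreal (2 ^ size N * (enn2real (?mf N) - enn2real (?mh N))\<^sup>2)) \<in> borel_measurable F.base_law"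
    "(\<lambda>N. ennreal (2 ^ size N) * (?mf N * ?mh N)) \<in> borel_measurable F.base_law"
    "(\<lambda>N. ennreal (2 ^ size N) * (?mh N * ?mf N)) \<in> borel_measurable F.base_law"
    "(\<lambda>N. ennreal (2 ^ size N) * (?mf N * ?mf N)) \<in> borel_measurable F.base_law"
    "(\<lambda>N. ennreal (2 ^ size N) * (?mh N * ?mh N)) \<in> borel_measurable F.base_law"
    by measurable
  have "?I + ennreal (J f h + J h f) = ?I + (ennreal (J f h) + ennreal (J h f))" using J0 by simp
  also have "\<dots> = (\<integral>\<^sup>+N. ennreal (2 ^ size N * (enn2real (?mf N) - enn2real (?mh N))\<^sup>2) + (ennreal (2 ^ size N) * (?mf N * ?mh N) + ennreal (2 ^ size N) * (?mh N * ?mf N)) \<partial>F.base_law)"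
    unfolding M[symmetric] by (simp only: nn_integral_add[OF m(1) borel_measurable_add[OF m(2,3)]] nn_integral_add[OF m(2,3)])
  also have "\<dots> = ennreal (J f f) + ennreal (J h h)"
    unfolding sq M[symmetric] by (rule nn_integral_add[OF m(4,5)])
  also have "\<dots> = ennreal (J f f + J h h)" using J0 by simp
  also have "\<dots> \<le> ennreal (\<delta> + (J f h + J h f))" using lin by (intro ennreal_leI) simp
  also have "\<dots> = ennreal \<delta> + ennreal (J f h + J h f)"
    using J0 V0 F.rho by (intro ennreal_plus) (auto simp: \<delta>_def)
  finally show ?thesis by (rule ennreal_add_cancel_right)
qed

text \<open>Both densities have total mass \<open>1\<close>, so the integral of
  \<open>a\<^sup>2 / b\<close> exceeds \<open>1\<close> by that of
  \<open>(a - b)\<^sup>2 / b\<close>, and \<open>1 / b \<le> 2 ^ size N\<close> reduces this to the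
  hypothesis. Unlike the affinity, this integral is multiplicative over independent observations;
  \<open>min_ge_quadratic\<close> then returns to the minimum.\<close>

lemma affinity_bound:
  fixes n :: nat
  assumes F: "shifted_perturbation g \<rho> f" and H: "shifted_perturbation g \<rho> h"
    and chi: "(\<integral>\<^sup>+N. ennreal (2 ^ size N * (enn2real (shifted_perturbation.mixture g \<rho> f N) -
      enn2real (shifted_perturbation.mixture g \<rho> h N))\<^sup>2) \<partial>shifted_perturbation.base_law \<rho>) \<le> ennreal \<delta>"
    and d0: "0 \<le> \<delta>"
  shows "ennreal (1 - (1 + \<delta>) ^ n / 4) \<le>
    (\<integral>\<^sup>+N. min (\<Prod>i<n. shifted_perturbation.mixture g \<rho> f (N i)) (\<Prod>i<n. shifted_perturbation.mixture g \<rho> h (N i))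
      \<partial>PiM {..<n} (\<lambda>_. shifted_perturbation.base_law \<rho>))"
proof -
  interpret F: shifted_perturbation g \<rho> f by fact
  interpret H: shifted_perturbation g \<rho> h by fact
  interpret B: prob_space F.base_law by (rule F.prob_space_base_law)
  interpret BB: product_sigma_finite "\<lambda>_::nat. F.base_law" by unfold_locales
  let ?BB = "PiM {..<n} (\<lambda>_. F.base_law)"
  define a where "a N = enn2real (F.mixture N)" for N
  define b where "b N = enn2real (H.mixture N)" for N
  have [measurable]: "a \<in> borel_measurable config_space" "b \<in> borel_measurable config_space"
    unfolding a_def[abs_def] b_def[abs_def] by measurable
  have pos: "0 < (1 / 2 :: real) ^ size N" for N :: "real multiset" by simp
  have a: "F.mixture N = ennreal (a N)" "0 < a N" for N
    unfolding a_def by (rule F.mixture_real(1), rule less_le_trans[OF pos F.mixture_real(2)])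
  have b: "H.mixture N = ennreal (b N)" "0 < b N" "(1 / 2) ^ size N \<le> b N" for N
    unfolding b_def by (rule H.mixture_real(1), rule less_le_trans[OF pos H.mixture_real(2)], rule H.mixture_real(2))
  have chi': "(\<integral>\<^sup>+N. ennreal (2 ^ size N * (a N - b N)\<^sup>2) \<partial>F.base_law) \<le> ennreal \<delta>"
    using chi unfolding a_def b_def .
  have ta: "(\<integral>\<^sup>+N. ennreal (a N) \<partial>F.base_law) = 1" using F.mixture_total unfolding a(1) .
  have tb: "(\<integral>\<^sup>+N. ennreal (b N) \<partial>F.base_law) = 1" using H.mixture_total unfolding b(1) .
  \<comment> \<open>The identity \<open>a\<^sup>2 / b + b = 2 * a + (a - b)\<^sup>2 / b\<close>,
    again arranged to avoid subtraction of integrals.\<close>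
  have pt: "ennreal ((a N)\<^sup>2 / b N) + ennreal (b N) \<le> (ennreal (a N) + ennreal (a N)) + ennreal (2 ^ size N * (a N - b N)\<^sup>2)" for N
  proof -
    have "1 / b N \<le> 1 / (1 / 2) ^ size N" using b(2,3)[of N] by (intro divide_left_mono) auto
    then have "1 / b N \<le> 2 ^ size N" by (simp add: power_one_over)
    then have "1 / b N * (a N - b N)\<^sup>2 \<le> 2 ^ size N * (a N - b N)\<^sup>2" by (intro mult_right_mono) auto
    moreover have "(a N)\<^sup>2 / b N + b N = a N + a N + 1 / b N * (a N - b N)\<^sup>2"
      using b(2)[of N] by (simp add: power2_eq_square field_simps)
    ultimately have "(a N)\<^sup>2 / b N + b N \<le> a N + a N + 2 ^ size N * (a N - b N)\<^sup>2" by linarith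
    then have "ennreal ((a N)\<^sup>2 / b N + b N) \<le> ennreal (a N + a N + 2 ^ size N * (a N - b N)\<^sup>2)" by (rule ennreal_leI)
    also have "\<dots> = ennreal (a N) + ennreal (a N) + ennreal (2 ^ size N * (a N - b N)\<^sup>2)"
      using less_imp_le[OF a(2)[of N]] by (subst ennreal_plus, simp, simp, subst ennreal_plus, auto)
    finally show ?thesis using a(2)[of N] b(2)[of N] by (simp add: less_imp_le)
  qed
  have single: "(\<integral>\<^sup>+N. ennreal ((a N)\<^sup>2 / b N) \<partial>F.base_law) \<le> ennreal (1 + \<delta>)" (is "?X \<le> _")
  proof -
    have "?X + 1 = (\<integral>\<^sup>+N. ennreal ((a N)\<^sup>2 / b N) + ennreal (b N) \<partial>F.base_law)"
      unfolding tb[symmetric] by (rule nn_integral_add[symmetric]) auto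
    also have "\<dots> \<le> (\<integral>\<^sup>+N. (ennreal (a N) + ennreal (a N)) + ennreal (2 ^ size N * (a N - b N)\<^sup>2) \<partial>F.base_law)"
      by (intro nn_integral_mono pt)
    also have "\<dots> = (\<integral>\<^sup>+N. ennreal (a N) + ennreal (a N) \<partial>F.base_law) + (\<integral>\<^sup>+N. ennreal (2 ^ size N * (a N - b N)\<^sup>2) \<partial>F.base_law)"
      by (rule nn_integral_add) measurable
    also have "(\<integral>\<^sup>+N. ennreal (a N) + ennreal (a N) \<partial>F.base_law) = 1 + 1"
      by (subst nn_integral_add) (auto simp: ta)
    also have "(1 + 1) + (\<integral>\<^sup>+N. ennreal (2 ^ size N * (a N - b N)\<^sup>2) \<partial>F.base_law) \<le> (1 + 1) + ennreal \<delta>"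
      by (intro add_left_mono chi')
    also have "(1 + 1) + ennreal \<delta> = ennreal (1 + \<delta>) + 1" using d0 by (simp add: ac_simps)
    finally have le: "?X + 1 \<le> ennreal (1 + \<delta>) + 1" .
    show ?thesis by (rule ennreal_add_cancel_right[where r=1]) (use le in simp)
  qed
  define P where "P N = (\<Prod>i<n. a (N i))" for N :: "nat \<Rightarrow> real multiset"
  define Q where "Q N = (\<Prod>i<n. b (N i))" for N :: "nat \<Rightarrow> real multiset"
  have [measurable]: "P \<in> borel_measurable ?BB" "Q \<in> borel_measurable ?BB"
    unfolding P_def[abs_def] Q_def[abs_def] by measurable
  have PQ: "0 < P N" "0 < Q N" for N unfolding P_def Q_def using a(2) b(2) by (auto intro: prod_pos)
  have eP: "(\<Prod>i<n. F.mixture (N i)) = ennreal (P N)" for N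
    unfolding a(1) P_def using a(2) by (intro prod_ennreal less_imp_le)
  have eQ: "(\<Prod>i<n. H.mixture (N i)) = ennreal (Q N)" for N
    unfolding b(1) Q_def using b(2) by (intro prod_ennreal less_imp_le)
  have "(1 :: ennreal) = (\<integral>\<^sup>+N. ennreal (P N) \<partial>?BB)"
    using F.mixture_product_total[of n] unfolding eP by simp
  also have "\<dots> \<le> (\<integral>\<^sup>+N. min (ennreal (P N)) (ennreal (Q N)) + ennreal (1 / 4) * ennreal ((P N)\<^sup>2 / Q N) \<partial>?BB)"
  proof (intro nn_integral_mono)
    fix N
    have "P N \<le> min (P N) (Q N) + 1 / 4 * ((P N)\<^sup>2 / Q N)"
      using min_ge_quadratic[of "P N" "Q N"] PQ[of N] by (simp only: times_divide_times_eq mult_1 less_imp_le diff_le_eq)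
    then have "ennreal (P N) \<le> ennreal (min (P N) (Q N) + 1 / 4 * ((P N)\<^sup>2 / Q N))" by (rule ennreal_leI)
    also have "\<dots> = min (ennreal (P N)) (ennreal (Q N)) + ennreal (1 / 4) * ennreal ((P N)\<^sup>2 / Q N)"
      using PQ[of N] by (simp add: ennreal_mult'[symmetric] min_ennreal less_imp_le)
    finally show "ennreal (P N) \<le> min (ennreal (P N)) (ennreal (Q N)) + ennreal (1 / 4) * ennreal ((P N)\<^sup>2 / Q N)" .
  qed
  also have "\<dots> = (\<integral>\<^sup>+N. min (ennreal (P N)) (ennreal (Q N)) \<partial>?BB) + ennreal (1 / 4) * (\<integral>\<^sup>+N. ennreal ((P N)\<^sup>2 / Q N) \<partial>?BB)"
    by (subst nn_integral_add, measurable, subst nn_integral_cmult) auto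
  also have "(\<integral>\<^sup>+N. ennreal ((P N)\<^sup>2 / Q N) \<partial>?BB) = (\<integral>\<^sup>+N. (\<Prod>i<n. ennreal ((a (N i))\<^sup>2 / b (N i))) \<partial>?BB)"
    using b(2) by (intro nn_integral_cong) (simp add: prod_ennreal less_imp_le P_def Q_def prod_dividef prod_power_distrib)
  also have "\<dots> = (\<Prod>i<n. ?X)"
    by (rule BB.product_nn_integral_prod[where f="\<lambda>_ N. ennreal ((a N)\<^sup>2 / b N)"]) auto
  also have "\<dots> \<le> ennreal ((1 + \<delta>) ^ n)"
    using power_mono[OF single, of n] d0 by (simp add: ennreal_power del: ennreal_plus)
  finally have "1 \<le> (\<integral>\<^sup>+N. min (ennreal (P N)) (ennreal (Q N)) \<partial>?BB) + ennreal (1 / 4) * ennreal ((1 + \<delta>) ^ n)"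
    by (simp add: add_left_mono mult_left_mono)
  then have *: "1 \<le> (\<integral>\<^sup>+N. min (ennreal (P N)) (ennreal (Q N)) \<partial>?BB) + ennreal ((1 + \<delta>) ^ n / 4)"
    using d0 by (simp add: ennreal_mult'[symmetric])
  show ?thesis unfolding eP eQ
  proof (cases "\<integral>\<^sup>+N. min (ennreal (P N)) (ennreal (Q N)) \<partial>?BB" rule: ennreal_cases)
    case (real r)
    have "ennreal 1 \<le> ennreal (r + (1 + \<delta>) ^ n / 4)" using * real d0 by simp
    then have "1 - (1 + \<delta>) ^ n / 4 \<le> r" using real d0 by (subst (asm) ennreal_le_iff) auto
    then show "ennreal (1 - (1 + \<delta>) ^ n / 4) \<le> (\<integral>\<^sup>+N. min (ennreal (P N)) (ennreal (Q N)) \<partial>?BB)"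
      unfolding real by (rule ennreal_leI)
  qed simp
qed

section \<open>Averaging over the shifts\<close>

context shift_density
begin

lemma integral_shift_law:
  fixes u :: "real \<Rightarrow> real"
  assumes "u \<in> borel_measurable borel"
  shows "(\<integral>t. u t \<partial>shift_law) = (\<integral>t. g t * u t \<partial>lborel)"
  unfolding shift_law_def using assms g_nonneg by (subst integral_density) auto

text \<open>For two independent shifts with the same law the exponential of the difference factors
  into a characteristic function and its conjugate.\<close>

lemma integral_cos_difference:
  "(\<integral>x. cos (2 * pi * of_int l * (fst x - snd x)) \<partial>(shift_law \<Otimes>\<^sub>M shift_law)) = (cmod (gamma_coeff g l))\<^sup>2"
proof -
  interpret G: prob_space shift_law by (rule prob_space_shift_law)
  interpret GG: pair_prob_space shift_law shift_law by unfold_locales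
  let ?c = "\<lambda>t. cos (2 * pi * of_int l * t)" and ?s = "\<lambda>t. sin (2 * pi * of_int l * t)"
  have prod: "(\<integral>x. u (fst x) * u (snd x) \<partial>(shift_law \<Otimes>\<^sub>M shift_law)) = (\<integral>t. u t \<partial>shift_law)\<^sup>2"
    and int: "integrable (shift_law \<Otimes>\<^sub>M shift_law) (\<lambda>x. u (fst x) * u (snd x))"
    if [measurable]: "u \<in> borel_measurable borel" and u: "\<And>t. \<bar>u t\<bar> \<le> 1" for u :: "real \<Rightarrow> real"
  proof -
    show i: "integrable (shift_law \<Otimes>\<^sub>M shift_law) (\<lambda>x. u (fst x) * u (snd x))"
    proof (rule GG.integrable_const_bound[where B=1])
      show "AE x in shift_law \<Otimes>\<^sub>M shift_law. norm (u (fst x) * u (snd x)) \<le> 1"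
        using u by (intro AE_I2) (simp add: abs_mult mult_le_one)
    qed measurable
    have "(\<integral>x. u (fst x) * u (snd x) \<partial>(shift_law \<Otimes>\<^sub>M shift_law)) = (\<integral>s. \<integral>t. u s * u t \<partial>shift_law \<partial>shift_law)"
      using GG.integral_fst'[OF i] by simp
    then show "(\<integral>x. u (fst x) * u (snd x) \<partial>(shift_law \<Otimes>\<^sub>M shift_law)) = (\<integral>t. u t \<partial>shift_law)\<^sup>2"
      by (simp add: power2_eq_square)
  qed
  have gi: "integrable lborel g"
    using g_total g_nonneg by (intro integrableI_nonneg) auto
  have e: "iexp (2 * pi * of_int l * t) = cis (2 * pi * of_int l * t)" for t by (simp add: cis_conv_exp)
  have ci: "integrable lborel (\<lambda>t. complex_of_real (g t) * cis (2 * pi * of_int l * t))"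
    unfolding e[symmetric]
    using gi by (rule Bochner_Integration.integrable_bound[OF _ _ AE_I2]) (auto simp: norm_mult)
  have gc: "gamma_coeff g l = (LINT t|lborel. complex_of_real (g t) * cis (2 * pi * of_int l * t))"
    unfolding gamma_coeff_def e ..
  have "Re (gamma_coeff g l) = (\<integral>t. ?c t \<partial>shift_law)"
    unfolding gc integral_Re[OF ci, symmetric] by (simp add: integral_shift_law)
  moreover have "Im (gamma_coeff g l) = (\<integral>t. ?s t \<partial>shift_law)"
    unfolding gc integral_Im[OF ci, symmetric] by (simp add: integral_shift_law)
  moreover have "(\<integral>x. cos (2 * pi * of_int l * (fst x - snd x)) \<partial>(shift_law \<Otimes>\<^sub>M shift_law)) =
    (\<integral>x. ?c (fst x) * ?c (snd x) + ?s (fst x) * ?s (snd x) \<partial>(shift_law \<Otimes>\<^sub>M shift_law))"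
    by (intro Bochner_Integration.integral_cong refl) (simp add: right_diff_distrib cos_diff)
  ultimately show ?thesis
    using int[of ?c] int[of ?s] prod[of ?c] prod[of ?s]
    by (simp add: cmod_power2)
qed

text \<open>The correlation has fewer than \<open>2 * M\<close> frequencies, all above
  \<open>M\<close>; each squared coefficient is at most \<open>1\<close> and is multiplied by at
  most \<open>C\<^sup>2 * M powr (- 2 * \<nu>)\<close>. The factor \<open>1 / 2\<close> from
  orthogonality turns the count \<open>2 * M\<close> into \<open>M\<close>.\<close>

lemma carrier_fejer_smoothing:
  assumes M: "0 < M" and nu: "0 \<le> \<nu>" and C: "0 \<le> C"
    and gam: "\<And>l::int. l \<noteq> 0 \<Longrightarrow> cmod (gamma_coeff g l) \<le> C * \<bar>real_of_int l\<bar> powr (- \<nu>)"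
  shows "(\<integral>x. shift_corr (\<lambda>t. e * carrier_fejer M (t - a)) (\<lambda>t. e * carrier_fejer M (t - a)) (fst x) (snd x)
      \<partial>(shift_law \<Otimes>\<^sub>M shift_law)) \<le> e\<^sup>2 * C\<^sup>2 * real M powr (1 - 2 * \<nu>)"
proof -
  interpret G: prob_space shift_law by (rule prob_space_shift_law)
  interpret GG: pair_prob_space shift_law shift_law by unfold_locales
  let ?L = "{int M<..<3 * int M}"
  let ?P = "shift_law \<Otimes>\<^sub>M shift_law"
  have sc: "shift_corr (\<lambda>t. e * carrier_fejer M (t - a)) (\<lambda>t. e * carrier_fejer M (t - a)) \<tau> \<tau>' =
    e\<^sup>2 / 2 * (\<Sum>l\<in>?L. (triangle_coeff M l)\<^sup>2 * cos (2 * pi * of_int l * (\<tau> - \<tau>')))" for \<tau> \<tau>'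
  proof -
    have "shift_corr (\<lambda>t. e * carrier_fejer M (t - a)) (\<lambda>t. e * carrier_fejer M (t - a)) \<tau> \<tau>' =
      (LBINT t:{0..1}. e\<^sup>2 * (carrier_fejer M (t - (a + \<tau>)) * carrier_fejer M (t - (a + \<tau>'))))"
      unfolding shift_corr_def
      by (intro arg_cong[where f="set_lebesgue_integral lborel {0..1}"] ext) (simp add: power2_eq_square diff_diff_eq2 diff_diff_eq add.commute ac_simps)
    also have "\<dots> = e\<^sup>2 / 2 * (\<Sum>l\<in>?L. (triangle_coeff M l)\<^sup>2 * cos (2 * pi * of_int l * (\<tau> - \<tau>')))"
      by (simp add: carrier_fejer_inner)
    finally show ?thesis .
  qed
  have int: "integrable ?P (\<lambda>x. cos (2 * pi * of_int l * (fst x - snd x)))" for l :: int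
    by (rule GG.integrable_const_bound[where B=1]) auto
  have "(\<integral>x. shift_corr (\<lambda>t. e * carrier_fejer M (t - a)) (\<lambda>t. e * carrier_fejer M (t - a)) (fst x) (snd x) \<partial>?P) =
    e\<^sup>2 / 2 * (\<Sum>l\<in>?L. (triangle_coeff M l)\<^sup>2 * (cmod (gamma_coeff g l))\<^sup>2)"
    unfolding sc using int by (simp add: integral_cos_difference)
  also have "\<dots> \<le> e\<^sup>2 / 2 * (\<Sum>l\<in>?L. C\<^sup>2 * real M powr (- 2 * \<nu>))"
  proof (intro mult_left_mono sum_mono)
    fix l assume l: "l \<in> ?L"
    have "cmod (gamma_coeff g l) \<le> C * \<bar>real_of_int l\<bar> powr (- \<nu>)" using l M by (intro gam) auto
    also have "\<bar>real_of_int l\<bar> powr (- \<nu>) \<le> real M powr (- \<nu>)"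
      using l M nu by (intro powr_mono2') auto
    finally have "cmod (gamma_coeff g l) \<le> C * real M powr (- \<nu>)" using C by (simp add: mult_left_mono)
    then have "(cmod (gamma_coeff g l))\<^sup>2 \<le> (C * real M powr (- \<nu>))\<^sup>2" by (intro power_mono) auto
    also have "\<dots> = C\<^sup>2 * real M powr (- 2 * \<nu>)"
      by (simp add: power_mult_distrib power2_eq_square powr_add[symmetric])
    finally have "(cmod (gamma_coeff g l))\<^sup>2 \<le> C\<^sup>2 * real M powr (- 2 * \<nu>)" .
    moreover have "(triangle_coeff M l)\<^sup>2 \<le> 1" using triangle_coeff_bounds[OF l] by (simp add: power_le_one)
    ultimately have "(triangle_coeff M l)\<^sup>2 * (cmod (gamma_coeff g l))\<^sup>2 \<le> 1 * (C\<^sup>2 * real M powr (- 2 * \<nu>))"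
      by (intro mult_mono) auto
    then show "(triangle_coeff M l)\<^sup>2 * (cmod (gamma_coeff g l))\<^sup>2 \<le> C\<^sup>2 * real M powr (- 2 * \<nu>)" by simp
  qed simp
  also have "\<dots> \<le> e\<^sup>2 / 2 * (2 * real M * (C\<^sup>2 * real M powr (- 2 * \<nu>)))"
    using M by (intro mult_left_mono) (auto intro!: mult_right_mono)
  also have "\<dots> = e\<^sup>2 * C\<^sup>2 * real M powr (1 - 2 * \<nu>)"
    using powr_mult_base[of "real M" "- 2 * \<nu>"] by (simp add: mult_ac)
  finally show ?thesis .
qed

end

section \<open>Besov norms of band-limited functions\<close>

lemma enn2real_inverse_le_1:
  assumes "1 \<le> p"
  shows "enn2real (1 / p) \<le> 1"
proof (cases p rule: ennreal_cases)
  case (real r)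
  then have "1 \<le> r" using assms by (simp add: ennreal_ge_1)
  then show ?thesis using real divide_ennreal[of 1 r] by simp
qed simp

text \<open>A real bound \<open>m \<ge> 1\<close> on the number of nonzero entries lets one formula
  cover infinite \<open>p\<close>, where \<open>enn2real (1 / p) = 0\<close> and the power of
  \<open>m\<close> is \<open>1\<close>.\<close>

lemma lp_norm_le:
  fixes a :: "'i \<Rightarrow> real"
  assumes p: "1 \<le> p" and J: "finite J" "J \<subseteq> I" and z: "\<And>i. i \<in> I - J \<Longrightarrow> a i = 0"
    and b: "\<And>i. i \<in> J \<Longrightarrow> \<bar>a i\<bar> \<le> b" "0 \<le> b" and m: "real (card J) \<le> m" "1 \<le> m"
  shows "lp_norm p I a \<le> ennreal (b * m powr enn2real (1 / p))"
proof (cases "p = \<infinity>")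
  case True
  have "(SUP i\<in>I. ennreal \<bar>a i\<bar>) \<le> ennreal b"
  proof (rule SUP_least)
    fix i assume "i \<in> I"
    then have "\<bar>a i\<bar> \<le> b" using z[of i] b by (cases "i \<in> J") auto
    then show "ennreal \<bar>a i\<bar> \<le> ennreal b" by (rule ennreal_leI)
  qed
  moreover have "m powr 0 = 1" using m by simp
  ultimately show ?thesis using True by (simp add: lp_norm_def)
next
  case False
  then obtain r where r: "p = ennreal r" "0 \<le> r" by (cases p rule: ennreal_cases) auto
  then have r1: "1 \<le> r" using p by (simp add: ennreal_ge_1)
  have er: "enn2real p = r" using r by simp
  have ir: "enn2real (1 / p) = 1 / r"
    using r r1 divide_ennreal[of 1 r] by simp
  let ?f = "\<lambda>i. \<bar>a i\<bar> powr r"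
  have "(\<Sum>\<^sub>\<infinity>i\<in>I. ennreal (?f i)) = (\<Sum>\<^sub>\<infinity>i\<in>J. ennreal (?f i))"
    using z J by (intro infsum_cong_neutral) auto
  also have "\<dots> = (\<Sum>i\<in>J. ennreal (?f i))" using J by (intro infsum_finite)
  also have "\<dots> = ennreal (\<Sum>i\<in>J. ?f i)" by (intro sum_ennreal) auto
  finally have S: "(\<Sum>\<^sub>\<infinity>i\<in>I. ennreal (\<bar>a i\<bar> powr enn2real p)) = ennreal (\<Sum>i\<in>J. ?f i)" by (simp add: er)
  have S0: "0 \<le> (\<Sum>i\<in>J. ?f i)" by (intro sum_nonneg) auto
  have "(\<Sum>i\<in>J. ?f i) \<le> real (card J) * b powr r"
    using b r1 by (intro sum_bounded_above powr_mono2) auto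
  also have "\<dots> \<le> m * b powr r" using m by (intro mult_right_mono) auto
  finally have "(\<Sum>i\<in>J. ?f i) powr (1 / r) \<le> (m * b powr r) powr (1 / r)"
    using S0 r1 by (intro powr_mono2) auto
  also have "\<dots> = b * m powr (1 / r)"
    using m b(2) r1 by (simp add: powr_mult powr_powr)
  finally have "(\<Sum>i\<in>J. ?f i) powr (1 / r) \<le> b * m powr (1 / r)" .
  then show ?thesis
    unfolding lp_norm_def Let_def S ir using False S0 by (simp add: ennreal_leI)
qed

text \<open>Linearity is checked after unfolding, where every integrand is a bounded function times
  \<open>w\<close> on the line and so integrable.\<close>

lemma wavelet_coeff_trig:
  fixes I :: "'i set" and l :: "'i \<Rightarrow> int"
  assumes w: "integrable lborel w" and I: "finite I"
  shows "wavelet_coeff w (\<lambda>t. \<rho> + (\<Sum>i\<in>I. c i * cos (2 * pi * of_int (l i) * t - a i))) j k =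
    \<rho> * wavelet_coeff w (\<lambda>t. 1) j k + (\<Sum>i\<in>I. c i * wavelet_coeff w (\<lambda>t. cos (2 * pi * of_int (l i) * t - a i)) j k)"
proof -
  let ?b = "\<lambda>i t. cos (2 * pi * of_int (l i) * t - a i)"
  let ?y = "\<lambda>y. (y + real k) / 2 ^ j"
  have bi: "integrable lborel (\<lambda>y. ?b i (?y y) * w y)" for i
    by (rule wavelet_coeff_unfold(2)[OF w _ _ cos_periodic_shift, where c=1]) auto
  have b: "wavelet_coeff w (?b i) j k = 2 powr (- real j / 2) * (LBINT y. ?b i (?y y) * w y)" for i
    by (rule wavelet_coeff_unfold(1)[OF w _ _ cos_periodic_shift, where c=1]) auto
  have one: "wavelet_coeff w (\<lambda>t. 1) j k = 2 powr (- real j / 2) * (LBINT y. w y)"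
    using wavelet_coeff_unfold(1)[OF w, where b="\<lambda>_. 1" and c=1] by simp
  have bd: "\<bar>\<rho> + (\<Sum>i\<in>I. c i * ?b i t)\<bar> \<le> \<bar>\<rho>\<bar> + (\<Sum>i\<in>I. \<bar>c i\<bar>)" for t
  proof -
    have "\<bar>\<Sum>i\<in>I. c i * ?b i t\<bar> \<le> (\<Sum>i\<in>I. \<bar>c i\<bar>)"
      by (rule order_trans[OF sum_abs], rule sum_mono) (simp add: abs_mult mult_left_le)
    then show ?thesis by linarith
  qed
  have "wavelet_coeff w (\<lambda>t. \<rho> + (\<Sum>i\<in>I. c i * ?b i t)) j k =
    2 powr (- real j / 2) * (LBINT y. (\<rho> + (\<Sum>i\<in>I. c i * ?b i (?y y))) * w y)"
    by (rule wavelet_coeff_unfold(1)[OF w _ bd]) (auto simp: cos_periodic_shift)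
  also have "(LBINT y. (\<rho> + (\<Sum>i\<in>I. c i * ?b i (?y y))) * w y) = (LBINT y. \<rho> * w y + (\<Sum>i\<in>I. c i * (?b i (?y y) * w y)))"
    by (intro Bochner_Integration.integral_cong refl) (simp add: distrib_right sum_distrib_right mult.assoc)
  also have "\<dots> = \<rho> * (LBINT y. w y) + (\<Sum>i\<in>I. c i * (LBINT y. ?b i (?y y) * w y))"
    using w bi by (simp add: Bochner_Integration.integral_add Bochner_Integration.integral_sum)
  finally show ?thesis unfolding b one by (simp only: distrib_left sum_distrib_left mult_ac)
qed

text \<open>The transform of the wavelet lives where
  \<open>1 / 3 \<le> l / 2 ^ j \<le> 4 / 3\<close>. For \<open>M < l < 3 * M\<close> this confines
  \<open>2 ^ j\<close> between \<open>3 / 4 * M\<close> and \<open>9 * M\<close>, a ratio of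
  \<open>12 < 2 ^ 4\<close>.\<close>

lemma dyadic_window_card:
  assumes "0 < M"
  defines "J \<equiv> {j :: nat. 3 * real M < 4 * 2 ^ j \<and> 2 ^ j < 9 * real M}"
  shows "finite J" "card J \<le> 4"
proof -
  define j1 where "j1 = (LEAST j. 3 * real M < 4 * 2 ^ j)"
  have "\<exists>j. 3 * real M < 4 * 2 ^ j"
  proof -
    obtain j where "3 * real M < 2 ^ j" using real_arch_pow[of 2 "3 * real M"] by auto
    then show ?thesis by (intro exI[of _ j]) simp
  qed
  then have j1: "3 * real M < 4 * 2 ^ j1" unfolding j1_def by (rule LeastI_ex)
  have sub: "J \<subseteq> {j1..<j1 + 4}"
  proof
    fix j assume j: "j \<in> J"
    have "j1 \<le> j" unfolding j1_def using j by (intro Least_le) (simp add: J_def)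
    moreover have "j < j1 + 4"
    proof (rule ccontr)
      assume "\<not> j < j1 + 4"
      then have "(2 :: real) ^ (j1 + 4) \<le> 2 ^ j" by (intro power_increasing) auto
      moreover have "(2 :: real) ^ (j1 + 4) = 16 * 2 ^ j1" by (simp add: power_add)
      ultimately have "16 * 2 ^ j1 < 9 * real M" using j by (simp add: J_def)
      then show False using j1 by linarith
    qed
    ultimately show "j \<in> {j1..<j1 + 4}" by simp
  qed
  then show "finite J" by (rule finite_subset) simp
  have "card J \<le> card {j1..<j1 + 4}" using sub by (intro card_mono) auto
  then show "card J \<le> 4" by simp
qed

text \<open>At level \<open>j0\<close> the scaling functions see only the constant, whereas the
  wavelets are blind to it. On a level of the window the sup bound gives coefficients of order
  \<open>2 powr (- j / 2)\<close>, the norm over \<open>2 ^ j\<close> positions adds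
  \<open>2 powr (j / p)\<close>, and the Besov weight leaves \<open>2 powr (j * s)\<close>, at most
  \<open>(9 * M) powr s\<close>.\<close>

lemma besov_norm_band_limited:
  fixes I :: "'i set" and l :: "'i \<Rightarrow> int"
  assumes phi: "meyer_scaling \<beta> \<phi>" and psi: "meyer_wavelet \<beta> \<psi>" and pq: "1 \<le> p" "1 \<le> q"
    and rho: "0 \<le> \<rho>" and I: "finite I" and l: "\<And>i. i \<in> I \<Longrightarrow> int M < l i \<and> l i < 3 * int M"
    and M: "2 ^ j0 \<le> M" and B: "\<And>t. \<bar>\<Sum>i\<in>I. c i * cos (2 * pi * of_int (l i) * t - a i)\<bar> \<le> B" and s: "0 \<le> s"
  shows "besov_norm \<phi> \<psi> j0 s p q (\<lambda>t. \<rho> + (\<Sum>i\<in>I. c i * cos (2 * pi * of_int (l i) * t - a i))) \<le>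
    ennreal (\<rho> * (2 ^ j0 * (LBINT y. \<bar>\<phi> y\<bar>)) + 4 * ((9 * real M) powr s * (B * (LBINT y. \<bar>\<psi> y\<bar>))))"
proof -
  let ?f = "\<lambda>t. \<Sum>i\<in>I. c i * cos (2 * pi * of_int (l i) * t - a i)"
  have M0: "0 < M" using M by (metis gr0I le_zero_eq power_not_zero zero_neq_numeral)
  have B0: "0 \<le> B" using B[of 0] by linarith
  have fp: "has_fourier_transform \<phi> (meyer_scaling_hat \<beta>)" and fs: "has_fourier_transform \<psi> (meyer_wavelet_hat \<beta>)"
    using phi psi by (auto simp: meyer_scaling_def meyer_wavelet_def)
  have ip: "integrable lborel \<phi>" and iw: "integrable lborel \<psi>" using fp fs by (auto simp: has_fourier_transform_def)
  have n0: "0 \<le> (LBINT y. \<bar>\<phi> y\<bar>)" "0 \<le> (LBINT y. \<bar>\<psi> y\<bar>)" by simp_all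
  have one: "wavelet_coeff w (\<lambda>t. 1) j k = 0" if "has_fourier_transform w F" "F 0 = 0" for w F j k
    using wavelet_coeff_cos_eq_0[OF that(1), of 0 j 0 k] that(2) by simp
  have hat_abs: "\<bar>- (2 * pi * of_int (l i) / 2 ^ j)\<bar> = 2 * pi * (of_int (l i) / 2 ^ j)" if "i \<in> I" for i j
    using l[OF that] by simp
  have scale: "2 * pi * x < 2 * pi * y" if "x < y" for x y
    using that by (intro mult_strict_left_mono) auto
  define P where "P = enn2real (1 / p)"
  have P: "0 \<le> P" "P \<le> 1" unfolding P_def using enn2real_inverse_le_1[OF pq(1)] by auto
  have scaling: "lp_norm p {..<2 ^ j0} (wavelet_coeff \<phi> (\<lambda>t. \<rho> + ?f t) j0) \<le> ennreal (\<rho> * (2 ^ j0 * (LBINT y. \<bar>\<phi> y\<bar>)))"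
  proof -
    have cz: "wavelet_coeff \<phi> (\<lambda>t. cos (2 * pi * of_int (l i) * t - a i)) j0 k = 0" if i: "i \<in> I" for i k
    proof (rule wavelet_coeff_cos_eq_0[OF fp])
      have "real (2 ^ j0) \<le> real M" using M by (simp only: of_nat_le_iff)
      then have "2 ^ j0 \<le> real M" unfolding of_nat_power of_nat_numeral .
      moreover have "real M < real_of_int (l i)" using l[OF i] by linarith
      ultimately have "2 ^ j0 < real_of_int (l i)" by linarith
      then have "2 / 3 * 2 ^ j0 < real_of_int (l i)" using zero_less_power[of "2 :: real" j0] by linarith
      \<comment> \<open>The scaling transform vanishes beyond \<open>4 * pi / 3\<close>, that is for
        \<open>l > 2 / 3 * 2 ^ j0\<close>; \<open>M \<ge> 2 ^ j0\<close> guarantees this.\<close>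
      then have big: "2 * pi * (2 / 3) < 2 * pi * (of_int (l i) / 2 ^ j0)"
        by (intro scale) (simp add: pos_less_divide_eq)
      then have "\<not> 2 * pi * (of_int (l i) / 2 ^ j0) \<le> 2 * pi / 3" "\<not> 2 * pi * (of_int (l i) / 2 ^ j0) \<le> 4 * pi / 3"
        using pi_gt_zero by linarith+
      then show "meyer_scaling_hat \<beta> (- (2 * pi * of_int (l i) / 2 ^ j0)) = 0"
        unfolding meyer_scaling_hat_def hat_abs[OF i] by simp
    qed
    have "lp_norm p {..<2 ^ j0} (wavelet_coeff \<phi> (\<lambda>t. \<rho> + ?f t) j0) \<le>
      ennreal (\<rho> * (2 powr (- real j0 / 2) * (1 * (LBINT y. \<bar>\<phi> y\<bar>))) * (2 ^ j0) powr P)"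
      unfolding P_def
    proof (rule lp_norm_le[OF pq(1), of "{..<2 ^ j0}"])
      fix k
      have "\<bar>wavelet_coeff \<phi> (\<lambda>t. 1) j0 k\<bar> \<le> 2 powr (- real j0 / 2) * (1 * (LBINT y. \<bar>\<phi> y\<bar>))"
        by (rule wavelet_coeff_le[OF ip]) auto
      then show "\<bar>wavelet_coeff \<phi> (\<lambda>t. \<rho> + ?f t) j0 k\<bar> \<le> \<rho> * (2 powr (- real j0 / 2) * (1 * (LBINT y. \<bar>\<phi> y\<bar>)))"
        unfolding wavelet_coeff_trig[OF ip I] using rho by (simp add: cz abs_mult mult_left_mono)
    qed (use rho n0 in auto)
    also have "\<dots> \<le> ennreal (\<rho> * (2 ^ j0 * (LBINT y. \<bar>\<phi> y\<bar>)))"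
    proof (rule ennreal_leI)
      have "2 powr (- real j0 / 2) \<le> (2 :: real) powr 0" by (intro powr_mono) auto
      moreover have "(2 ^ j0 :: real) powr P \<le> (2 ^ j0) powr 1" using P by (intro powr_mono) auto
      ultimately have "2 powr (- real j0 / 2) * (2 ^ j0) powr P \<le> 1 * (2 ^ j0) powr 1"
        by (intro mult_mono) auto
      then have "\<rho> * (LBINT y. \<bar>\<phi> y\<bar>) * (2 powr (- real j0 / 2) * (2 ^ j0) powr P) \<le> \<rho> * (LBINT y. \<bar>\<phi> y\<bar>) * (1 * (2 ^ j0) powr 1)"
        using rho n0 by (intro mult_left_mono) auto
      then show "\<rho> * (2 powr (- real j0 / 2) * (1 * (LBINT y. \<bar>\<phi> y\<bar>))) * (2 ^ j0) powr P \<le> \<rho> * (2 ^ j0 * (LBINT y. \<bar>\<phi> y\<bar>))"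
        by (simp add: mult_ac)
    qed
    finally show ?thesis .
  qed
  define J where "J = {j :: nat. 3 * real M < 4 * 2 ^ j \<and> 2 ^ j < 9 * real M}"
  have wav0: "wavelet_coeff \<psi> (\<lambda>t. \<rho> + ?f t) j k = wavelet_coeff \<psi> ?f j k" for j k
  proof -
    have "wavelet_coeff \<psi> (\<lambda>t. 1) j k = 0" by (rule one[OF fs]) (simp add: meyer_wavelet_hat_def)
    then show ?thesis using wavelet_coeff_trig[OF iw I, of \<rho> c l a j k] wavelet_coeff_trig[OF iw I, of 0 c l a j k] by simp
  qed
  have wavz: "wavelet_coeff \<psi> (\<lambda>t. \<rho> + ?f t) j k = 0" if j: "j \<notin> J" for j k
  proof -
    have "wavelet_coeff \<psi> (\<lambda>t. cos (2 * pi * of_int (l i) * t - a i)) j k = 0" if i: "i \<in> I" for i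
    proof (rule wavelet_coeff_cos_eq_0[OF fs])
      have li: "real M < of_int (l i)" "of_int (l i) < 3 * real M" using l[OF i] by linarith+
      show "meyer_wavelet_hat \<beta> (- (2 * pi * of_int (l i) / 2 ^ j)) = 0"
      proof (cases "2 ^ j < 9 * real M")
        case False
        then have "3 * real_of_int (l i) < 2 ^ j" using li by linarith
        then have "2 * pi * (of_int (l i) / 2 ^ j) < 2 * pi * (1 / 3)"
          by (intro scale) (simp add: pos_divide_less_eq)
        then show ?thesis unfolding meyer_wavelet_hat_def hat_abs[OF i] by simp
      next
        case True
        then have "4 * 2 ^ j < 3 * real_of_int (l i)" using j li by (simp add: J_def)
        then have "2 * pi * (4 / 3) < 2 * pi * (of_int (l i) / 2 ^ j)"
          by (intro scale) (simp add: pos_less_divide_eq)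
        then have "\<not> 2 * pi * (of_int (l i) / 2 ^ j) < 2 * pi / 3" "\<not> 2 * pi * (of_int (l i) / 2 ^ j) \<le> 4 * pi / 3"
            "\<not> 2 * pi * (of_int (l i) / 2 ^ j) \<le> 8 * pi / 3"
          using pi_gt_zero by linarith+
        then show ?thesis unfolding meyer_wavelet_hat_def hat_abs[OF i] by simp
      qed
    qed
    then show ?thesis unfolding wav0 using wavelet_coeff_trig[OF iw I, of 0 c l a j k] by simp
  qed
  let ?b = "(9 * real M) powr s * (B * (LBINT y. \<bar>\<psi> y\<bar>))"
  have level: "2 powr (real j * (s + 1 / 2 - P)) * enn2real (lp_norm p {..<2 ^ j} (wavelet_coeff \<psi> (\<lambda>t. \<rho> + ?f t) j)) \<le> ?b" if j: "j \<in> J" for j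
  proof -
    let ?n = "B * (LBINT y. \<bar>\<psi> y\<bar>)"
    have n: "0 \<le> ?n" using B0 n0 by simp
    have "lp_norm p {..<2 ^ j} (wavelet_coeff \<psi> (\<lambda>t. \<rho> + ?f t) j) \<le> ennreal (2 powr (- real j / 2) * ?n * (2 ^ j) powr P)"
      unfolding P_def
    proof (rule lp_norm_le[OF pq(1), of "{..<2 ^ j}"])
      fix k
      show "\<bar>wavelet_coeff \<psi> (\<lambda>t. \<rho> + ?f t) j k\<bar> \<le> 2 powr (- real j / 2) * ?n"
        unfolding wav0 by (rule wavelet_coeff_le[OF iw _ B]) (auto simp: cos_periodic_shift)
    qed (use n in auto)
    then have "enn2real (lp_norm p {..<2 ^ j} (wavelet_coeff \<psi> (\<lambda>t. \<rho> + ?f t) j)) \<le> 2 powr (- real j / 2) * ?n * (2 ^ j) powr P"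
      using n by (intro enn2real_leI) auto
    then have "2 powr (real j * (s + 1 / 2 - P)) * enn2real (lp_norm p {..<2 ^ j} (wavelet_coeff \<psi> (\<lambda>t. \<rho> + ?f t) j)) \<le>
      2 powr (real j * (s + 1 / 2 - P)) * (2 powr (- real j / 2) * ?n * (2 ^ j) powr P)"
      by (intro mult_left_mono) auto
    also have "(2 ^ j) powr P = 2 powr (real j * P)" by (simp add: powr_powr powr_realpow[symmetric])
    also have "2 powr (real j * (s + 1 / 2 - P)) * (2 powr (- real j / 2) * ?n * 2 powr (real j * P)) = 2 powr (real j * s) * ?n"
    proof -
      have "2 powr (real j * (s + 1 / 2 - P)) * 2 powr (- real j / 2) * 2 powr (real j * P) = 2 powr (real j * s)"
        unfolding powr_add[symmetric] by (intro arg_cong2[where f="(powr)"] refl) (simp add: algebra_simps)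
      then show ?thesis by (simp add: mult_ac)
    qed
    also have "2 powr (real j * s) = (2 ^ j) powr s" by (simp add: powr_powr powr_realpow[symmetric])
    also have "(2 ^ j) powr s * ?n \<le> ?b"
      using j s n by (intro mult_right_mono powr_mono2) (auto simp: J_def)
    finally show ?thesis .
  qed
  have b0: "0 \<le> ?b" using B0 n0 by simp
  have lz: "lp_norm p S (\<lambda>k. 0) = 0" for S :: "nat set"
  proof -
    have "lp_norm p S (\<lambda>k. 0) \<le> ennreal (0 * 1 powr enn2real (1 / p))"
      by (rule lp_norm_le[OF pq(1), of "{}"]) auto
    then show ?thesis by simp
  qed
  have "lp_norm q {j0..} (\<lambda>j. 2 powr (real j * (s + 1 / 2 - P)) * enn2real (lp_norm p {..<2 ^ j} (wavelet_coeff \<psi> (\<lambda>t. \<rho> + ?f t) j))) \<le> ennreal (?b * 4 powr enn2real (1 / q))"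
  proof (rule lp_norm_le[OF pq(2), of "J \<inter> {j0..}"])
    show "finite (J \<inter> {j0..})" using dyadic_window_card(1)[OF M0] by (auto simp: J_def)
    have "card (J \<inter> {j0..}) \<le> card J" using dyadic_window_card(1)[OF M0] by (intro card_mono) (auto simp: J_def)
    then show "real (card (J \<inter> {j0..})) \<le> 4" using dyadic_window_card(2)[OF M0] by (simp add: J_def)
    fix j
    show "2 powr (real j * (s + 1 / 2 - P)) * enn2real (lp_norm p {..<2 ^ j} (wavelet_coeff \<psi> (\<lambda>t. \<rho> + ?f t) j)) = 0" if "j \<in> {j0..} - J \<inter> {j0..}"
    proof -
      have "wavelet_coeff \<psi> (\<lambda>t. \<rho> + ?f t) j = (\<lambda>k. 0)" using wavz that by auto
      then show ?thesis by (simp add: lz)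
    qed
    show "\<bar>2 powr (real j * (s + 1 / 2 - P)) * enn2real (lp_norm p {..<2 ^ j} (wavelet_coeff \<psi> (\<lambda>t. \<rho> + ?f t) j))\<bar> \<le> ?b" if "j \<in> J \<inter> {j0..}"
      using level[of j] that by (simp add: abs_mult)
  qed (use b0 in auto)
  also have "\<dots> \<le> ennreal (4 * ?b)"
  proof (rule ennreal_leI)
    \<comment> \<open>The number of levels enters with an exponent of at most \<open>1\<close>,
      whatever \<open>q\<close>.\<close>
    have "4 powr enn2real (1 / q) \<le> (4 :: real) powr 1"
      using enn2real_inverse_le_1[OF pq(2)] by (intro powr_mono) auto
    then show "?b * 4 powr enn2real (1 / q) \<le> 4 * ?b" using mult_left_mono[OF _ b0] by (simp add: mult.commute)
  qed
  finally have "besov_norm \<phi> \<psi> j0 s p q (\<lambda>t. \<rho> + ?f t) \<le> ennreal (\<rho> * (2 ^ j0 * (LBINT y. \<bar>\<phi> y\<bar>))) + ennreal (4 * ?b)"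
    unfolding besov_norm_def P_def by (intro add_mono scaling)
  then show ?thesis using rho n0 b0 by (simp add: ennreal_plus[symmetric] del: ennreal_plus)
qed

section \<open>Reduction to a hypercube\<close>

lemma fejer_integral: "0 < M \<Longrightarrow> (LBINT t:{0..1}. fejer M (t - a)) = 1"
proof -
  assume M: "0 < M"
  let ?c = "\<lambda>j::int. 1 - \<bar>of_int j\<bar> / real M"
  have "(LBINT t:{0..1}. fejer M (t - a)) =
    (LBINT t:{0..1}. (\<Sum>j\<in>{- int M<..<int M}. ?c j * cos (2 * pi * of_int j * t - 2 * pi * of_int j * a)))"
    unfolding fejer_def by (simp add: right_diff_distrib)
  also have "\<dots> = (\<Sum>j\<in>{- int M<..<int M}. LBINT t:{0..1}. ?c j * cos (2 * pi * of_int j * t - 2 * pi * of_int j * a))"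
    by (rule set_integral_finite_sum) (intro borel_integrable_atLeastAtMost' continuous_intros)
  also have "\<dots> = (\<Sum>j\<in>{- int M<..<int M}. if j = 0 then 1 else 0)"
  proof (intro sum.cong refl)
    fix j :: int
    show "(LBINT t:{0..1}. ?c j * cos (2 * pi * of_int j * t - 2 * pi * of_int j * a)) = (if j = 0 then 1 else 0)"
      using integral_cos_period[of j "2 * pi * of_int j * a"] by (cases "j = 0") (simp_all add: set_lebesgue_integral_def)
  qed
  finally show ?thesis using M by simp
qed

lemma continuous_on_fejer [continuous_intros]:
  fixes f :: "real \<Rightarrow> real"
  shows "continuous_on S f \<Longrightarrow> continuous_on S (\<lambda>t. fejer M (f t))"
  unfolding fejer_def by (auto intro!: continuous_intros)

text \<open>A Bessel inequality for the non-orthogonal system of translates: by positivity,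
  Cauchy-Schwarz with weight \<open>fejer\<close> suffices.\<close>

lemma carrier_fejer_bessel:
  assumes M: "0 < M" and f: "f \<in> L2_01"
  shows "(\<Sum>k<M. (LBINT t:{0..1}. f t * carrier_fejer M (t - real k / M))\<^sup>2) \<le> M * (L2_norm_01 f)\<^sup>2"
proof -
  let ?w = "\<lambda>k t. fejer M (t - real k / M)" and ?h = "\<lambda>t. cos (4 * pi * M * t)"
  have ch: "continuous_on {0..1} ?h" by (intro continuous_intros)
  have cw: "continuous_on {0..1} (?w k)" for k by (intro continuous_intros)
  note cs = weighted_Cauchy_Schwarz[OF f ch cw fejer_nonneg]
  have k: "(LBINT t:{0..1}. f t * carrier_fejer M (t - real k / M))\<^sup>2 \<le> (LBINT t:{0..1}. (f t)\<^sup>2 * ?w k t)" for k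
  proof -
    \<comment> \<open>The second factor of Cauchy-Schwarz is at most the mass \<open>1\<close> of
      the kernel, because the carrier is bounded by \<open>1\<close>.\<close>
    have "(LBINT t:{0..1}. (?h t)\<^sup>2 * ?w k t) \<le> (LBINT t:{0..1}. ?w k t)"
    proof (rule set_integral_mono)
      show "(?h t)\<^sup>2 * ?w k t \<le> ?w k t" for t
        using fejer_nonneg[of M "t - real k / M"] by (intro mult_left_le_one_le) (auto simp: abs_square_le_1)
    qed (intro borel_integrable_atLeastAtMost' continuous_intros)+
    also have "\<dots> = 1" by (rule fejer_integral[OF M])
    finally have h1: "(LBINT t:{0..1}. (?h t)\<^sup>2 * ?w k t) \<le> 1" .
    have f0: "0 \<le> (LBINT t:{0..1}. (f t)\<^sup>2 * ?w k t)"
      unfolding set_lebesgue_integral_def using fejer_nonneg by (intro integral_nonneg_AE) auto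
    have "(LBINT t:{0..1}. f t * (?w k t * ?h t))\<^sup>2 \<le> (LBINT t:{0..1}. (f t)\<^sup>2 * ?w k t) * (LBINT t:{0..1}. (?h t)\<^sup>2 * ?w k t)"
      by (rule cs(1))
    also have "\<dots> \<le> (LBINT t:{0..1}. (f t)\<^sup>2 * ?w k t)" using mult_left_mono[OF h1 f0] by simp
    finally show ?thesis unfolding carrier_fejer_shift .
  qed
  have "(\<Sum>k<M. (LBINT t:{0..1}. f t * carrier_fejer M (t - real k / M))\<^sup>2) \<le> (\<Sum>k<M. LBINT t:{0..1}. (f t)\<^sup>2 * ?w k t)"
    by (intro sum_mono k)
  also have "\<dots> = (LBINT t:{0..1}. (\<Sum>k<M. (f t)\<^sup>2 * ?w k t))"
    by (rule set_integral_finite_sum[symmetric]) (rule cs(2))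
  also have "\<dots> = (LBINT t:{0..1}. (f t)\<^sup>2 * M)"
    unfolding sum_distrib_left[symmetric] fejer_partition[OF M] ..
  also have "\<dots> = M * (L2_norm_01 f)\<^sup>2" unfolding L2_norm_sq by simp
  finally show ?thesis .
qed

section \<open>Vertices of the hypercube\<close>

text \<open>A vertex of the hypercube is encoded as the set \<open>S\<close> of the indices whose
  bump is switched on; neighbours differ by one index.\<close>

definition bump_sum :: "real \<Rightarrow> nat \<Rightarrow> nat set \<Rightarrow> real \<Rightarrow> real" where
  "bump_sum e M S t = (\<Sum>k\<in>S. e * carrier_fejer M (t - real k / M))"

lemma continuous_on_bump_sum [continuous_intros]:
  fixes f :: "real \<Rightarrow> real"
  shows "continuous_on X f \<Longrightarrow> continuous_on X (\<lambda>t. bump_sum e M S (f t))"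
  unfolding bump_sum_def by (auto intro!: continuous_intros)

lemma bump_sum_le:
  assumes M: "0 < M" and e: "0 \<le> e" and S: "S \<subseteq> {..<M}"
  shows "\<bar>bump_sum e M S t\<bar> \<le> e * M"
proof -
  have "\<bar>bump_sum e M S t\<bar> \<le> (\<Sum>k\<in>S. e * fejer M (t - real k / M))"
    unfolding bump_sum_def using e
    by (intro order_trans[OF sum_abs] sum_mono) (simp add: abs_mult mult_left_mono carrier_fejer_le)
  also have "\<dots> \<le> (\<Sum>k<M. e * fejer M (t - real k / M))"
    using S e fejer_nonneg by (intro sum_mono2) auto
  also have "\<dots> = e * M" unfolding sum_distrib_left[symmetric] fejer_partition[OF M] ..
  finally show ?thesis .
qed

lemma bump_sum_cos:
  "bump_sum e M S t = (\<Sum>i\<in>S \<times> {int M<..<3 * int M}.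
     (e * triangle_coeff M (snd i)) * cos (2 * pi * of_int (snd i) * t - 2 * pi * of_int (snd i) * (real (fst i) / M)))"
proof -
  have "bump_sum e M S t = (\<Sum>k\<in>S. \<Sum>l\<in>{int M<..<3 * int M}.
     (e * triangle_coeff M l) * cos (2 * pi * of_int l * t - 2 * pi * of_int l * (real k / M)))"
    unfolding bump_sum_def carrier_fejer_cos sum_distrib_left
    by (simp only: right_diff_distrib mult.assoc)
  then show ?thesis by (simp add: sum.cartesian_product case_prod_beta)
qed

lemma bump_sum_mean_zero: "(LBINT t:{0..1}. bump_sum e M S (t - \<tau>)) = 0"
proof (cases "finite S")
  case True
  let ?I = "S \<times> {int M<..<3 * int M}"
  have "(LBINT t:{0..1}. bump_sum e M S (t - \<tau>)) = (LBINT t:{0..1}. (\<Sum>i\<in>?I.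
     (e * triangle_coeff M (snd i)) * cos (2 * pi * of_int (snd i) * t - 2 * pi * of_int (snd i) * (\<tau> + real (fst i) / M))))"
    unfolding bump_sum_cos by (simp only: right_diff_distrib distrib_left diff_diff_eq)
  also have "\<dots> = (\<Sum>i\<in>?I. LBINT t:{0..1}. (e * triangle_coeff M (snd i)) * cos (2 * pi * of_int (snd i) * t - 2 * pi * of_int (snd i) * (\<tau> + real (fst i) / M)))"
    by (rule set_integral_finite_sum) (intro borel_integrable_atLeastAtMost' continuous_intros)
  also have "\<dots> = 0"
    by (intro sum.neutral ballI) (auto simp: integral_cos_period)
  finally show ?thesis .
qed (simp add: bump_sum_def set_lebesgue_integral_def)

lemma perturbation_bump_sum:
  assumes M: "0 < M" and e: "0 \<le> e" and S: "S \<subseteq> {..<M}" and rho: "0 < \<rho>" "e * M \<le> \<rho> / 2"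
  shows "perturbation \<rho> (bump_sum e M S)"
proof
  show "\<bar>bump_sum e M S t\<bar> \<le> \<rho> / 2" for t using bump_sum_le[OF M e S, of t] rho by simp
  show "bump_sum e M S (t + of_int m) = bump_sum e M S t" for t m
  proof -
    have "t + of_int m - real k / M = (t - real k / M) + of_int m" for k by simp
    then show ?thesis unfolding bump_sum_def by (simp only: carrier_fejer_periodic)
  qed
qed (use rho in \<open>auto intro!: continuous_intros bump_sum_mean_zero\<close>)

lemma bump_sum_insert:
  "finite S \<Longrightarrow> k \<notin> S \<Longrightarrow> bump_sum e M (insert k S) t = e * carrier_fejer M (t - real k / M) + bump_sum e M S t"
  by (simp add: bump_sum_def)

text \<open>Only pairs of neighbours in the hypercube are compared, each coordinate \<open>k\<close> being read off
  by the same functional \<open>\<theta> k\<close> for both neighbours; the values of \<open>\<theta> k\<close> at the other vertices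
  are irrelevant.\<close>

lemma hypercube_sum_ge:
  fixes \<theta> :: "nat \<Rightarrow> nat set \<Rightarrow> real" and W :: "nat set \<Rightarrow> ennreal" and F :: "nat set \<Rightarrow> real"
  assumes F: "\<And>S. S \<subseteq> {..<M} \<Longrightarrow> (\<Sum>k<M. (\<theta> k S)\<^sup>2) \<le> M * F S" "\<And>S. 0 \<le> F S" and M: "0 < M"
    and step: "\<And>k S. k < M \<Longrightarrow> S \<subseteq> {..<M} - {k} \<Longrightarrow> \<theta> k (insert k S) = \<theta> k S - d k" and d: "\<And>k. k < M \<Longrightarrow> D \<le> d k" "0 \<le> D"
  shows "(\<Sum>k<M. \<Sum>S\<in>Pow ({..<M} - {k}). ennreal (D\<^sup>2 / 2) * min (W S) (W (insert k S))) \<le>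
    of_nat M * (\<Sum>S\<in>Pow {..<M}. ennreal (F S) * W S)"
proof -
  have "(\<Sum>k<M. \<Sum>S\<in>Pow ({..<M} - {k}). ennreal (D\<^sup>2 / 2) * min (W S) (W (insert k S))) \<le>
    (\<Sum>k<M. \<Sum>S\<in>Pow {..<M}. ennreal ((\<theta> k S)\<^sup>2) * W S)"
  proof (intro sum_mono)
    fix k assume "k \<in> {..<M}"
    then have k: "k < M" by simp
    let ?P = "Pow ({..<M} - {k})"
    \<comment> \<open>The sets \<open>S\<close> without \<open>k\<close>, together with their
      partners \<open>insert k S\<close>, run through all vertices exactly once.\<close>
    have split: "Pow {..<M} = ?P \<union> insert k ` ?P"
      using k Pow_insert[of k "{..<M} - {k}"] by (simp add: insert_absorb)
    have disj: "?P \<inter> insert k ` ?P = {}" by auto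
    have inj: "inj_on (insert k) ?P" by (auto simp: inj_on_def)
    have "(\<Sum>S\<in>?P. ennreal (D\<^sup>2 / 2) * min (W S) (W (insert k S))) \<le>
      (\<Sum>S\<in>?P. ennreal ((\<theta> k S)\<^sup>2) * W S + ennreal ((\<theta> k (insert k S))\<^sup>2) * W (insert k S))"
    proof (intro sum_mono)
      fix S assume S: "S \<in> ?P"
      have "D\<^sup>2 / 2 \<le> (d k)\<^sup>2 / 2" using d k by (intro divide_right_mono power_mono) auto
      also have "\<dots> \<le> (\<theta> k S)\<^sup>2 + (\<theta> k (insert k S))\<^sup>2"
        using two_squares_ge[of "d k" "\<theta> k S" 0] step[OF k, of S] S by auto
      finally have "ennreal (D\<^sup>2 / 2) \<le> ennreal ((\<theta> k S)\<^sup>2) + ennreal ((\<theta> k (insert k S))\<^sup>2)"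
        by (simp add: ennreal_plus[symmetric] ennreal_leI del: ennreal_plus)
      then have "ennreal (D\<^sup>2 / 2) * min (W S) (W (insert k S)) \<le>
        (ennreal ((\<theta> k S)\<^sup>2) + ennreal ((\<theta> k (insert k S))\<^sup>2)) * min (W S) (W (insert k S))"
        by (intro mult_right_mono) auto
      also have "\<dots> = ennreal ((\<theta> k S)\<^sup>2) * min (W S) (W (insert k S)) + ennreal ((\<theta> k (insert k S))\<^sup>2) * min (W S) (W (insert k S))"
        by (rule distrib_right)
      also have "\<dots> \<le> ennreal ((\<theta> k S)\<^sup>2) * W S + ennreal ((\<theta> k (insert k S))\<^sup>2) * W (insert k S)"
        by (intro add_mono mult_left_mono) auto
      finally show "ennreal (D\<^sup>2 / 2) * min (W S) (W (insert k S)) \<le>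
        ennreal ((\<theta> k S)\<^sup>2) * W S + ennreal ((\<theta> k (insert k S))\<^sup>2) * W (insert k S)" .
    qed
    also have "\<dots> = (\<Sum>S\<in>?P. ennreal ((\<theta> k S)\<^sup>2) * W S) + (\<Sum>S\<in>insert k ` ?P. ennreal ((\<theta> k S)\<^sup>2) * W S)"
      by (simp add: sum.distrib sum.reindex[OF inj])
    also have "\<dots> = (\<Sum>S\<in>Pow {..<M}. ennreal ((\<theta> k S)\<^sup>2) * W S)"
      unfolding split by (rule sum.union_disjoint[symmetric]) (use disj in auto)
    finally show "(\<Sum>S\<in>?P. ennreal (D\<^sup>2 / 2) * min (W S) (W (insert k S))) \<le> (\<Sum>S\<in>Pow {..<M}. ennreal ((\<theta> k S)\<^sup>2) * W S)" .
  qed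
  also have "\<dots> = (\<Sum>S\<in>Pow {..<M}. (\<Sum>k<M. ennreal ((\<theta> k S)\<^sup>2)) * W S)"
    unfolding sum_distrib_right by (rule sum.swap)
  also have "\<dots> \<le> (\<Sum>S\<in>Pow {..<M}. (of_nat M * ennreal (F S)) * W S)"
  proof (intro sum_mono mult_right_mono)
    fix S assume "S \<in> Pow {..<M}"
    then have "ennreal (\<Sum>k<M. (\<theta> k S)\<^sup>2) \<le> ennreal (real M * F S)" using F(1)[of S] by (intro ennreal_leI) auto
    then show "(\<Sum>k<M. ennreal ((\<theta> k S)\<^sup>2)) \<le> of_nat M * ennreal (F S)"
      by (simp add: sum_ennreal ennreal_mult' ennreal_of_nat_eq_real_of_nat)
  qed simp
  finally show ?thesis by (simp add: sum_distrib_left mult.assoc)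
qed

text \<open>Assouad's argument. There are \<open>M * 2 ^ (M - 1)\<close> pairs of neighbours, each
  contributing at least \<open>D\<^sup>2 / 2\<close> times an affinity of at least
  \<open>1 / 4\<close>. The Bessel inequality costs a factor \<open>M\<close>, which cancels the
  number of coordinates, and averaging divides by the \<open>2 ^ M\<close> vertices. With
  \<open>D = e * M / 6\<close> there remains
  \<open>D\<^sup>2 / 16 = (e * M)\<^sup>2 / 576\<close>.\<close>

lemma assouad_risk_bound:
  assumes g: "shift_density g" and M: "0 < M" and e: "0 \<le> e" and rho: "0 < \<rho>" "e * M \<le> \<rho> / 2"
    and small: "2 / \<rho> * (e * M)\<^sup>2 \<le> 1" and nu: "0 \<le> \<nu>" and C: "0 \<le> C"
    and gam: "\<And>l::int. l \<noteq> 0 \<Longrightarrow> cmod (gamma_coeff g l) \<le> C * \<bar>real_of_int l\<bar> powr (- \<nu>)"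
    and est: "est \<in> estimators n"
    and R: "\<And>S. S \<subseteq> {..<M} \<Longrightarrow> risk g n est (\<lambda>t. \<rho> + bump_sum e M S t) \<le> R"
    and chi: "(1 + exp \<rho> * (2 / \<rho> * (e\<^sup>2 * C\<^sup>2 * real M powr (1 - 2 * \<nu>)) + 8 * (2 / \<rho> * (e * M)\<^sup>2)\<^sup>2)) ^ n \<le> 3"
  shows "ennreal ((e * M)\<^sup>2 / 576) \<le> R"
proof -
  define \<delta> where "\<delta> = exp \<rho> * (2 / \<rho> * (e\<^sup>2 * C\<^sup>2 * real M powr (1 - 2 * \<nu>)) + 8 * (2 / \<rho> * (e * M)\<^sup>2)\<^sup>2)"
  have V0: "0 \<le> e\<^sup>2 * C\<^sup>2 * real M powr (1 - 2 * \<nu>)" by simp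
  have d0: "0 \<le> \<delta>" unfolding \<delta>_def using rho V0 by simp
  have sp: "shifted_perturbation g \<rho> (bump_sum e M S)" if "S \<subseteq> {..<M}" for S
    unfolding shifted_perturbation_def using g perturbation_bump_sum[OF M e that rho] by simp
  interpret E: shifted_perturbation g \<rho> "bump_sum e M {}" by (rule sp) simp
  let ?B = "PiM {..<n} (\<lambda>_. E.base_law)"
  define W where "W S N = (\<Prod>i<n. shifted_perturbation.mixture g \<rho> (bump_sum e M S) (N i))" for S N
  define F where "F N S = (L2_norm_01 (\<lambda>t. est N t - (\<rho> + bump_sum e M S t)))\<^sup>2" for N S
  let ?H = "\<lambda>k. Pow ({..<M} - {k})" and ?m = "\<lambda>k S N. min (W S N) (W (insert k S) N)"
  let ?K = "\<lambda>k t. carrier_fejer M (t - real k / M)" and ?d = "\<lambda>N S t. est N t - (\<rho> + bump_sum e M S t)"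
  define D where "D = e * (real M / 6)"
  have lamL2: "(\<lambda>t. \<rho> + bump_sum e M S t) \<in> L2_01" for S
    by (intro continuous_in_L2_01 continuous_intros)
  have Bsets: "sets ?B = sets (PiM {..<n} (\<lambda>_. config_space))" by (intro sets_PiM_cong) auto
  have estB: "est \<in> ?B \<rightarrow>\<^sub>M L2_borel"
    using est unfolding estimators_def by (subst measurable_cong_sets[OF Bsets refl])
  have spL: "space L2_borel = L2_01"
    unfolding L2_borel_def by (rule space_measure_of) (auto simp: L2_open_def)
  have Fm: "(\<lambda>N. ennreal (F N S)) \<in> borel_measurable (PiM {..<n} (\<lambda>_. config_space))" for S
    using measurable_compose[OF est[unfolded estimators_def] measurable_L2_dist[OF lamL2[of S]]]
    unfolding F_def by measurable
  have FmB: "(\<lambda>N. ennreal (F N S)) \<in> borel_measurable ?B" for S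
    using Fm by (subst measurable_cong_sets[OF Bsets refl])
  have Wm: "W S \<in> borel_measurable ?B" if "S \<subseteq> {..<M}" for S
  proof -
    interpret T: shifted_perturbation g \<rho> "bump_sum e M S" by (rule sp[OF that])
    show ?thesis unfolding W_def by measurable
  qed
  have risk: "(\<integral>\<^sup>+N. ennreal (F N S) * W S N \<partial>?B) \<le> R" if "S \<subseteq> {..<M}" for S
  proof -
    interpret T: shifted_perturbation g \<rho> "bump_sum e M S" by (rule sp[OF that])
    have "risk g n est (\<lambda>t. \<rho> + bump_sum e M S t) = (\<integral>\<^sup>+N. ennreal (F N S) * W S N \<partial>?B)"
      unfolding risk_def W_def F_def[symmetric] by (rule T.observation_integral[OF Fm])
    then show ?thesis using R[OF that] by simp
  qed
  have aff: "ennreal (1 / 4) \<le> (\<integral>\<^sup>+N. ?m k S N \<partial>?B)" if k: "k < M" and S: "S \<subseteq> {..<M} - {k}" for k S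
  proof -
    have S': "S \<subseteq> {..<M}" "insert k S \<subseteq> {..<M}" using k S by auto
    have fin: "finite S" using S by (rule finite_subset) simp
    \<comment> \<open>Neighbours differ by a single bump; its sign is immaterial as the correlation
      is quadratic in the amplitude.\<close>
    have diff: "(\<lambda>t. bump_sum e M S t - bump_sum e M (insert k S) t) = (\<lambda>t. (- e) * ?K k t)"
    proof
      fix t
      have "k \<notin> S" using S by auto
      from bump_sum_insert[OF fin this, of e M t]
      show "bump_sum e M S t - bump_sum e M (insert k S) t = (- e) * ?K k t" by simp
    qed
    have "(\<integral>\<^sup>+N. ennreal (2 ^ size N * (enn2real (shifted_perturbation.mixture g \<rho> (bump_sum e M S) N) -
      enn2real (shifted_perturbation.mixture g \<rho> (bump_sum e M (insert k S)) N))\<^sup>2) \<partial>E.base_law) \<le> ennreal \<delta>"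
      unfolding \<delta>_def
    proof (rule chi_square_bound[OF sp[OF S'(1)] sp[OF S'(2)] _ _ small _ V0])
      show "\<bar>bump_sum e M S t\<bar> \<le> e * M" "\<bar>bump_sum e M (insert k S) t\<bar> \<le> e * M" for t
        using bump_sum_le[OF M e S'(1)] bump_sum_le[OF M e S'(2)] by auto
      show "(\<integral>x. shift_corr (\<lambda>t. bump_sum e M S t - bump_sum e M (insert k S) t) (\<lambda>t. bump_sum e M S t - bump_sum e M (insert k S) t) (fst x) (snd x)
          \<partial>(E.shift_law \<Otimes>\<^sub>M E.shift_law)) \<le> e\<^sup>2 * C\<^sup>2 * real M powr (1 - 2 * \<nu>)"
        unfolding diff using E.carrier_fejer_smoothing[OF M nu C gam, of "- e" "real k / M"] by simp
    qed
    from affinity_bound[OF sp[OF S'(1)] sp[OF S'(2)] this d0, of n]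
    have "ennreal (1 - (1 + \<delta>) ^ n / 4) \<le> (\<integral>\<^sup>+N. ?m k S N \<partial>?B)"
      unfolding W_def .
    \<comment> \<open>The hypothesis \<open>chi\<close> bounds the power by \<open>3\<close>, and
      \<open>1 - 3 / 4 = 1 / 4\<close>.\<close>
    moreover have "1 / 4 \<le> 1 - (1 + \<delta>) ^ n / 4" using chi unfolding \<delta>_def by simp
    then have "ennreal (1 / 4) \<le> ennreal (1 - (1 + \<delta>) ^ n / 4)" by (rule ennreal_leI)
    ultimately show ?thesis by (rule order_trans[rotated])
  qed
  have pointwise: "(\<Sum>k<M. \<Sum>S\<in>?H k. ennreal (D\<^sup>2 / 2) * ?m k S N) \<le>
    of_nat M * (\<Sum>S\<in>Pow {..<M}. ennreal (F N S) * W S N)" if N: "N \<in> space ?B" for N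
  proof (rule hypercube_sum_ge[where W="\<lambda>S. W S N" and F="F N" and \<theta>="\<lambda>k S. LBINT t:{0..1}. (?d N S t) * ?K k t"
        and d="\<lambda>k. e * (LBINT t:{0..1}. (?K k t)\<^sup>2)"])
    have eN: "est N \<in> L2_01" using measurable_space[OF estB N] spL by simp
    fix S
    show "(\<Sum>k<M. (LBINT t:{0..1}. (?d N S t) * ?K k t)\<^sup>2) \<le> M * F N S"
      unfolding F_def by (rule carrier_fejer_bessel[OF M L2_diff_mem(1)[OF eN lamL2]])
    show "0 \<le> F N S" by (simp add: F_def)
    fix k assume k: "k < M" and S: "S \<subseteq> {..<M} - {k}"
    have fin: "finite S" using S by (rule finite_subset) simp
    have kS: "k \<notin> S" using S by auto
    have KL2: "?K k \<in> L2_01" by (intro continuous_in_L2_01 continuous_intros)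
    have i1: "set_integrable lborel {0..1} (\<lambda>t. (?d N S t) * ?K k t)"
      by (rule L2_diff_mem(2)[OF L2_diff_mem(1)[OF eN lamL2] KL2])
    have i2: "set_integrable lborel {0..1} (\<lambda>t. e * (?K k t)\<^sup>2)"
      by (intro borel_integrable_atLeastAtMost' continuous_intros)
    \<comment> \<open>Switching on the bump \<open>k\<close> changes its own functional by a fixed
      amount, whatever the other bumps are; overlaps between bumps therefore do no harm when
      neighbours are compared.\<close>
    have "(LBINT t:{0..1}. (est N t - (\<rho> + bump_sum e M (insert k S) t)) * ?K k t) =
      (LBINT t:{0..1}. (?d N S t) * ?K k t - e * (?K k t)\<^sup>2)"
      by (intro arg_cong[where f="set_lebesgue_integral lborel {0..1}"] ext)
         (simp add: bump_sum_insert[OF fin kS] power2_eq_square algebra_simps)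
    also have "\<dots> = (LBINT t:{0..1}. (?d N S t) * ?K k t) - e * (LBINT t:{0..1}. (?K k t)\<^sup>2)"
      using i1 i2 by (subst set_integral_diff) auto
    finally show "(LBINT t:{0..1}. (est N t - (\<rho> + bump_sum e M (insert k S) t)) * ?K k t) =
      (LBINT t:{0..1}. (?d N S t) * ?K k t) - e * (LBINT t:{0..1}. (?K k t)\<^sup>2)" .
  next
    fix k
    show "D \<le> e * (LBINT t:{0..1}. (?K k t)\<^sup>2)"
      unfolding D_def using carrier_fejer_norm[OF M] e by (intro mult_left_mono)
  qed (use M e in \<open>auto simp: D_def\<close>)
  have cardk: "card (?H k) * 2 = 2 ^ M" if "k < M" for k
    using that M by (simp add: card_Pow power_eq_if)
  have "of_nat M * (of_nat (card (Pow {..<M})) * ennreal (D\<^sup>2 / 16)) \<le> of_nat M * (of_nat (card (Pow {..<M})) * R)"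
  proof -
    have "of_nat M * (of_nat (card (Pow {..<M})) * ennreal (D\<^sup>2 / 16)) = ennreal (real M * (2 ^ M * (D\<^sup>2 / 16)))"
      by (simp add: card_Pow ennreal_of_nat_eq_real_of_nat ennreal_mult'[symmetric])
    also have "real M * (2 ^ M * (D\<^sup>2 / 16)) = (\<Sum>k<M. \<Sum>S\<in>?H k. D\<^sup>2 / 2 * (1 / 4))"
    proof -
      have each: "(\<Sum>S\<in>?H k. D\<^sup>2 / 2 * (1 / 4)) = 2 ^ M * (D\<^sup>2 / 16)" if k: "k < M" for k
      proof -
        have "(\<Sum>S\<in>?H k. D\<^sup>2 / 2 * (1 / 4)) = real (card (?H k) * 2) * (D\<^sup>2 / 16)"
          by simp
        then show ?thesis unfolding cardk[OF k] by simp
      qed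
      have "(\<Sum>k<M. \<Sum>S\<in>?H k. D\<^sup>2 / 2 * (1 / 4)) = (\<Sum>k<M. 2 ^ M * (D\<^sup>2 / 16))"
        by (rule sum.cong[OF refl], rule each) (simp only: lessThan_iff)
      then show ?thesis by simp
    qed
    also have "ennreal \<dots> = (\<Sum>k<M. \<Sum>S\<in>?H k. ennreal (D\<^sup>2 / 2) * ennreal (1 / 4))"
      by (simp add: sum_ennreal ennreal_mult'[symmetric] sum_nonneg del: sum_constant)
    also have "\<dots> \<le> (\<Sum>k<M. \<Sum>S\<in>?H k. ennreal (D\<^sup>2 / 2) * (\<integral>\<^sup>+N. ?m k S N \<partial>?B))"
      by (intro sum_mono mult_left_mono aff) auto
    also have "\<dots> = (\<integral>\<^sup>+N. (\<Sum>k<M. \<Sum>S\<in>?H k. ennreal (D\<^sup>2 / 2) * ?m k S N) \<partial>?B)"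
    proof -
      have m: "(\<lambda>N. ?m k S N) \<in> borel_measurable ?B" if "k < M" "S \<in> ?H k" for k S
        using that by (intro borel_measurable_min Wm) auto
      have m': "(\<lambda>N. ennreal (D\<^sup>2 / 2) * ?m k S N) \<in> borel_measurable ?B" if "k < M" "S \<in> ?H k" for k S
        using m[OF that] by (intro borel_measurable_times_ennreal) auto
      have "(\<integral>\<^sup>+N. (\<Sum>k<M. \<Sum>S\<in>?H k. ennreal (D\<^sup>2 / 2) * ?m k S N) \<partial>?B) =
        (\<Sum>k<M. \<integral>\<^sup>+N. (\<Sum>S\<in>?H k. ennreal (D\<^sup>2 / 2) * ?m k S N) \<partial>?B)"
        by (intro nn_integral_sum borel_measurable_sum m') auto
      also have "\<dots> = (\<Sum>k<M. \<Sum>S\<in>?H k. \<integral>\<^sup>+N. ennreal (D\<^sup>2 / 2) * ?m k S N \<partial>?B)"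
        by (intro sum.cong refl nn_integral_sum m') auto
      also have "\<dots> = (\<Sum>k<M. \<Sum>S\<in>?H k. ennreal (D\<^sup>2 / 2) * (\<integral>\<^sup>+N. ?m k S N \<partial>?B))"
        by (intro sum.cong refl nn_integral_cmult m) auto
      finally show ?thesis by simp
    qed
    also have "\<dots> \<le> (\<integral>\<^sup>+N. of_nat M * (\<Sum>S\<in>Pow {..<M}. ennreal (F N S) * W S N) \<partial>?B)"
      by (intro nn_integral_mono pointwise)
    also have "\<dots> = of_nat M * (\<Sum>S\<in>Pow {..<M}. \<integral>\<^sup>+N. ennreal (F N S) * W S N \<partial>?B)"
    proof -
      have m: "(\<lambda>N. ennreal (F N S) * W S N) \<in> borel_measurable ?B" if "S \<in> Pow {..<M}" for S
        using that FmB Wm by (intro borel_measurable_times_ennreal) auto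
      show ?thesis using m
        by (subst nn_integral_cmult, intro borel_measurable_sum, simp, subst nn_integral_sum, auto)
    qed
    also have "\<dots> \<le> of_nat M * (\<Sum>S\<in>Pow {..<M}. R)"
      by (intro mult_left_mono sum_mono risk) auto
    finally show ?thesis by simp
  qed
  then have "ennreal (D\<^sup>2 / 16) \<le> R"
  proof -
    assume le: "of_nat M * (of_nat (card (Pow {..<M})) * ennreal (D\<^sup>2 / 16)) \<le> of_nat M * (of_nat (card (Pow {..<M})) * R)"
    have c: "of_nat M * of_nat (card (Pow {..<M})) = ennreal (real M * 2 ^ M)"
      by (simp add: card_Pow ennreal_of_nat_eq_real_of_nat ennreal_mult'[symmetric])
    have pos: "0 < real M * 2 ^ M" using M by simp
    show ?thesis
    proof (cases R rule: ennreal_cases)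
      case (real r)
      have "ennreal (real M * 2 ^ M) * ennreal (D\<^sup>2 / 16) \<le> ennreal (real M * 2 ^ M) * ennreal r"
        using le unfolding real c[symmetric] by (simp only: mult.assoc)
      then have "ennreal ((real M * 2 ^ M) * (D\<^sup>2 / 16)) \<le> ennreal ((real M * 2 ^ M) * r)"
        using pos real by (simp only: ennreal_mult'[symmetric] less_imp_le)
      then have "(real M * 2 ^ M) * (D\<^sup>2 / 16) \<le> (real M * 2 ^ M) * r"
        using pos real by (subst (asm) ennreal_le_iff) auto
      then have "D\<^sup>2 / 16 \<le> r" using pos by (subst (asm) mult_le_cancel_left_pos) auto
      then show ?thesis unfolding real by (rule ennreal_leI)
    qed simp
  qed
  moreover have "D\<^sup>2 / 16 = (e * M)\<^sup>2 / 576" by (simp add: D_def power2_eq_square)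
  ultimately show ?thesis by simp
qed

section \<open>Choice of the parameters and the rate\<close>

theorem theorem4p1:
  fixes g \<beta> \<phi> \<psi> :: "real \<Rightarrow> real"
    and \<nu> Cg Cg' C \<alpha> s A :: real
    and p q :: ennreal
    and j0 :: nat
  assumes g_density: "g \<in> borel_measurable borel" "\<And>x. 0 \<le> g x" "(\<integral>\<^sup>+ x. ennreal (g x) \<partial>lborel) = 1"
    and A1: "0 < \<nu>" "0 < Cg'" "Cg' \<le> Cg"
      "\<And>l::int. l \<noteq> 0 \<Longrightarrow>
         Cg' * \<bar>real_of_int l\<bar> powr (- \<nu>) \<le> cmod (gamma_coeff g l) \<and>
         cmod (gamma_coeff g l) \<le> Cg * \<bar>real_of_int l\<bar> powr (- \<nu>)"
    and A2: "0 < C" "1 < \<alpha>" "\<And>x. g x \<le> C / (1 + \<bar>x\<bar> powr \<alpha>)"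
    and meyer: "meyer_auxiliary \<beta>" "meyer_scaling \<beta> \<phi>" "meyer_wavelet \<beta> \<psi>"
    and pq: "1 \<le> p" "1 \<le> q"
    and "0 < A"
    and s: "2 * \<nu> + 1 < s"
  shows "\<exists>C0>0. \<forall>\<^sub>F n in sequentially.
    (INF est\<in>estimators n. SUP lam\<in>besov_ball \<phi> \<psi> j0 s p q A \<inter> Lambda0. risk g n est lam)
      \<ge> ennreal (C0 * real n powr (- (2 * s / (2 * s + 2 * \<nu> + 1))))"
proof -
  define r where "r = 2 * s + 2 * \<nu> + 1"
  have s0: "0 < s" and r0: "0 < r" using s A1(1) by (auto simp: r_def)
  have sg: "shift_density g" using g_density by unfold_locales auto
  define \<Phi> where "\<Phi> = (LBINT y. \<bar>\<phi> y\<bar>)"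
  define \<Psi> where "\<Psi> = (LBINT y. \<bar>\<psi> y\<bar>)"
  have pos: "0 \<le> \<Phi>" "0 \<le> \<Psi>" by (simp_all add: \<Phi>_def \<Psi>_def)
  \<comment> \<open>Half of the radius \<open>A\<close> is reserved for the constant
    \<open>\<rho>\<close>, the other half for the bumps; the summand \<open>1\<close> keeps the
    denominator positive, as only \<open>0 \<le> \<Phi>\<close> is at hand.\<close>
  define \<rho> where "\<rho> = A / (2 * (2 ^ j0 * \<Phi> + 1))"
  have den: "0 < 2 * (2 ^ j0 * \<Phi> + 1)" using pos by (simp add: add_nonneg_pos)
  have rho: "0 < \<rho>" unfolding \<rho>_def using \<open>0 < A\<close> den by (intro divide_pos_pos)
  have rhoA: "\<rho> * (2 ^ j0 * \<Phi>) \<le> A / 2"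
  proof -
    have "\<rho> * (2 ^ j0 * \<Phi>) \<le> \<rho> * (2 ^ j0 * \<Phi> + 1)" using rho by simp
    also have "\<dots> = A / 2" unfolding \<rho>_def using den by (simp add: field_simps)
    finally show ?thesis .
  qed
  \<comment> \<open>The chi-square term will be at most \<open>c\<^sup>2 * K * M powr (- r)\<close>:
    the first summand collects the smoothed bump, the second the remainder, with
    \<open>8 * (2 / \<rho>)\<^sup>2 = 32 / \<rho>\<^sup>2\<close>.\<close>
  define K where "K = exp \<rho> * (2 / \<rho> * Cg\<^sup>2 + 32 / \<rho>\<^sup>2)"
  have K0: "0 < K" unfolding K_def using rho by (intro mult_pos_pos add_nonneg_pos) auto
  \<comment> \<open>The four bounds serve in turn \<open>c\<^sup>2 \<le> c\<close>, the smallness of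
    the perturbation against \<open>\<rho>\<close>, the estimate
    \<open>\<delta> \<le> 1 / n\<close>, and the Besov radius.\<close>
  define c where "c = Min {1, \<rho> / 2, 1 / K, A / (8 * 9 powr s * (\<Psi> + 1))}"
  have c0: "0 < c" unfolding c_def using rho K0 \<open>0 < A\<close> pos by (simp add: add_nonneg_pos)
  have c_le: "c \<le> 1" "c \<le> \<rho> / 2" "c \<le> 1 / K" "c \<le> A / (8 * 9 powr s * (\<Psi> + 1))"
    unfolding c_def by (rule Min_le; simp)+
  have csq: "c\<^sup>2 \<le> c" using c0 c_le(1) by (simp add: power2_eq_square mult_left_le)
  have cK: "c\<^sup>2 * K \<le> 1"
  proof -
    have "c\<^sup>2 * K \<le> 1 / K * K" using csq c_le(3) K0 by (intro mult_right_mono) auto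
    then show ?thesis using K0 by simp
  qed
  have cA: "4 * (9 powr s * (c * \<Psi>)) \<le> A / 2"
  proof -
    have "c * \<Psi> \<le> c * (\<Psi> + 1)" using c0 by simp
    also have "\<dots> \<le> A / (8 * 9 powr s * (\<Psi> + 1)) * (\<Psi> + 1)" using c_le(4) pos by (intro mult_right_mono) auto
    also have "\<dots> = A / (8 * 9 powr s)"
    proof -
      have "\<Psi> + 1 \<noteq> 0" using pos by linarith
      then show ?thesis by simp
    qed
    finally have "4 * (9 powr s * (c * \<Psi>)) \<le> 4 * (9 powr s * (A / (8 * 9 powr s)))" by (intro mult_left_mono) auto
    then show ?thesis by simp
  qed
  \<comment> \<open>\<open>M \<le> 2 * n powr (1 / r)\<close> costs the factor
    \<open>2 powr (- 2 * s)\<close>; \<open>576\<close> is the constant of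
    \<open>assouad_risk_bound\<close>.\<close>
  define C0 where "C0 = c\<^sup>2 * 2 powr (- 2 * s) / 576"
  have C0pos: "0 < C0" unfolding C0_def using c0 by simp
  have lower: "ennreal (C0 * real n powr (- (2 * s / r))) \<le>
      (SUP lam\<in>besov_ball \<phi> \<psi> j0 s p q A \<inter> Lambda0. risk g n est lam)"
    if n: "1 \<le> n" "2 ^ j0 \<le> real n powr (1 / r)" and est: "est \<in> estimators n" for n est
  proof -
    \<comment> \<open>The smallest integer with \<open>n \<le> M powr r\<close>, so that a
      chi-square distance of at most \<open>M powr (- r)\<close> is at most
      \<open>1 / n\<close>.\<close>
    define M where "M = nat \<lceil>real n powr (1 / r)\<rceil>"
    have n1: "1 \<le> real n powr (1 / r)" using n(1) r0 by (intro ge_one_powr_ge_zero) auto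
    have Mge: "real n powr (1 / r) \<le> real M" unfolding M_def by linarith
    have Mle: "real M \<le> 2 * real n powr (1 / r)" unfolding M_def using n1 by linarith
    have M1: "1 \<le> real M" using n1 Mge by linarith
    then have M0: "0 < M" by simp
    have Mr: "real n \<le> real M powr r"
    proof -
      have "real n = (real n powr (1 / r)) powr r" using r0 n(1) by (simp add: powr_powr)
      also have "\<dots> \<le> real M powr r" using Mge r0 by (intro powr_mono2) auto
      finally show ?thesis .
    qed
    \<comment> \<open>The perturbation then has uniform size at most
      \<open>e * M = c * M powr (- s)\<close>, which exactly balances the Besov weight
      \<open>(9 * M) powr s\<close> up to constants.\<close>
    define e where "e = c * real M powr (- s) / real M"
    have e0: "0 \<le> e" unfolding e_def using c0 by simp
    have eM: "e * M = c * real M powr (- s)" unfolding e_def using M0 by simp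
    have eMc: "e * M \<le> c"
    proof -
      have "real M powr (- s) \<le> real M powr 0" using M1 s0 by (intro powr_mono) auto
      then have "c * real M powr (- s) \<le> c * 1" using c0 M0 by (intro mult_left_mono) auto
      then show ?thesis unfolding eM by simp
    qed
    have eMsq: "(e * M)\<^sup>2 = c\<^sup>2 * real M powr (- 2 * s)"
      unfolding eM by (simp add: power_mult_distrib power2_eq_square powr_add[symmetric])
    have mem: "(\<lambda>t. \<rho> + bump_sum e M S t) \<in> besov_ball \<phi> \<psi> j0 s p q A \<inter> Lambda0" if S: "S \<subseteq> {..<M}" for S
    proof -
      have bd: "\<bar>bump_sum e M S t\<bar> \<le> e * M" for t by (rule bump_sum_le[OF M0 e0 S])
      have L2: "(\<lambda>t. \<rho> + bump_sum e M S t) \<in> L2_01" by (intro continuous_in_L2_01 continuous_intros)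
      have nn: "0 \<le> \<rho> + bump_sum e M S t" for t using bd[of t] eMc c_le(2) rho by linarith
      let ?I = "S \<times> {int M<..<3 * int M}"
      have fin: "finite ?I" using finite_subset[OF S] by simp
      have "2 ^ j0 \<le> real M" using n(2) Mge by linarith
      then have "real (2 ^ j0) \<le> real M" unfolding of_nat_power of_nat_numeral .
      then have jM: "2 ^ j0 \<le> M" by (simp only: of_nat_le_iff)
      have "besov_norm \<phi> \<psi> j0 s p q (\<lambda>t. \<rho> + bump_sum e M S t) \<le>
        ennreal (\<rho> * (2 ^ j0 * \<Phi>) + 4 * ((9 * real M) powr s * (e * M * \<Psi>)))"
        unfolding bump_sum_cos \<Phi>_def \<Psi>_def
      proof (rule besov_norm_band_limited[OF meyer(2,3) pq less_imp_le[OF rho] fin _ jM _ less_imp_le[OF s0]])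
        show "int M < snd i \<and> snd i < 3 * int M" if "i \<in> ?I" for i using that by auto
        show "\<bar>\<Sum>i\<in>?I. (e * triangle_coeff M (snd i)) * cos (2 * pi * of_int (snd i) * t - 2 * pi * of_int (snd i) * (real (fst i) / M))\<bar> \<le> e * M" for t
          using bd[of t] unfolding bump_sum_cos .
      qed
      also have "\<dots> \<le> ennreal A"
      proof (rule ennreal_leI)
        have "real M powr s * real M powr (- s) = 1" using M0 by (simp add: powr_add[symmetric])
        then have level: "(9 * real M) powr s * (e * M * \<Psi>) = 9 powr s * (c * \<Psi>)"
          unfolding eM by (simp add: powr_mult)
        show "\<rho> * (2 ^ j0 * \<Phi>) + 4 * ((9 * real M) powr s * (e * M * \<Psi>)) \<le> A"
          unfolding level using rhoA cA by linarith
      qed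
      finally show ?thesis using L2 nn by (auto simp: besov_ball_def Lambda0_def)
    qed
    define \<delta> where "\<delta> = exp \<rho> * (2 / \<rho> * (e\<^sup>2 * Cg\<^sup>2 * real M powr (1 - 2 * \<nu>)) + 8 * (2 / \<rho> * (e * M)\<^sup>2)\<^sup>2)"
    have d0: "0 \<le> \<delta>" unfolding \<delta>_def using rho by simp
    have dn: "\<delta> \<le> 1 / real n"
    proof -
      have t1: "e\<^sup>2 * Cg\<^sup>2 * real M powr (1 - 2 * \<nu>) = c\<^sup>2 * Cg\<^sup>2 * real M powr (- r)"
      proof -
        have "e\<^sup>2 = (e * M)\<^sup>2 * (1 / (real M)\<^sup>2)" using M0 by (simp add: power_mult_distrib)
        also have "1 / (real M)\<^sup>2 = real M powr (- 2)"
          unfolding powr_minus[of "real M" 2] using powr_realpow[of "real M" 2] M0 by (simp add: divide_inverse)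
        finally have "e\<^sup>2 = c\<^sup>2 * real M powr (- 2 * s) * real M powr (- 2)" unfolding eMsq .
        then have "e\<^sup>2 * real M powr (1 - 2 * \<nu>) = c\<^sup>2 * (real M powr (- 2 * s) * real M powr (- 2) * real M powr (1 - 2 * \<nu>))" by simp
        also have "real M powr (- 2 * s) * real M powr (- 2) * real M powr (1 - 2 * \<nu>) = real M powr (- r)"
          unfolding powr_add[symmetric] by (simp add: r_def algebra_simps)
        finally show ?thesis by (simp add: mult_ac)
      qed
      have t2: "((e * M)\<^sup>2)\<^sup>2 \<le> c\<^sup>2 * real M powr (- r)"
      proof -
        have "((e * M)\<^sup>2)\<^sup>2 = (c\<^sup>2)\<^sup>2 * real M powr (- 4 * s)"
          unfolding eMsq by (simp add: power_mult_distrib power2_eq_square powr_add[symmetric])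
        also have "\<dots> \<le> c\<^sup>2 * real M powr (- r)"
        proof (intro mult_mono)
          have "c\<^sup>2 \<le> 1" using csq c_le(1) by linarith
          then show "(c\<^sup>2)\<^sup>2 \<le> c\<^sup>2"
            unfolding power2_eq_square[of "c\<^sup>2"] by (rule mult_left_le) simp
          \<comment> \<open>This is where the smoothness enters: the fourth power of the amplitude
            has to stay below the order \<open>M powr (- r)\<close>, that is
            \<open>4 * s \<ge> 2 * s + 2 * \<nu> + 1\<close>.\<close>
          show "real M powr (- 4 * s) \<le> real M powr (- r)" using M1 s A1(1) by (intro powr_mono) (auto simp: r_def)
        qed auto
        finally show ?thesis .
      qed
      have "8 * (2 / \<rho> * (e * M)\<^sup>2)\<^sup>2 = 32 / \<rho>\<^sup>2 * ((e * M)\<^sup>2)\<^sup>2" by (simp add: power_mult_distrib power_divide)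
      also have "\<dots> \<le> 32 / \<rho>\<^sup>2 * (c\<^sup>2 * real M powr (- r))" using t2 by (intro mult_left_mono) auto
      finally have "\<delta> \<le> exp \<rho> * (2 / \<rho> * (c\<^sup>2 * Cg\<^sup>2 * real M powr (- r)) + 32 / \<rho>\<^sup>2 * (c\<^sup>2 * real M powr (- r)))"
        unfolding \<delta>_def t1 by (intro mult_left_mono add_left_mono) auto
      also have "\<dots> = c\<^sup>2 * K * real M powr (- r)" unfolding K_def by (simp add: algebra_simps)
      also have "\<dots> \<le> 1 * real M powr (- r)" by (intro mult_right_mono cK) auto
      also have "\<dots> = 1 / real M powr r" by (simp add: powr_minus divide_inverse)
      also have "\<dots> \<le> 1 / real n" using Mr n(1) M0 by (intro divide_left_mono mult_pos_pos) auto
      finally show ?thesis .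
    qed
    have chi: "(1 + \<delta>) ^ n \<le> 3"
    proof -
      \<comment> \<open>\<open>1 + x \<le> exp x\<close> bounds the power by \<open>exp 1\<close>,
        uniformly in \<open>n\<close>.\<close>
      have "(1 + \<delta>) ^ n \<le> (exp (1 / real n)) ^ n"
        using dn d0 exp_ge_add_one_self[of "1 / real n"] by (intro power_mono) linarith+
      also have "\<dots> = exp 1" using n(1) by (simp add: exp_of_nat_mult[symmetric])
      also have "exp (1 :: real) \<le> 3" by (rule exp_le)
      finally show ?thesis .
    qed
    have "ennreal ((e * M)\<^sup>2 / 576) \<le> (SUP lam\<in>besov_ball \<phi> \<psi> j0 s p q A \<inter> Lambda0. risk g n est lam)"
    proof (rule assouad_risk_bound[OF sg M0 e0 rho _ _ less_imp_le[OF A1(1)] _ _ est _ chi[unfolded \<delta>_def]])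
      show "e * M \<le> \<rho> / 2" using eMc c_le(2) by linarith
      have "(e * M)\<^sup>2 \<le> c\<^sup>2" using eMc e0 by (intro power_mono) auto
      then have "(e * M)\<^sup>2 \<le> \<rho> / 2" using csq c_le(2) by linarith
      then have "2 / \<rho> * (e * M)\<^sup>2 \<le> 2 / \<rho> * (\<rho> / 2)" using rho by (intro mult_left_mono) auto
      then show "2 / \<rho> * (e * M)\<^sup>2 \<le> 1" using rho by simp
      show "0 \<le> Cg" using A1 by linarith
      show "cmod (gamma_coeff g l) \<le> Cg * \<bar>real_of_int l\<bar> powr (- \<nu>)" if "l \<noteq> 0" for l :: int
        using A1(4)[OF that] by blast
      show "risk g n est (\<lambda>t. \<rho> + bump_sum e M S t) \<le> (SUP lam\<in>besov_ball \<phi> \<psi> j0 s p q A \<inter> Lambda0. risk g n est lam)"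
        if "S \<subseteq> {..<M}" for S
        by (rule SUP_upper[OF mem[OF that]])
    qed
    moreover have "C0 * real n powr (- (2 * s / r)) \<le> (e * M)\<^sup>2 / 576"
    proof -
      have "2 powr (- 2 * s) * real n powr (- (2 * s / r)) = (2 * real n powr (1 / r)) powr (- 2 * s)"
        by (simp add: powr_mult powr_powr)
      also have "\<dots> \<le> real M powr (- 2 * s)" using Mle M0 s0 by (intro powr_mono2') auto
      finally have "c\<^sup>2 * (2 powr (- 2 * s) * real n powr (- (2 * s / r))) \<le> c\<^sup>2 * real M powr (- 2 * s)"
        by (intro mult_left_mono) auto
      then show ?thesis unfolding eMsq C0_def by (simp add: mult_ac)
    qed
    ultimately show ?thesis by (meson ennreal_leI order_trans)
  qed
  \<comment> \<open>For large \<open>n\<close> the frequencies lie above the coarse level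
    \<open>j0\<close>, as \<open>besov_norm_band_limited\<close> requires.\<close>
  have "\<forall>\<^sub>F n in sequentially. 2 ^ j0 \<le> real n powr (1 / r)"
  proof -
    have "\<forall>\<^sub>F n in sequentially. (2 ^ j0) powr r \<le> real n"
      using filterlim_real_sequentially unfolding filterlim_at_top by blast
    then show ?thesis
    proof eventually_elim
      case (elim n)
      have "2 ^ j0 = ((2 ^ j0) powr r) powr (1 / r)" using r0 by (simp add: powr_powr)
      also have "\<dots> \<le> real n powr (1 / r)" using elim r0 by (intro powr_mono2) auto
      finally show ?case .
    qed
  qed
  then have "\<forall>\<^sub>F n in sequentially.
    (INF est\<in>estimators n. SUP lam\<in>besov_ball \<phi> \<psi> j0 s p q A \<inter> Lambda0. risk g n est lam)
      \<ge> ennreal (C0 * real n powr (- (2 * s / (2 * s + 2 * \<nu> + 1))))"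
    using eventually_ge_at_top[of 1]
  proof eventually_elim
    case (elim n)
    show ?case unfolding r_def[symmetric] by (rule INF_greatest) (rule lower[OF elim(2,1)])
  qed
  with C0pos show ?thesis by blast
qed

end
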